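(* Let $C$ be a $k$-dimensional tropical variety in $\mathbb{R}^d$, let $\omega_1,\ldots,\omega_n$ be the vertices of the polytope $P(C)$, and let $C_i$ be the tropical variety formed from the support of $\omega_i$ for each $i \in \{1,\ldots,n\}$. Then $C_1, \ldots, C_n$ are the distinct extremal tropical varieties of dimension $k$ contained in $C$. Furthermore, for each subset $S \subset \{1,\ldots,n\}$, the following two statements are equivalent. (1) $\{C_i : i \in S\}$ is an extremal decomposition of $C$. (2) The vertices $\{\omega_i : i \in S\}$ span $P(C)$; i.e., there exist scalars $\{t_i \in (0,1] : i \in S\}$ that satisfy $\sum_{i \in S} t_i = 1$ such that $\sum_{i \in S} t_i \omega_i$ is contained in the relative interior of $P(C)$.
   Context: Tropical varieties. Polyhedral complexes are finite and nonempty; their cells are convex polyhedra, possibly unbounded. Let $C \subset \mathbb{R}^d$ be a polyhedral complex of dimension $k$ (identified with its underlying set). $\widetilde{E}$ is the set of its $k$-dimensional cells (maximal faces) and $\widetilde{V}$ the set of its $(k-1)$-dimensional cells (ridges). $C$ is always assumed pure (every cell of dimension less than $k$ is a face of a $k$-dimensional cell) and rational: for each cell $\rho \in \widetilde{E}\cup\widetilde{V}$, with $L_\rho$ the linear space parallel to $\rho$, the lattice $L_\rho \cap \mathbb{Z}^d$ has rank $\dim \rho$. For $\tau \in \widetilde{V}$, $\sigma \in \widetilde{E}$ with $\tau \subset \sigma$, fix $z_\tau(\sigma) \in L_\sigma \cap \mathbb{Z}^d$ such that $L_\sigma \cap \mathbb{Z}^d = (L_\tau \cap \mathbb{Z}^d)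 + \mathbb{Z} z_\tau(\sigma)$ and $x + \lambda z_\tau(\sigma) \in \sigma$ for some $x \in \tau$, $\lambda > 0$ (it is unique modulo $L_\tau \cap \mathbb{Z}^d$). A map $\omega: \widetilde{E} \to \mathbb{R}_{\geq 0}$ is balanced if for every $\tau \in \widetilde{V}$, $\sum_{\sigma \supset \tau} \omega(\sigma) z_\tau(\sigma) \in L_\tau$ (sum over $\sigma \in \widetilde{E}$ having $\tau$ as a face); it is a weighting if its values lie in $\mathbb{Z}_{>0}$. $C$ is a tropical variety of dimension $k$ if it has a balanced weighting. A tropical variety $C$ is extremal if it cannot be written as $C = C_1 \cup C_2$ with $C_1, C_2$ tropical varieties in $\mathbb{R}^d$ that are both proper subsets of $C$. The tropical variety formed from the support of a nonzero balanced map $\omega: \widetilde{E} \to \mathbb{R}_{\geq 0}$ is the set $\bigcup\{\sigma \in \widetilde{E} : \omega(\sigma)>0\}$. A set of distinct extremal tropical varieties $\{C_1,\ldots,C_m\}$ (of the same dimension as $C$) contained in $C$ is an extremal decomposition of $C$ if $C = \bigcup_i C_i$. $W(C) \subset \mathbb{R}^{\widetilde{E}}$ is the cone of balanced maps $\omega: \widetilde{E} \to \mathbb{R}_{\geq 0}$, and $P(C) := W(C) \cap \{x \in \mathbb{R}^{\widetilde{E}} : \sum_{\sigma \in \widetilde{E}} x_\sigma = 1\}$, a convex polytope. *)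

theory Defs
  imports "HOL-Analysis.Analysis"
begin

text \<open>Cells are nonempty by convention, so that the complexes of dimension 0 are the finite
  nonempty sets of points and have no ridges.  The intersection of two cells may still be empty;
  the empty set is a face of everything in the sense of \<^const>\<open>face_of\<close>.\<close>

definition polyhedral_complex :: "(real^'d) set set \<Rightarrow> bool" where
  "polyhedral_complex X \<longleftrightarrow>
     finite X \<and> X \<noteq> {} \<and>
     (\<forall>\<rho>\<in>X. polyhedron \<rho> \<and> \<rho> \<noteq> {}) \<and>
     (\<forall>\<rho>\<in>X. \<forall>F. F face_of \<rho> \<and> F \<noteq> {} \<longrightarrow> F \<in> X) \<and>
     (\<forall>\<rho>\<in>X. \<forall>\<rho>'\<in>X. (\<rho> \<inter> \<rho>') face_of \<rho> \<and> (\<rho> \<inter> \<rho>') face_of \<rho>')"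

definition complex_dim :: "(real^'d) set set \<Rightarrow> int" where
  "complex_dim X = Max (aff_dim ` X)"

definition facets :: "(real^'d) set set \<Rightarrow> (real^'d) set set" where
  "facets X = {\<sigma>\<in>X. aff_dim \<sigma> = complex_dim X}"

definition ridges :: "(real^'d) set set \<Rightarrow> (real^'d) set set" where
  "ridges X = {\<tau>\<in>X. aff_dim \<tau> = complex_dim X - 1}"

definition pure_complex :: "(real^'d) set set \<Rightarrow> bool" where
  "pure_complex X \<longleftrightarrow>
     (\<forall>\<rho>\<in>X. aff_dim \<rho> < complex_dim X \<longrightarrow> (\<exists>\<sigma>\<in>facets X. \<rho> face_of \<sigma>))"

definition parallel_space :: "(real^'d) set \<Rightarrow> (real^'d) set" where
  "parallel_space \<rho> = {x - y | x y. x \<in> affine hull \<rho> \<and> y \<in> affine hull \<rho>}"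

definition integer_points :: "(real^'d) set" where
  "integer_points = {x. \<forall>i. x $ i \<in> \<int>}"

definition cell_lattice :: "(real^'d) set \<Rightarrow> (real^'d) set" where
  "cell_lattice \<rho> = parallel_space \<rho> \<inter> integer_points"

text \<open>A lattice of rank \<open>r\<close> is the integer span of \<open>r\<close> linearly independent vectors.  (For
  integer vectors, independence over the reals and over the integers coincide.)\<close>

definition has_lattice_rank :: "(real^'d) set \<Rightarrow> nat \<Rightarrow> bool" where
  "has_lattice_rank \<Lambda> r \<longleftrightarrow>
     (\<exists>B. finite B \<and> independent B \<and> card B = r \<and>
          \<Lambda> = {\<Sum>b\<in>B. of_int (c b) *\<^sub>R b | c :: real^'d \<Rightarrow> int. True})"

definition rational_complex :: "(real^'d) set set \<Rightarrow> bool" where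
  "rational_complex X \<longleftrightarrow>
     (\<forall>\<rho>\<in>facets X \<union> ridges X. \<exists>r. has_lattice_rank (cell_lattice \<rho>) r \<and> int r = aff_dim \<rho>)"

text \<open>\<open>z\<close> is an admissible choice of \<open>z\<^sub>\<tau>(\<sigma>)\<close>.\<close>

definition lattice_normal :: "(real^'d) set \<Rightarrow> (real^'d) set \<Rightarrow> real^'d \<Rightarrow> bool" where
  "lattice_normal \<tau> \<sigma> z \<longleftrightarrow>
     z \<in> cell_lattice \<sigma> \<and>
     cell_lattice \<sigma> = {a + of_int m *\<^sub>R z | a m. a \<in> cell_lattice \<tau>} \<and>
     (\<exists>x\<in>\<tau>. \<exists>l>0. x + l *\<^sub>R z \<in> \<sigma>)"

definition star_facets :: "(real^'d) set set \<Rightarrow> (real^'d) set \<Rightarrow> (real^'d) set set" where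
  "star_facets X \<tau> = {\<sigma>\<in>facets X. \<tau> face_of \<sigma>}"

text \<open>In a rational complex admissible vectors \<open>z\<^sub>\<tau>(\<sigma>)\<close> exist and are unique modulo
  \<open>cell_lattice \<tau>\<close>, so the condition below does not depend on the choice of \<open>z\<close>.  Only the
  values of \<open>\<omega>\<close> on \<open>facets X\<close> matter.\<close>

definition balanced :: "(real^'d) set set \<Rightarrow> ((real^'d) set \<Rightarrow> real) \<Rightarrow> bool" where
  "balanced X \<omega> \<longleftrightarrow>
     (\<forall>\<sigma>\<in>facets X. 0 \<le> \<omega> \<sigma>) \<and>
     (\<forall>\<tau>\<in>ridges X. \<exists>z. (\<forall>\<sigma>\<in>star_facets X \<tau>. lattice_normal \<tau> \<sigma> (z \<sigma>)) \<and>
        (\<Sum>\<sigma>\<in>star_facets X \<tau>. \<omega> \<sigma> *\<^sub>R z \<sigma>) \<in> parallel_space \<tau>)"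

definition weighting :: "(real^'d) set set \<Rightarrow> ((real^'d) set \<Rightarrow> real) \<Rightarrow> bool" where
  "weighting X \<omega> \<longleftrightarrow> (\<forall>\<sigma>\<in>facets X. \<omega> \<sigma> \<in> \<int> \<and> 0 < \<omega> \<sigma>)"

definition tropical_complex :: "(real^'d) set set \<Rightarrow> bool" where
  "tropical_complex X \<longleftrightarrow>
     polyhedral_complex X \<and> pure_complex X \<and> rational_complex X \<and>
     (\<exists>\<omega>. balanced X \<omega> \<and> weighting X \<omega>)"

text \<open>As a subset of the ambient space, a tropical variety may carry many cell structures; one
  of them has to satisfy the conditions.\<close>

definition tropical_variety :: "nat \<Rightarrow> (real^'d) set \<Rightarrow> bool" where
  "tropical_variety k C \<longleftrightarrow> (\<exists>X. tropical_complex X \<and> complex_dim X = int k \<and> C = \<Union>X)"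

text \<open>The two pieces of a forbidden splitting may a priori have any dimension.\<close>

definition extremal_tropical_variety :: "nat \<Rightarrow> (real^'d) set \<Rightarrow> bool" where
  "extremal_tropical_variety k C \<longleftrightarrow>
     tropical_variety k C \<and>
     \<not> (\<exists>C1 C2 k1 k2. tropical_variety k1 C1 \<and> tropical_variety k2 C2 \<and>
           C1 \<subset> C \<and> C2 \<subset> C \<and> C = C1 \<union> C2)"

definition extremal_decomposition :: "nat \<Rightarrow> (real^'d) set set \<Rightarrow> (real^'d) set \<Rightarrow> bool" where
  "extremal_decomposition k \<D> C \<longleftrightarrow>
     finite \<D> \<and> (\<forall>D\<in>\<D>. extremal_tropical_variety k D \<and> D \<subseteq> C) \<and> C = \<Union>\<D>"

text \<open>To have the real vector space with coordinates indexed by the facets available as a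
  Euclidean space, the facets are enumerated by a bijection \<open>cell\<close> from a finite type \<open>'e\<close>.\<close>

definition balanced_cone ::
    "('e::finite \<Rightarrow> (real^'d) set) \<Rightarrow> (real^'d) set set \<Rightarrow> (real^'e) set" where
  "balanced_cone cell X = {\<chi> e. \<omega> (cell e) | \<omega>. balanced X \<omega>}"

definition balanced_polytope ::
    "('e::finite \<Rightarrow> (real^'d) set) \<Rightarrow> (real^'d) set set \<Rightarrow> (real^'e) set" where
  "balanced_polytope cell X = balanced_cone cell X \<inter> {x. (\<Sum>e\<in>UNIV. x $ e) = 1}"

definition support_variety :: "('e::finite \<Rightarrow> (real^'d) set) \<Rightarrow> real^'e \<Rightarrow> (real^'d) set" where
  "support_variety cell x = \<Union>{cell e | e. 0 < x $ e}"

end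

theory Submission
  imports Defs
begin

text \<open>The balanced maps are the nonnegative points of a linear subspace, because the lattice normals
  are unique modulo the lattice of the ridge.  So \<open>P(C)\<close> is a section of the standard
  simplex: a point is a vertex iff its support is minimal, every other point has the union of
  two strictly smaller supports as its support, and the relative interior consists of the points of
  full support.  The theorem follows once the tropical varieties of dimension \<open>k\<close> inside
  \<open>C\<close> are known to be exactly the supports of the points of \<open>P(C)\<close>.

  Supports of balanced maps are tropical varieties by simultaneous Diophantine approximation, which
  turns a real balanced map into an integral one with the same support.  Conversely, the weights of a
  tropical variety contained in \<open>C\<close>, with its own cell structure, are constant on the relative
  interior of each facet of \<open>C\<close>, because balancing carries them across the ridges met by a
  generic segment.  The resulting map is balanced, as comparing both structures at a generic point of
  a ridge of \<open>C\<close> shows.\<close>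

section \<open>Parallel spaces\<close>

text \<open>The obstacle is that a tropical variety inside \<open>C\<close> comes with cells
  unrelated to those of \<open>C\<close>, and a common refinement would have to be proved rational
  and balanced anew. The two structures are therefore compared only along short rays from one point:
  a ray that stays in a finite union of convex sets stays in one of them, and a ray entering the
  relative interiors of two cells ties their weights and normals together. Lattice data alone fix a
  normal only up to sign; the ray supplies the sign. The starting points avoid finitely many affine
  hulls, so that their carriers have the expected dimension. Extremality forbids splittings into
  pieces of any dimension, while the polytope sees only dimension \<open>k\<close>: a dimension
  count shows that one piece has dimension \<open>k\<close>, and the support of a vertex contains
  not even one proper subvariety of that dimension.\<close>

lemma parallel_space_eq_image:
  assumes "a \<in> affine hull S"
  shows "parallel_space S = (+) (- a) ` (affine hull S)"
proof
  show "parallel_space S \<subseteq> (+) (- a) ` (affine hull S)"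
  proof
    fix v assume "v \<in> parallel_space S"
    then obtain x y where "x \<in> affine hull S" "y \<in> affine hull S" "v = x - y"
      by (auto simp: parallel_space_def)
    moreover from this have "a + 1 *\<^sub>R (x - y) \<in> affine hull S"
      using assms by (intro mem_affine_3_minus affine_affine_hull)
    ultimately show "v \<in> (+) (- a) ` (affine hull S)"
      by (intro image_eqI[of _ _ "a + 1 *\<^sub>R (x - y)"]) auto
  qed
  show "(+) (- a) ` (affine hull S) \<subseteq> parallel_space S"
    using assms by (fastforce simp: parallel_space_def)
qed

lemma subspace_parallel_space: "S \<noteq> {} \<Longrightarrow> subspace (parallel_space S)"
  by (metis affine_affine_hull affine_diffs_subspace affine_hull_eq_empty ex_in_conv
      parallel_space_eq_image)

lemma dim_parallel_space: "S \<noteq> {} \<Longrightarrow> int (dim (parallel_space S)) = aff_dim S"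
  by (metis aff_dim_affine_hull aff_dim_eq_dim affine_hull_eq_empty ex_in_conv hull_hull
      parallel_space_eq_image)

lemma diff_in_parallel_space:
  "x \<in> affine hull S \<Longrightarrow> y \<in> affine hull S \<Longrightarrow> x - y \<in> parallel_space S"
  by (auto simp: parallel_space_def)

lemma add_parallel_space_iff:
  "a \<in> affine hull S \<Longrightarrow> a + v \<in> affine hull S \<longleftrightarrow> v \<in> parallel_space S"
  by (auto simp: parallel_space_eq_image) (metis add.commute add_diff_cancel_left' imageI uminus_add_conv_diff)

lemma parallel_space_mono: "S \<subseteq> affine hull T \<Longrightarrow> parallel_space S \<subseteq> parallel_space T"
  unfolding parallel_space_def by (smt (verit) Collect_mono affine_affine_hull hull_minimal subsetD)

lemma parallel_space_eqI:
  assumes "parallel_space S \<subseteq> parallel_space T" "aff_dim S = aff_dim T" "S \<noteq> {}" "T \<noteq> {}"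
  shows "parallel_space S = parallel_space T"
  using assms dim_parallel_space[of S] dim_parallel_space[of T]
  by (intro subspace_dim_equal subspace_parallel_space) auto

lemma rel_interior_in_hull: "x \<in> rel_interior S \<Longrightarrow> x \<in> affine hull S"
  by (meson hull_inc rel_interior_subset subsetD)

lemma rel_interior_face_mem: "T face_of S \<Longrightarrow> x \<in> rel_interior T \<Longrightarrow> x \<in> S"
  by (meson face_of_imp_subset rel_interior_subset subsetD)

section \<open>Generic points\<close>

text \<open>A nonempty relatively open part of \<open>affine hull S\<close> has the same affine
  hull, so no \<open>affine hull T\<close> contains it. Removing these closed sets one at a time
  keeps the set nonempty and relatively open, which is what the induction carries in
  \<open>U\<close>.\<close>

lemma generic_point:
  fixes S U :: "'a::euclidean_space set"
  assumes "finite F" "openin (top_of_set (affine hull S)) U" "U \<noteq> {}"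
    and "\<And>T. T \<in> F \<Longrightarrow> \<not> S \<subseteq> affine hull T"
  obtains x where "x \<in> U" "\<And>T. T \<in> F \<Longrightarrow> x \<notin> affine hull T"
proof -
  have "\<exists>x\<in>U. \<forall>T\<in>F. x \<notin> affine hull T"
    using assms
  proof (induction F arbitrary: U)
    case empty
    then show ?case by auto
  next
    case (insert T F)
    let ?U = "U - affine hull T"
    have "\<not> U \<subseteq> affine hull T"
    proof
      assume "U \<subseteq> affine hull T"
      then have "affine hull U \<subseteq> affine hull T"
        by (simp add: hull_minimal)
      moreover have "affine hull U = affine hull S"
        using insert.prems by (intro affine_hull_openin)
      ultimately show False
        using insert.prems(3)[of T] hull_subset[of S affine] by auto
    qed
    moreover have "?U = U \<inter> - (affine hull T)"
      by auto
    then have "openin (top_of_set (affine hull S)) ?U"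
      using insert.prems(1) by (simp add: openin_Int_open open_Compl)
    ultimately have "\<exists>x\<in>?U. \<forall>T\<in>F. x \<notin> affine hull T"
      using insert.prems(3) by (intro insert.IH) auto
    then show ?case by auto
  qed
  then show ?thesis using that by blast
qed

section \<open>Germs of rays\<close>

text \<open>The germ at \<open>x\<close> of the ray in direction \<open>v\<close>. The point
  \<open>x\<close> itself is exempt, so a ray may start on the boundary and enter the relative
  interior; only small times count, so the notion passes to finite intersections.\<close>

definition enters :: "'a::real_normed_vector \<Rightarrow> 'a \<Rightarrow> 'a set \<Rightarrow> bool" where
  "enters x v S \<longleftrightarrow> (\<forall>\<^sub>F t in at_right 0. x + t *\<^sub>R v \<in> S)"

lemma enters_mono: "enters x v S \<Longrightarrow> S \<subseteq> T \<Longrightarrow> enters x v T"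
  unfolding enters_def by (auto elim: eventually_mono)

lemma enters_Int: "enters x v (S \<inter> T) \<longleftrightarrow> enters x v S \<and> enters x v T"
  unfolding enters_def by (simp add: eventually_conj_iff)

lemma enters_obtains:
  assumes "enters x v S"
  obtains t where "t > 0" "x + t *\<^sub>R v \<in> S"
proof -
  have "\<forall>\<^sub>F t in at_right 0. t > 0 \<and> x + t *\<^sub>R v \<in> S"
    using assms unfolding enters_def by (intro eventually_conj eventually_at_right_less)
  then show ?thesis
    using that by (metis (no_types, lifting) eventually_False eventually_mono trivial_limit_at_right_real)
qed

text \<open>A ray that does not eventually avoid \<open>S\<close> meets it at arbitrarily small
  times, and convexity fills the gap between such a time and one fixed hit.\<close>

lemma enters_convex_cases:
  assumes "convex S"
  shows "enters x v S \<or> enters x v (- S)"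
proof (rule disjCI)
  assume "\<not> enters x v (- S)"
  then have *: "\<exists>t>0. t < b \<and> x + t *\<^sub>R v \<in> S" if "b > 0" for b
    using that unfolding enters_def eventually_at_right_field by auto
  obtain b where b: "b > 0" "x + b *\<^sub>R v \<in> S"
    using *[of 1] by auto
  have "x + t *\<^sub>R v \<in> S" if t: "0 < t" "t < b" for t
  proof -
    obtain s where s: "s > 0" "s < t" "x + s *\<^sub>R v \<in> S"
      using *[of t] t by auto
    \<comment> \<open>The position of the time \<open>t\<close> between the hits at \<open>s\<close>
      and \<open>b\<close>.\<close>
    define u where "u = (t - s) / (b - s)"
    have u: "0 \<le> u" "u \<le> 1"
      using s t by (auto simp: u_def)
    have "u * (b - s) = t - s"
      using s t by (simp add: u_def)
    then have tu: "t = (1 - u) * s + u * b"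
      by (simp add: algebra_simps)
    have "(1 - u) *\<^sub>R (x + s *\<^sub>R v) + u *\<^sub>R (x + b *\<^sub>R v) \<in> S"
      using convexD_alt[OF assms s(3) b(2) u] .
    also have "(1 - u) *\<^sub>R (x + s *\<^sub>R v) + u *\<^sub>R (x + b *\<^sub>R v) = x + t *\<^sub>R v"
      by (simp add: tu algebra_simps)
    finally show ?thesis .
  qed
  then show "enters x v S"
    unfolding enters_def eventually_at_right_field using b(1) by auto
qed

text \<open>If no member were entered, the ray would eventually avoid each of the finitely many
  members, hence their union.\<close>

lemma enters_Union:
  assumes "finite F" "\<And>S. S \<in> F \<Longrightarrow> convex S" "enters x v (\<Union>F)"
  obtains S where "S \<in> F" "enters x v S"
proof (rule ccontr)
  assume "\<not> thesis"
  then have "\<forall>S\<in>F. enters x v (- S)"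
    using assms(2) enters_convex_cases that by blast
  then have "\<forall>\<^sub>F t in at_right 0. \<forall>S\<in>F. x + t *\<^sub>R v \<in> - S"
    unfolding enters_def using assms(1) by (simp add: eventually_ball_finite)
  then have "enters x v (\<Inter>S\<in>F. - S)"
    unfolding enters_def by (auto elim: eventually_mono)
  then have "enters x v ((\<Inter>S\<in>F. - S) \<inter> \<Union>F)"
    using assms(3) enters_Int by blast
  then show False
    by (rule enters_obtains) auto
qed

lemma enters_closed:
  assumes "enters x v S" "closed S"
  shows "x \<in> S"
proof -
  have "((\<lambda>t. x + t *\<^sub>R v) \<longlongrightarrow> x + 0 *\<^sub>R v) (at_right 0)"
    by (intro tendsto_intros)
  then show ?thesis
    using assms Lim_in_closed_set[of S "\<lambda>t. x + t *\<^sub>R v" "at_right 0" x]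
    by (auto simp: enters_def)
qed

lemma enters_parallel_space:
  assumes "enters x v S" "x \<in> affine hull S"
  shows "v \<in> parallel_space S"
proof -
  obtain t where t: "t > 0" "x + t *\<^sub>R v \<in> S"
    using assms(1) by (rule enters_obtains)
  have tv: "t *\<^sub>R v \<in> parallel_space S"
    using t(2) add_parallel_space_iff[OF assms(2)] hull_inc by metis
  then have "(1/t) *\<^sub>R t *\<^sub>R v \<in> parallel_space S"
    using assms(2) by (intro subspace_scale[OF subspace_parallel_space] tv) auto
  then show ?thesis using t by simp
qed

text \<open>The relative interior is open in the affine hull, and the ray never leaves that
  hull.\<close>

lemma enters_rel_interior:
  assumes "x \<in> rel_interior S" "v \<in> parallel_space S"
  shows "enters x v (rel_interior S)"
proof -
  have xS: "x \<in> affine hull S"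
    using assms(1) rel_interior_subset hull_subset by (metis subsetD)
  obtain T where T: "open T" "rel_interior S = affine hull S \<inter> T"
    using openin_rel_interior[of S] by (auto simp: openin_open)
  have "((\<lambda>t. x + t *\<^sub>R v) \<longlongrightarrow> x + 0 *\<^sub>R v) (at_right 0)"
    by (intro tendsto_intros)
  then have "\<forall>\<^sub>F t in at_right 0. x + t *\<^sub>R v \<in> T"
    using T assms(1) by (intro topological_tendstoD) auto
  moreover have "x + t *\<^sub>R v \<in> affine hull S" for t
    using xS assms(2) subspace_scale[OF subspace_parallel_space] affine_hull_empty
    by (metis add_parallel_space_iff empty_iff)
  ultimately show ?thesis
    unfolding enters_def T(2) by simp
qed

section \<open>Cells of polyhedral complexes\<close>

lemma polyhedral_complex_cell:
  assumes "polyhedral_complex X" "\<rho> \<in> X"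
  shows "polyhedron \<rho>" "\<rho> \<noteq> {}" "convex \<rho>" "closed \<rho>"
proof -
  show "polyhedron \<rho>" "\<rho> \<noteq> {}"
    using assms unfolding polyhedral_complex_def by blast+
  then show "convex \<rho>" "closed \<rho>"
    by (simp_all add: polyhedron_imp_convex polyhedron_imp_closed)
qed

lemma polyhedral_complex_finite: "polyhedral_complex X \<Longrightarrow> finite X"
  by (rule conjunct1) (unfold polyhedral_complex_def)

lemma polyhedral_complex_face:
  "polyhedral_complex X \<Longrightarrow> \<rho> \<in> X \<Longrightarrow> F face_of \<rho> \<Longrightarrow> F \<noteq> {} \<Longrightarrow> F \<in> X"
  unfolding polyhedral_complex_def by blast

lemma aff_dim_le_complex_dim:
  "polyhedral_complex X \<Longrightarrow> \<rho> \<in> X \<Longrightarrow> aff_dim \<rho> \<le> complex_dim X"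
  by (simp add: polyhedral_complex_finite complex_dim_def)

lemma facets_nonempty:
  assumes "polyhedral_complex X"
  shows "facets X \<noteq> {}"
proof -
  have "complex_dim X \<in> aff_dim ` X"
    unfolding complex_dim_def using assms polyhedral_complex_finite
    by (intro Max_in) (auto simp only: polyhedral_complex_def finite_imageI image_is_empty)
  then show ?thesis
    by (auto simp: facets_def)
qed

text \<open>A cell of least dimension through \<open>x\<close> works: on the relative frontier of a
  polyhedron, \<open>x\<close> would lie in one of its facets, a cell of smaller dimension.\<close>

lemma obtains_carrier:
  assumes "polyhedral_complex X" "x \<in> \<Union>X"
  obtains \<rho> where "\<rho> \<in> X" "x \<in> rel_interior \<rho>"
proof -
  obtain \<rho>0 where "\<rho>0 \<in> X \<and> x \<in> \<rho>0"
    using assms(2) by blast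
  from ex_has_least_nat[of "\<lambda>\<rho>. \<rho> \<in> X \<and> x \<in> \<rho>", OF this, of "\<lambda>\<rho>. nat (aff_dim \<rho>)"]
  obtain \<rho> where \<rho>: "\<rho> \<in> X" "x \<in> \<rho>"
    and least: "\<And>\<rho>'. \<rho>' \<in> X \<Longrightarrow> x \<in> \<rho>' \<Longrightarrow> nat (aff_dim \<rho>) \<le> nat (aff_dim \<rho>')"
    by blast
  note cell = polyhedral_complex_cell[OF assms(1) \<rho>(1)]
  have "x \<in> rel_interior \<rho>"
  proof (rule ccontr)
    assume "x \<notin> rel_interior \<rho>"
    then have "x \<in> rel_frontier \<rho>"
      using \<rho>(2) closure_subset by (auto simp: rel_frontier_def)
    then obtain F where F: "F facet_of \<rho>" "x \<in> F"
      using rel_frontier_of_polyhedron[OF cell(1)] by auto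
    then have "F \<in> X"
      using polyhedral_complex_face[OF assms(1) \<rho>(1)] by (simp add: facet_of_def)
    \<comment> \<open>Nonnegativity matters because \<open>nat\<close> in the measure does not
      distinguish the dimensions -1 and 0.\<close>
    moreover have "aff_dim F < aff_dim \<rho>" "0 \<le> aff_dim F"
      using F aff_dim_negative_iff[of F] by (auto simp: facet_of_def)
    ultimately show False
      using least[OF _ F(2)] by force
  qed
  with \<rho>(1) show ?thesis using that by blast
qed

text \<open>The face \<open>\<rho> \<inter> \<rho>'\<close> of \<open>\<rho>\<close> contains a
  relative interior point of \<open>\<rho>\<close>, so it is all of \<open>\<rho>\<close>.\<close>

lemma carrier_face_of:
  assumes "polyhedral_complex X" "\<rho> \<in> X" "\<rho>' \<in> X" "x \<in> rel_interior \<rho>" "x \<in> \<rho>'"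
  shows "\<rho> face_of \<rho>'"
proof -
  have f: "\<rho> \<inter> \<rho>' face_of \<rho>" "\<rho> \<inter> \<rho>' face_of \<rho>'"
    using assms(1-3) unfolding polyhedral_complex_def by blast+
  have "\<rho> \<subseteq> \<rho> \<inter> \<rho>'"
    using assms(4,5) rel_interior_subset by (intro subset_of_face_of[OF f(1)]) auto
  then show ?thesis
    using f(2) by (simp add: inf.absorb1)
qed

lemma carrier_unique:
  assumes "polyhedral_complex X" "\<rho> \<in> X" "\<rho>' \<in> X" "x \<in> rel_interior \<rho>" "x \<in> rel_interior \<rho>'"
  shows "\<rho> = \<rho>'"
  using assms carrier_face_of face_of_imp_subset rel_interior_subset by (metis subset_antisym subsetD)

lemma facet_eq:
  assumes "polyhedral_complex X" "\<sigma> \<in> facets X" "\<rho> \<in> X" "\<sigma> face_of \<rho>"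
  shows "\<rho> = \<sigma>"
  using assms face_of_aff_dim_lt[of \<rho> \<sigma>] polyhedral_complex_cell(3)[of X \<rho>]
    aff_dim_le_complex_dim[of X \<rho>] by (force simp: facets_def)

lemma facet_carrier_eq:
  assumes "polyhedral_complex X" "\<sigma> \<in> facets X" "\<rho> \<in> X" "x \<in> rel_interior \<sigma>" "x \<in> \<rho>"
  shows "\<rho> = \<sigma>"
  using assms carrier_face_of facet_eq unfolding facets_def by blast

lemma face_of_facet:
  assumes "polyhedral_complex X" "pure_complex X" "\<rho> \<in> X"
  obtains \<sigma> where "\<sigma> \<in> facets X" "\<rho> face_of \<sigma>"
proof (cases "aff_dim \<rho> < complex_dim X")
  case True
  then show ?thesis using assms that by (auto simp: pure_complex_def)
next
  case False
  then have "\<rho> \<in> facets X"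
    using aff_dim_le_complex_dim[OF assms(1,3)] assms(3) by (simp add: facets_def)
  then show ?thesis
    using that face_of_refl polyhedral_complex_cell(3)[OF assms(1,3)] by blast
qed

lemma Union_facets:
  assumes "polyhedral_complex X" "pure_complex X"
  shows "\<Union>(facets X) = \<Union>X"
proof
  show "\<Union>(facets X) \<subseteq> \<Union>X"
    by (auto simp: facets_def)
  show "\<Union>X \<subseteq> \<Union>(facets X)"
  proof
    fix x assume "x \<in> \<Union>X"
    then obtain \<rho> where "\<rho> \<in> X" "x \<in> \<rho>" by blast
    then obtain \<sigma> where "\<sigma> \<in> facets X" "\<rho> face_of \<sigma>"
      using face_of_facet[OF assms] by blast
    then show "x \<in> \<Union>(facets X)"
      using face_of_imp_subset \<open>x \<in> \<rho>\<close> by blast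
  qed
qed

lemma finite_facets: "polyhedral_complex X \<Longrightarrow> finite (facets X)"
  and finite_ridges: "polyhedral_complex X \<Longrightarrow> finite (ridges X)"
  and finite_star_facets: "polyhedral_complex X \<Longrightarrow> finite (star_facets X \<tau>)"
  by (simp_all add: polyhedral_complex_finite facets_def ridges_def star_facets_def)

lemma enters_facet:
  assumes "polyhedral_complex X" "pure_complex X" "enters x v (\<Union>X)"
  obtains \<sigma> where "\<sigma> \<in> facets X" "enters x v \<sigma>" "x \<in> \<sigma>"
proof -
  have "enters x v (\<Union>(facets X))"
    using assms by (simp add: Union_facets)
  then obtain \<sigma> where \<sigma>: "\<sigma> \<in> facets X" "enters x v \<sigma>"
    using finite_facets[OF assms(1)] polyhedral_complex_cell(3)[OF assms(1)]
    by (elim enters_Union[rotated 2]) (auto simp: facets_def)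
  moreover have "x \<in> \<sigma>"
    using \<sigma> polyhedral_complex_cell(4)[OF assms(1)]
    by (intro enters_closed) (auto simp: facets_def)
  ultimately show ?thesis using that by blast
qed

lemma enters_star_facet:
  assumes "polyhedral_complex X" "pure_complex X" "\<tau> \<in> X" "x \<in> rel_interior \<tau>"
    and "enters x v (\<Union>X)"
  obtains \<sigma> where "\<sigma> \<in> star_facets X \<tau>" "enters x v \<sigma>"
proof -
  obtain \<sigma> where "\<sigma> \<in> facets X" "enters x v \<sigma>" "x \<in> \<sigma>"
    using assms(1,2,5) by (rule enters_facet)
  then show ?thesis
    using that carrier_face_of[OF assms(1,3) _ assms(4)] by (auto simp: star_facets_def facets_def)
qed

lemma enters_cell_unique:
  assumes "polyhedral_complex X" "\<rho> \<in> X" "\<rho>' \<in> X"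
    and "enters x v (rel_interior \<rho>)" "enters x v (rel_interior \<rho>')"
  shows "\<rho> = \<rho>'"
proof -
  have "enters x v (rel_interior \<rho> \<inter> rel_interior \<rho>')"
    using assms by (simp add: enters_Int)
  then show ?thesis
    by (rule enters_obtains) (use carrier_unique[OF assms(1-3)] in auto)
qed

section \<open>Inward normals\<close>

text \<open>The real shadow of \<open>lattice_normal\<close>: the lattice is forgotten, and what
  remains is that \<open>z\<close> spans \<open>parallel_space \<sigma>\<close> modulo
  \<open>parallel_space \<tau>\<close> and points into \<open>\<sigma>\<close>. The geometry of rays
  at \<open>\<tau>\<close> needs just this.\<close>

definition inward_normal :: "(real^'d) set \<Rightarrow> (real^'d) set \<Rightarrow> real^'d \<Rightarrow> bool" where
  "inward_normal \<tau> \<sigma> z \<longleftrightarrow>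
     \<tau> face_of \<sigma> \<and> z \<notin> parallel_space \<tau> \<and>
     parallel_space \<sigma> = {l + c *\<^sub>R z | l c. l \<in> parallel_space \<tau>} \<and>
     (\<exists>x\<in>\<tau>. \<exists>c>0. x + c *\<^sub>R z \<in> \<sigma>)"

text \<open>The face \<open>\<tau>\<close> bounds \<open>\<sigma>\<close> on one side. If
  \<open>c\<close> were negative, the segment from the given point to a point on the side of
  \<open>z\<close> would meet the affine hull of \<open>\<tau>\<close> inside
  \<open>\<sigma>\<close>. A face contains the endpoints of such a segment, which forces a nonzero
  multiple of \<open>z\<close> into \<open>parallel_space \<tau>\<close>.\<close>

lemma inward_normal_nonneg:
  assumes n: "inward_normal \<tau> \<sigma> z" and "convex \<sigma>"
    and x: "x \<in> affine hull \<tau>" and l: "l \<in> parallel_space \<tau>" and y: "x + (l + c *\<^sub>R z) \<in> \<sigma>"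
  shows "0 \<le> c"
proof (rule ccontr)
  assume c: "\<not> 0 \<le> c"
  obtain p a where p: "p \<in> \<tau>" "a > 0" "p + a *\<^sub>R z \<in> \<sigma>" and f: "\<tau> face_of \<sigma>"
    and z: "z \<notin> parallel_space \<tau>"
    using n by (auto simp: inward_normal_def)
  have "\<tau> \<noteq> {}"
    using p by auto
  then have sub: "subspace (parallel_space \<tau>)"
    by (rule subspace_parallel_space)
  have scaleD: "b = 0" if "b *\<^sub>R z \<in> parallel_space \<tau>" for b
    using subspace_scale[OF sub that, of "1/b"] z by (cases "b = 0") auto
  have paff: "p \<in> affine hull \<tau>"
    using p by (simp add: hull_inc)
  have xl: "x + l \<in> affine hull \<tau>"
    using x l by (simp add: add_parallel_space_iff)
  define y where "y = x + (l + c *\<^sub>R z)"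
  define w where "w = p + a *\<^sub>R z"
  \<comment> \<open>Chosen so that the coefficients of \<open>z\<close> in
    \<open>(1 - u) *\<^sub>R w + u *\<^sub>R y\<close> cancel.\<close>
  define u where "u = a / (a - c)"
  have u: "0 < u" "u < 1"
    using p(2) c by (auto simp: u_def field_simps)
  have "u * c + (1 - u) * a = 0"
    using p(2) c by (simp add: u_def field_simps)
  then have "(u * c) *\<^sub>R z + ((1 - u) * a) *\<^sub>R z = 0"
    by (metis scaleR_left_distrib scaleR_zero_left)
  then have m: "(1 - u) *\<^sub>R w + u *\<^sub>R y = (1 - u) *\<^sub>R p + u *\<^sub>R (x + l)"
    by (simp add: w_def y_def algebra_simps)
  have "(1 - u) *\<^sub>R w + u *\<^sub>R y \<in> affine hull \<tau>"
    unfolding m by (intro mem_affine affine_affine_hull paff xl) auto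
  moreover have "(1 - u) *\<^sub>R w + u *\<^sub>R y \<in> \<sigma>"
    using \<open>convex \<sigma>\<close> p(3) y u by (intro convexD_alt) (auto simp: w_def y_def)
  ultimately have "(1 - u) *\<^sub>R w + u *\<^sub>R y \<in> \<tau>"
    using face_of_imp_eq_affine_Int[OF \<open>convex \<sigma>\<close> f] by blast
  moreover have "w \<noteq> y"
  proof
    assume "w = y"
    then have "(a - c) *\<^sub>R z = (x + l) - p"
      by (simp add: w_def y_def algebra_simps)
    then show False
      using scaleD[of "a - c"] diff_in_parallel_space[OF xl paff] p(2) c by auto
  qed
  ultimately have "y \<in> \<tau>"
    using f u p(3) y face_ofD[OF f, of "(1 - u) *\<^sub>R w + u *\<^sub>R y" w y]
    by (auto simp: in_segment w_def y_def)
  then have "y - (x + l) \<in> parallel_space \<tau>"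
    by (intro diff_in_parallel_space xl) (simp add: hull_inc)
  then show False
    using scaleD[of c] c by (simp add: y_def)
qed

lemma inward_normal_decompose:
  assumes "inward_normal \<tau> \<sigma> z" "v \<in> parallel_space \<sigma>"
  obtains l c where "v = l + c *\<^sub>R z" "l \<in> parallel_space \<tau>"
  using assms by (auto simp: inward_normal_def)

text \<open>A point of the ray is exhibited as the midpoint of a point of \<open>\<tau>\<close> and
  a point strictly between \<open>x\<close> and a relative interior point \<open>w\<close> of
  \<open>\<sigma>\<close>. The latter lies in the relative interior, hence so does the
  midpoint.\<close>

lemma inward_normal_enters:
  assumes n: "inward_normal \<tau> \<sigma> z" and cvx: "convex \<sigma>"
    and x: "x \<in> rel_interior \<tau>" and l: "l \<in> parallel_space \<tau>" and c: "0 < c"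
  shows "enters x (l + c *\<^sub>R z) (rel_interior \<sigma>)"
proof -
  have f: "\<tau> face_of \<sigma>" and z: "z \<notin> parallel_space \<tau>"
    using n by (auto simp: inward_normal_def)
  have "x \<in> \<tau>"
    using x rel_interior_subset by blast
  then have \<tau>: "x \<in> \<tau>" "x \<in> affine hull \<tau>" "\<tau> \<noteq> {}"
    by (auto simp: hull_inc)
  have sub: "subspace (parallel_space \<tau>)"
    using \<tau> by (intro subspace_parallel_space)
  have "\<sigma> \<noteq> {}"
    using f \<tau> face_of_imp_subset by blast
  then obtain w where w: "w \<in> rel_interior \<sigma>"
    using cvx rel_interior_eq_empty by blast
  then have w\<sigma>: "w \<in> \<sigma>" using rel_interior_subset by blast
  have x\<sigma>: "x \<in> \<sigma>" using f \<tau> face_of_imp_subset by blast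
  have "w - x \<in> parallel_space \<sigma>"
    using w\<sigma> x\<sigma> by (intro diff_in_parallel_space) (auto simp: hull_inc)
  then obtain l0 c0 where l0: "w - x = l0 + c0 *\<^sub>R z" "l0 \<in> parallel_space \<tau>"
    using n by (elim inward_normal_decompose)
  have "0 \<le> c0"
    using n cvx \<tau>(2) l0(2) by (rule inward_normal_nonneg) (simp add: l0(1)[symmetric] w\<sigma>)
  \<comment> \<open>Otherwise \<open>w\<close> would lie in the face \<open>\<tau>\<close>, which
    would then contain all of \<open>\<sigma>\<close>.\<close>
  moreover have "c0 \<noteq> 0"
  proof
    assume "c0 = 0"
    then have "x + (w - x) \<in> affine hull \<tau>"
      using l0 \<tau> by (simp add: add_parallel_space_iff)
    then have "w \<in> \<tau>"
      using face_of_imp_eq_affine_Int[OF cvx f] w\<sigma> by auto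
    then have "\<sigma> \<subseteq> \<tau>"
      using w w\<sigma> by (intro subset_of_face_of[OF f]) auto
    moreover have "0 + 1 *\<^sub>R z \<in> parallel_space \<sigma>"
      using n subspace_0[OF sub] unfolding inward_normal_def by blast
    ultimately show False
      using parallel_space_mono[of \<sigma> \<tau>] hull_subset[of \<tau> affine] z by auto
  qed
  ultimately have c0: "c0 > 0" by simp
  \<comment> \<open>\<open>d\<close> and \<open>l'\<close> solve
    \<open>l' + d *\<^sub>R (w - x) = 2 *\<^sub>R (l + c *\<^sub>R z)\<close>; the factor 2
    compensates for the midpoint.\<close>
  define d where "d = 2 * (c / c0)"
  have d: "d > 0" using c c0 by (simp add: d_def)
  define l' where "l' = 2 *\<^sub>R l - d *\<^sub>R l0"
  have l': "l' \<in> parallel_space \<tau>"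
    unfolding l'_def using sub l l0(2) by (intro subspace_diff subspace_scale)
  have "\<forall>\<^sub>F t in at_right 0. x + t *\<^sub>R l' \<in> \<sigma>"
    using enters_mono[OF enters_rel_interior[OF x l'], of \<sigma>] rel_interior_subset[of \<tau>]
      face_of_imp_subset[OF f] by (auto simp: enters_def)
  moreover have "\<forall>\<^sub>F t in at_right 0. 0 < t \<and> t < 1 / d"
    unfolding eventually_at_right_field using d by (intro exI[of _ "1/d"]) auto
  ultimately have "\<forall>\<^sub>F t in at_right 0. x + t *\<^sub>R (l + c *\<^sub>R z) \<in> rel_interior \<sigma>"
  proof eventually_elim
    case (elim t)
    have td: "0 < t * d" "t * d < 1"
      using elim(2) d by (auto simp: field_simps)
    have i: "x - (t * d) *\<^sub>R (x - w) \<in> rel_interior \<sigma>"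
      using td by (intro rel_interior_convex_shrink cvx w x\<sigma>) auto
    have "(x + t *\<^sub>R l') - (1/2) *\<^sub>R ((x + t *\<^sub>R l') - (x - (t * d) *\<^sub>R (x - w))) \<in> rel_interior \<sigma>"
      by (rule rel_interior_convex_shrink[OF cvx i elim(1)]) auto
    also have "(x + t *\<^sub>R l') - (1/2) *\<^sub>R ((x + t *\<^sub>R l') - (x - (t * d) *\<^sub>R (x - w)))
      = x + ((t / 2) *\<^sub>R l' + (t * d / 2) *\<^sub>R (w - x))"
      by (simp add: vec_eq_iff field_simps)
    also have "\<dots> = x + t *\<^sub>R (l + c *\<^sub>R z)"
      using c0 by (simp add: l0(1) l'_def algebra_simps d_def)
    finally show ?case .
  qed
  then show ?thesis by (simp add: enters_def)
qed

text \<open>Converse to \<open>inward_normal_enters\<close>: for directions transversal to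
  \<open>\<tau>\<close>, the sign of the coefficient of the normal decides whether the ray enters
  \<open>\<sigma>\<close>.\<close>

lemma inward_normal_pos:
  assumes n: "inward_normal \<tau> \<sigma> z" and cvx: "convex \<sigma>"
    and x: "x \<in> affine hull \<tau>" and l: "l \<in> parallel_space \<tau>"
    and e: "enters x (l + c *\<^sub>R z) \<sigma>" and v: "l + c *\<^sub>R z \<notin> parallel_space \<tau>"
  shows "0 < c"
proof -
  obtain t where t: "t > 0" "x + t *\<^sub>R (l + c *\<^sub>R z) \<in> \<sigma>"
    using e by (rule enters_obtains)
  have "subspace (parallel_space \<tau>)"
    using x by (intro subspace_parallel_space) auto
  then have "t *\<^sub>R l \<in> parallel_space \<tau>"
    using l by (intro subspace_scale)
  then have "0 \<le> t * c"
    using n cvx x t(2) by (intro inward_normal_nonneg[of \<tau> \<sigma> z x "t *\<^sub>R l"]) (auto simp: algebra_simps)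
  moreover have "c \<noteq> 0"
    using v l by auto
  ultimately show ?thesis
    using t(1) by (simp add: zero_le_mult_iff)
qed

section \<open>Lattice normals\<close>

text \<open>Rationality enters here: a lattice basis consists of as many independent vectors of the
  parallel space as its dimension, so it spans.\<close>

lemma span_cell_lattice:
  assumes "has_lattice_rank (cell_lattice \<rho>) r" "int r = aff_dim \<rho>" "\<rho> \<noteq> {}"
  shows "span (cell_lattice \<rho>) = parallel_space \<rho>"
proof
  have sub: "subspace (parallel_space \<rho>)"
    using assms(3) by (rule subspace_parallel_space)
  show "span (cell_lattice \<rho>) \<subseteq> parallel_space \<rho>"
    using sub by (intro span_minimal) (auto simp: cell_lattice_def)
  obtain B where B: "finite B" "independent B" "card B = r"
    "cell_lattice \<rho> = {\<Sum>b\<in>B. of_int (c b) *\<^sub>R b | c :: real^'a \<Rightarrow> int. True}"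
    using assms(1) by (auto simp: has_lattice_rank_def)
  have "B \<subseteq> cell_lattice \<rho>"
  proof
    fix b assume "b \<in> B"
    then have "b = (\<Sum>b'\<in>B. of_int (if b' = b then 1 else 0) *\<^sub>R b')"
      using B(1) by (simp add: if_distrib [of "\<lambda>x. x *\<^sub>R _"] if_distrib [of "of_int"] sum.delta cong: if_cong)
    then show "b \<in> cell_lattice \<rho>"
      unfolding B(4) by (intro CollectI exI[of _ "\<lambda>b'. if b' = b then 1 else 0"] conjI TrueI)
  qed
  moreover have "dim (parallel_space \<rho>) = card B"
    using dim_parallel_space[OF assms(3)] assms(2) B(3) by simp
  then have "parallel_space \<rho> \<subseteq> span B"
    using \<open>B \<subseteq> cell_lattice \<rho>\<close> B(2) by (intro card_ge_dim_independent) (auto simp: cell_lattice_def)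
  ultimately show "parallel_space \<rho> \<subseteq> span (cell_lattice \<rho>)"
    using span_mono by blast
qed

lemma rational_complex_span:
  assumes "polyhedral_complex X" "rational_complex X" "\<rho> \<in> facets X \<union> ridges X"
  shows "span (cell_lattice \<rho>) = parallel_space \<rho>"
proof -
  have "\<rho> \<in> X"
    using assms(3) by (auto simp: facets_def ridges_def)
  then show ?thesis
    using assms span_cell_lattice polyhedral_complex_cell(2) unfolding rational_complex_def by metis
qed

text \<open>Real spans turn the decomposition of the lattices into one of the parallel spaces;
  \<open>z\<close> is transversal because \<open>\<sigma>\<close> has larger dimension than
  \<open>\<tau>\<close>.\<close>

lemma lattice_normal_inward:
  assumes "polyhedral_complex X" "rational_complex X" "\<tau> \<in> ridges X" "\<sigma> \<in> star_facets X \<tau>"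
    and z: "lattice_normal \<tau> \<sigma> z"
  shows "inward_normal \<tau> \<sigma> z"
proof -
  have \<sigma>: "\<sigma> \<in> facets X" "\<tau> face_of \<sigma>"
    using assms(4) by (auto simp: star_facets_def)
  have "\<tau> \<in> X" "\<sigma> \<in> X"
    using \<sigma> assms(3) by (auto simp: facets_def ridges_def)
  note ne = this[THEN polyhedral_complex_cell(2)[OF assms(1)]]
  note sub = ne[THEN subspace_parallel_space]
  have span: "span (cell_lattice \<tau>) = parallel_space \<tau>" "span (cell_lattice \<sigma>) = parallel_space \<sigma>"
    using rational_complex_span assms(1-3) \<sigma> by blast+
  have mono: "parallel_space \<tau> \<subseteq> parallel_space \<sigma>"
    using face_of_imp_subset[OF \<sigma>(2)] hull_subset[of \<sigma> affine] by (intro parallel_space_mono) blast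
  have "z \<in> parallel_space \<sigma>"
    using z by (auto simp: lattice_normal_def cell_lattice_def)
  then have "{l + c *\<^sub>R z | l c. l \<in> parallel_space \<tau>} \<subseteq> parallel_space \<sigma>"
    using mono subspace_add[OF sub(2)] subspace_scale[OF sub(2)] by blast
  moreover have "parallel_space \<sigma> \<subseteq> {l + c *\<^sub>R z | l c. l \<in> parallel_space \<tau>}"
  proof -
    have "cell_lattice \<sigma> \<subseteq> {l + c *\<^sub>R z | l c. l \<in> parallel_space \<tau>}"
      using z by (auto simp: lattice_normal_def cell_lattice_def)
    moreover have "subspace {l + c *\<^sub>R z | l c. l \<in> parallel_space \<tau>}"
    proof -
      have "{l + c *\<^sub>R z | l c. l \<in> parallel_space \<tau>} = {x + y | x y. x \<in> parallel_space \<tau> \<and> y \<in> span {z}}"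
        by (auto simp: span_singleton)
      then show ?thesis
        using subspace_sums[OF sub(1) subspace_span[of "{z}"]] by simp
    qed
    ultimately show ?thesis
      unfolding span(2)[symmetric] by (rule span_minimal)
  qed
  ultimately have eq: "parallel_space \<sigma> = {l + c *\<^sub>R z | l c. l \<in> parallel_space \<tau>}"
    by simp
  have "z \<notin> parallel_space \<tau>"
  proof
    assume "z \<in> parallel_space \<tau>"
    then have "parallel_space \<sigma> = parallel_space \<tau>"
      unfolding eq using subspace_add[OF sub(1)] subspace_scale[OF sub(1)] mono eq by blast
    then have "aff_dim \<sigma> = aff_dim \<tau>"
      using ne dim_parallel_space by metis
    then show False
      using \<sigma>(1) assms(3) by (auto simp: facets_def ridges_def)
  qed
  with \<sigma> eq z show ?thesis
    by (auto simp: inward_normal_def lattice_normal_def)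
qed

text \<open>Modulo \<open>parallel_space \<tau>\<close> each normal is an integer multiple of the
  other, so the two factors have product 1. Two pairs of cells are allowed because the lemma serves
  both different facets at one ridge and cells of two complexes.\<close>

lemma lattice_normal_unique_upto_sign:
  assumes z: "lattice_normal \<tau> \<sigma> z" "lattice_normal \<tau>' \<sigma>' z'"
    and eq: "parallel_space \<tau> = parallel_space \<tau>'" "parallel_space \<sigma> = parallel_space \<sigma>'"
    and ne: "\<tau> \<noteq> {}" and nz: "z \<notin> parallel_space \<tau>"
  shows "z - z' \<in> parallel_space \<tau> \<or> z + z' \<in> parallel_space \<tau>"
proof -
  have sub: "subspace (parallel_space \<tau>)"
    using ne by (rule subspace_parallel_space)
  have lat: "cell_lattice \<tau> = cell_lattice \<tau>'" "cell_lattice \<sigma> = cell_lattice \<sigma>'"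
    by (simp_all add: cell_lattice_def eq)
  obtain a m where a: "z = a + of_int m *\<^sub>R z'" "a \<in> parallel_space \<tau>"
    using z lat unfolding lattice_normal_def cell_lattice_def by blast
  obtain b n where b: "z' = b + of_int n *\<^sub>R z" "b \<in> parallel_space \<tau>"
    using z lat unfolding lattice_normal_def cell_lattice_def by blast
  have "z = (a + of_int m *\<^sub>R b) + of_int (m * n) *\<^sub>R z"
    by (subst a(1), subst b(1)) (simp add: algebra_simps)
  then have "(1 - of_int (m * n)) *\<^sub>R z = a + of_int m *\<^sub>R b"
    by (simp add: algebra_simps)
  then have s: "(1 - of_int (m * n)) *\<^sub>R z \<in> parallel_space \<tau>"
    using a(2) b(2) sub by (simp add: subspace_add subspace_scale)
  have "m * n = 1"
  proof (rule ccontr)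
    assume "m * n \<noteq> 1"
    then have "1 - real_of_int (m * n) \<noteq> 0"
      by (metis eq_iff_diff_eq_0 of_int_eq_1_iff)
    then show False
      using subspace_scale[OF sub s, of "1 / (1 - of_int (m * n))"] nz by simp
  qed
  then consider "m = 1" | "m = -1"
    using zmult_eq_1_iff by blast
  then show ?thesis
    using a by cases auto
qed

text \<open>The opposite sign is impossible: it would give a point of \<open>\<sigma>\<close> a
  negative coefficient along the normal \<open>z'\<close>.\<close>

lemma lattice_normal_unique:
  assumes X: "polyhedral_complex X" "rational_complex X" "\<tau> \<in> ridges X" "\<sigma> \<in> star_facets X \<tau>"
    and z: "lattice_normal \<tau> \<sigma> z" "lattice_normal \<tau> \<sigma> z'"
  shows "z - z' \<in> parallel_space \<tau>"
proof (rule ccontr)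
  assume *: "z - z' \<notin> parallel_space \<tau>"
  have \<tau>: "\<tau> \<in> X" and \<sigma>: "\<sigma> \<in> X"
    using X by (auto simp: ridges_def star_facets_def facets_def)
  have n: "inward_normal \<tau> \<sigma> z" "inward_normal \<tau> \<sigma> z'"
    using lattice_normal_inward[OF X] z by blast+
  then obtain p c where p: "p \<in> \<tau>" "c > 0" "p + c *\<^sub>R z \<in> \<sigma>" and "z \<notin> parallel_space \<tau>"
    by (auto simp: inward_normal_def)
  then have "z + z' \<in> parallel_space \<tau>"
    using lattice_normal_unique_upto_sign[OF z refl refl] * by blast
  then have "c *\<^sub>R (z + z') \<in> parallel_space \<tau>"
    using p(1) by (intro subspace_scale[OF subspace_parallel_space]) auto
  \<comment> \<open>The point \<open>p + c *\<^sub>R z\<close> of \<open>\<sigma>\<close> is read as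
    \<open>p + (c *\<^sub>R (z + z') + (- c) *\<^sub>R z')\<close>.\<close>
  then have "0 \<le> - c"
    using n(2) polyhedral_complex_cell(3)[OF X(1) \<sigma>] p
    by (intro inward_normal_nonneg[of \<tau> \<sigma> z' p "c *\<^sub>R (z + z')"])
      (auto simp: hull_inc algebra_simps)
  then show False using p(2) by simp
qed

section \<open>The balancing condition for a fixed choice of normals\<close>

text \<open>One normal for each pair, fixed for all weights. In \<open>balanced\<close> the normals
  may vary with the map, which hides that the condition is linear in it.\<close>

definition lattice_normals ::
    "(real^'d) set set \<Rightarrow> ((real^'d) set \<Rightarrow> (real^'d) set \<Rightarrow> real^'d) \<Rightarrow> bool" where
  "lattice_normals X Z \<longleftrightarrow>
     (\<forall>\<tau>\<in>ridges X. \<forall>\<sigma>\<in>star_facets X \<tau>. lattice_normal \<tau> \<sigma> (Z \<tau> \<sigma>))"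

lemma tropical_complexD:
  assumes "tropical_complex X"
  shows "polyhedral_complex X" "pure_complex X" "rational_complex X"
  using assms by (simp_all add: tropical_complex_def)

text \<open>The balanced weighting of a tropical complex already supplies normals at every
  ridge.\<close>

lemma lattice_normals_exist:
  assumes "tropical_complex X"
  obtains Z where "lattice_normals X Z"
proof -
  have "\<forall>\<tau>\<in>ridges X. \<exists>z. \<forall>\<sigma>\<in>star_facets X \<tau>. lattice_normal \<tau> \<sigma> (z \<sigma>)"
    using assms unfolding tropical_complex_def balanced_def by blast
  then show ?thesis
    using that unfolding lattice_normals_def by metis
qed

lemma weighted_sum_mem_cong:
  assumes "subspace L" "\<And>i. i \<in> I \<Longrightarrow> a i - b i \<in> L"
  shows "(\<Sum>i\<in>I. c i *\<^sub>R a i) \<in> L \<longleftrightarrow> (\<Sum>i\<in>I. c i *\<^sub>R b i) \<in> L"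
proof -
  have d: "(\<Sum>i\<in>I. c i *\<^sub>R a i) - (\<Sum>i\<in>I. c i *\<^sub>R b i) \<in> L"
    unfolding sum_subtractf[symmetric] scaleR_diff_right[symmetric]
    using assms by (intro subspace_sum subspace_scale)
  show ?thesis
    using subspace_add[OF assms(1) d] subspace_diff[OF assms(1) _ d] by fastforce
qed

text \<open>Two choices of normals differ by elements of \<open>parallel_space \<tau>\<close>, so
  membership of the weighted sum does not see the choice.\<close>

lemma balanced_iff:
  assumes X: "polyhedral_complex X" "rational_complex X" and Z: "lattice_normals X Z"
  shows "balanced X \<omega> \<longleftrightarrow> (\<forall>\<sigma>\<in>facets X. 0 \<le> \<omega> \<sigma>) \<and>
    (\<forall>\<tau>\<in>ridges X. (\<Sum>\<sigma>\<in>star_facets X \<tau>. \<omega> \<sigma> *\<^sub>R Z \<tau> \<sigma>) \<in> parallel_space \<tau>)"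
proof -
  have "(\<exists>z. (\<forall>\<sigma>\<in>star_facets X \<tau>. lattice_normal \<tau> \<sigma> (z \<sigma>)) \<and>
          (\<Sum>\<sigma>\<in>star_facets X \<tau>. \<omega> \<sigma> *\<^sub>R z \<sigma>) \<in> parallel_space \<tau>) \<longleftrightarrow>
        (\<Sum>\<sigma>\<in>star_facets X \<tau>. \<omega> \<sigma> *\<^sub>R Z \<tau> \<sigma>) \<in> parallel_space \<tau>" (is "?L \<longleftrightarrow> ?R")
    if \<tau>: "\<tau> \<in> ridges X" for \<tau>
  proof
    have sub: "subspace (parallel_space \<tau>)"
      using \<tau> polyhedral_complex_cell(2)[OF X(1)]
      by (intro subspace_parallel_space) (auto simp: ridges_def)
    assume ?L
    then obtain z where z: "\<forall>\<sigma>\<in>star_facets X \<tau>. lattice_normal \<tau> \<sigma> (z \<sigma>)"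
      "(\<Sum>\<sigma>\<in>star_facets X \<tau>. \<omega> \<sigma> *\<^sub>R z \<sigma>) \<in> parallel_space \<tau>"
      by blast
    moreover have "z \<sigma> - Z \<tau> \<sigma> \<in> parallel_space \<tau>" if "\<sigma> \<in> star_facets X \<tau>" for \<sigma>
      using lattice_normal_unique[OF X \<tau> that] z(1) Z that \<tau> by (auto simp: lattice_normals_def)
    ultimately show ?R
      using weighted_sum_mem_cong[OF sub, of _ z "Z \<tau>" \<omega>] by blast
  next
    assume ?R
    then show ?L
      using Z \<tau> by (auto simp: lattice_normals_def)
  qed
  then show ?thesis
    unfolding balanced_def by blast
qed

section \<open>Integral balanced maps\<close>

text \<open>Multiplying \<open>v\<close> by a common approximate denominator and rounding leaves every equation
  with an integer error smaller than one, that is, with no error.\<close>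

lemma integer_solution:
  fixes A :: "'j \<Rightarrow> 'i \<Rightarrow> int" and v :: "'i \<Rightarrow> real"
  assumes "finite I" "finite J" and sol: "\<And>j. j \<in> J \<Longrightarrow> (\<Sum>i\<in>I. of_int (A j i) * v i) = 0"
  obtains p :: "'i \<Rightarrow> int" where "\<And>j. j \<in> J \<Longrightarrow> (\<Sum>i\<in>I. A j i * p i) = 0"
    and "\<And>i. i \<in> I \<Longrightarrow> v i > 0 \<Longrightarrow> p i > 0" and "\<And>i. i \<in> I \<Longrightarrow> v i = 0 \<Longrightarrow> p i = 0"
proof -
  \<comment> \<open>The three summands make \<open>N\<close> exceed 1, each row sum of absolute
    values of \<open>A\<close>, and each \<open>1 / \<bar>v i\<bar>\<close>; zero entries of
    \<open>v\<close> contribute 0 to the last sum.\<close>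
  define M where "M = 1 + (\<Sum>j\<in>J. \<Sum>i\<in>I. real_of_int \<bar>A j i\<bar>) + (\<Sum>i\<in>I. 1 / \<bar>v i\<bar>)"
  obtain N :: nat where N: "M < real N"
    using reals_Archimedean2 by blast
  have pos: "0 \<le> (\<Sum>j\<in>J. \<Sum>i\<in>I. real_of_int \<bar>A j i\<bar>)" "0 \<le> (\<Sum>i\<in>I. 1 / \<bar>v i\<bar>)"
    by (intro sum_nonneg; simp)+
  then have N1: "real N > 1" "N > 0"
    using N by (auto simp: M_def intro: gr0I)
  have NA: "(\<Sum>i\<in>I. real_of_int \<bar>A j i\<bar>) < real N" if "j \<in> J" for j
  proof -
    have "(\<Sum>i\<in>I. real_of_int \<bar>A j i\<bar>) \<le> (\<Sum>j\<in>J. \<Sum>i\<in>I. real_of_int \<bar>A j i\<bar>)"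
      using that assms(2) by (intro member_le_sum sum_nonneg) auto
    then show ?thesis using N pos(2) by (simp add: M_def)
  qed
  have Nv: "1 / real N < v i" if "i \<in> I" "v i > 0" for i
  proof -
    have "1 / \<bar>v i\<bar> \<le> (\<Sum>i\<in>I. 1 / \<bar>v i\<bar>)"
      using that assms(1) by (intro member_le_sum[of i I "\<lambda>i. 1 / \<bar>v i\<bar>"]) auto
    then have "1 / v i < real N"
      using N pos(1) that by (simp add: M_def)
    then show ?thesis
      using that(2) N1 by (simp add: field_simps)
  qed
  obtain f where f: "bij_betw f {..<card I} I"
    using ex_bij_betw_nat_finite[OF assms(1)] atLeast0LessThan by auto
  obtain q p where q: "0 < q"
    and p: "\<And>n. n < card I \<Longrightarrow> \<bar>of_int q * v (f n) - of_int (p n)\<bar> < 1 / N"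
    using Dirichlet_approx_simult[OF N1(2), of "card I" "\<lambda>n. v (f n)"] by metis
  define P where "P = (\<lambda>i. p (the_inv_into {..<card I} f i))"
  have P: "\<bar>of_int q * v i - of_int (P i)\<bar> < 1 / N" if "i \<in> I" for i
    using p[of "the_inv_into {..<card I} f i"] f that
    by (simp add: P_def f_the_inv_into_f_bij_betw bij_betw_def f_the_inv_into_f
        the_inv_into_into[of f _ _ "{..<card I}", simplified])
  have "(\<Sum>i\<in>I. A j i * P i) = 0" if j: "j \<in> J" for j
  proof -
    have "(\<Sum>i\<in>I. of_int (A j i) * (of_int q * v i)) = of_int q * (\<Sum>i\<in>I. of_int (A j i) * v i)"
      unfolding sum_distrib_left by (intro sum.cong) auto
    \<comment> \<open>The multiple of \<open>v\<close> by \<open>q\<close> solves the system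
      exactly, so only the rounding errors remain.\<close>
    then have "of_int (\<Sum>i\<in>I. A j i * P i) = - (\<Sum>i\<in>I. of_int (A j i) * (of_int q * v i - of_int (P i)))"
      using sol[OF j] by (simp add: right_diff_distrib sum_subtractf)
    then have "\<bar>of_int (\<Sum>i\<in>I. A j i * P i) :: real\<bar> \<le>
        (\<Sum>i\<in>I. \<bar>of_int (A j i) * (of_int q * v i - of_int (P i))\<bar>)"
      using sum_abs[of "\<lambda>i. of_int (A j i) * (of_int q * v i - of_int (P i))" I] by linarith
    also have "\<dots> \<le> (\<Sum>i\<in>I. real_of_int \<bar>A j i\<bar> * (1 / N))"
    proof (intro sum_mono)
      fix i assume "i \<in> I"
      then show "\<bar>of_int (A j i) * (of_int q * v i - of_int (P i))\<bar> \<le> real_of_int \<bar>A j i\<bar> * (1 / N)"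
        unfolding abs_mult of_int_abs by (rule mult_left_mono[OF less_imp_le[OF P]]) auto
    qed
    also have "\<dots> = (\<Sum>i\<in>I. real_of_int \<bar>A j i\<bar>) / N"
      by (simp add: sum_divide_distrib)
    also have "\<dots> < 1"
      using NA[OF j] N1 by simp
    finally show ?thesis by linarith
  qed
  moreover have "P i > 0" if i: "i \<in> I" "v i > 0" for i
  proof -
    \<comment> \<open>As \<open>q\<close> is at least 1, the scaled entry stays above
      \<open>1 / N\<close>, which bounds the rounding error.\<close>
    have "v i \<le> of_int q * v i"
      using q i(2) by simp
    then have "0 < real_of_int (P i)"
      using P[OF i(1)] Nv[OF i] by linarith
    then show ?thesis by simp
  qed
  moreover have "P i = 0" if i: "i \<in> I" "v i = 0" for i
  proof -
    have "1 / real N \<le> 1" using N1 by simp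
    then have "\<bar>real_of_int (P i)\<bar> < 1"
      using P[OF i(1)] i(2) by simp
    then show ?thesis by linarith
  qed
  ultimately show ?thesis using that by blast
qed

text \<open>Integral spanning vectors allow membership in \<open>parallel_space \<tau>\<close> to be
  written with integer coefficients.\<close>

lemma integral_span_obtains:
  assumes "polyhedral_complex X" "rational_complex X" "\<tau> \<in> ridges X"
  obtains B where "finite B" "B \<subseteq> integer_points" "span B = parallel_space \<tau>"
proof -
  obtain B where B: "B \<subseteq> cell_lattice \<tau>" "independent B" "cell_lattice \<tau> \<subseteq> span B"
    by (rule maximal_independent_subset)
  then have "span B = parallel_space \<tau>"
    using rational_complex_span[OF assms(1,2)] assms(3) span_mono[OF B(1)] span_minimal[OF B(3) subspace_span]
    by auto
  then show ?thesis
    using that B independent_imp_finite by (auto simp: cell_lattice_def)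
qed

text \<open>Balancing is a membership, not an equation. Adding the coefficients of the weighted sum
  in terms of integral spanning vectors as further unknowns, of arbitrary sign, turns it into a
  homogeneous system with integer coefficients.\<close>

lemma integral_balanced_map:
  assumes X: "polyhedral_complex X" "rational_complex X" and Z: "lattice_normals X Z"
    and bal: "balanced X \<omega>"
  obtains p :: "(real^'d) set \<Rightarrow> int" where "balanced X (\<lambda>\<sigma>. of_int (p \<sigma>))"
    and "\<And>\<sigma>. \<sigma> \<in> facets X \<Longrightarrow> \<omega> \<sigma> > 0 \<Longrightarrow> p \<sigma> > 0"
    and "\<And>\<sigma>. \<sigma> \<in> facets X \<Longrightarrow> \<omega> \<sigma> = 0 \<Longrightarrow> p \<sigma> = 0"
proof -
  note bal = bal[unfolded balanced_iff[OF X Z]]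
  have "\<forall>\<tau>\<in>ridges X. \<exists>B. finite B \<and> B \<subseteq> integer_points \<and> span B = parallel_space \<tau>"
    using integral_span_obtains[OF X] by metis
  then obtain B where B: "\<And>\<tau>. \<tau> \<in> ridges X \<Longrightarrow> finite (B \<tau>)"
    "\<And>\<tau>. \<tau> \<in> ridges X \<Longrightarrow> B \<tau> \<subseteq> integer_points"
    "\<And>\<tau>. \<tau> \<in> ridges X \<Longrightarrow> span (B \<tau>) = parallel_space \<tau>"
    by metis
  have "\<forall>\<tau>\<in>ridges X. \<exists>c. (\<Sum>\<sigma>\<in>star_facets X \<tau>. \<omega> \<sigma> *\<^sub>R Z \<tau> \<sigma>) = (\<Sum>b\<in>B \<tau>. c b *\<^sub>R b)"
  proof
    fix \<tau> assume \<tau>: "\<tau> \<in> ridges X"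
    then have "(\<Sum>\<sigma>\<in>star_facets X \<tau>. \<omega> \<sigma> *\<^sub>R Z \<tau> \<sigma>) \<in> span (B \<tau>)"
      using bal B(3) by simp
    then show "\<exists>c. (\<Sum>\<sigma>\<in>star_facets X \<tau>. \<omega> \<sigma> *\<^sub>R Z \<tau> \<sigma>) = (\<Sum>b\<in>B \<tau>. c b *\<^sub>R b)"
      unfolding span_finite[OF B(1)[OF \<tau>]] by blast
  qed
  from bchoice[OF this] obtain c where c: "\<And>\<tau>. \<tau> \<in> ridges X \<Longrightarrow>
      (\<Sum>\<sigma>\<in>star_facets X \<tau>. \<omega> \<sigma> *\<^sub>R Z \<tau> \<sigma>) = (\<Sum>b\<in>B \<tau>. c \<tau> b *\<^sub>R b)"
    by blast
  \<comment> \<open>Unknowns: a weight for each facet and a coefficient for each ridge and spanning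
    vector. Equations: one for each ridge and coordinate.\<close>
  define I where "I = facets X <+> Sigma (ridges X) B"
  define J where "J = ridges X \<times> (UNIV :: 'd set)"
  define v where "v = case_sum \<omega> (\<lambda>(\<tau>, b). - c \<tau> b)"
  \<comment> \<open>The floor only changes the type, since all these entries are integers
    (\<open>int_Z\<close>, \<open>int_B\<close>).\<close>
  define A where "A = (\<lambda>(\<tau>, k :: 'd). case_sum
      (\<lambda>\<sigma>. if \<sigma> \<in> star_facets X \<tau> then \<lfloor>Z \<tau> \<sigma> $ k\<rfloor> else 0)
      (\<lambda>(\<tau>', b :: real^'d). if \<tau>' = \<tau> then \<lfloor>b $ k\<rfloor> else 0))"
  have fin: "finite (facets X)" "finite (ridges X)" "finite (Sigma (ridges X) B)"
    using finite_facets finite_ridges X(1) B(1) by auto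
  have int_Z: "of_int \<lfloor>Z \<tau> \<sigma> $ k\<rfloor> = Z \<tau> \<sigma> $ k" if "\<tau> \<in> ridges X" "\<sigma> \<in> star_facets X \<tau>" for \<tau> \<sigma> k
    using Z that by (auto simp: lattice_normals_def lattice_normal_def cell_lattice_def integer_points_def)
  have int_B: "of_int \<lfloor>b $ k\<rfloor> = b $ k" if "\<tau> \<in> ridges X" "b \<in> B \<tau>" for \<tau> b and k :: 'd
    by (metis (mono_tags, lifting) B(2) Ints_cases floor_of_int integer_points_def mem_Collect_eq subsetD that)
  have eval: "(\<Sum>i\<in>I. of_int (A (\<tau>, k) i) * w i) =
      ((\<Sum>\<sigma>\<in>star_facets X \<tau>. w (Inl \<sigma>) *\<^sub>R Z \<tau> \<sigma>) + (\<Sum>b\<in>B \<tau>. w (Inr (\<tau>, b)) *\<^sub>R b)) $ k"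
    if \<tau>: "\<tau> \<in> ridges X" for \<tau> k and w :: "(real^'d) set + (real^'d) set \<times> (real^'d) \<Rightarrow> real"
  proof -
    have "(\<Sum>\<sigma>\<in>facets X. of_int (A (\<tau>, k) (Inl \<sigma>)) * w (Inl \<sigma>)) =
        (\<Sum>\<sigma>\<in>star_facets X \<tau>. w (Inl \<sigma>) * Z \<tau> \<sigma> $ k)"
      using fin int_Z[OF \<tau>]
      by (intro sum.mono_neutral_cong_right) (auto simp: A_def star_facets_def)
    moreover have "(\<Sum>i\<in>Sigma (ridges X) B. of_int (A (\<tau>, k) (Inr i)) * w (Inr i)) =
        (\<Sum>b\<in>B \<tau>. w (Inr (\<tau>, b)) * b $ k)"
    proof -
      have "(\<Sum>i\<in>Sigma (ridges X) B. of_int (A (\<tau>, k) (Inr i)) * w (Inr i)) =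
          (\<Sum>\<tau>'\<in>ridges X. \<Sum>b\<in>B \<tau>'. of_int (A (\<tau>, k) (Inr (\<tau>', b))) * w (Inr (\<tau>', b)))"
        using fin B(1) by (simp add: sum.Sigma case_prod_unfold)
      also have "\<dots> = (\<Sum>\<tau>'\<in>ridges X. if \<tau>' = \<tau> then (\<Sum>b\<in>B \<tau>. w (Inr (\<tau>, b)) * b $ k) else 0)"
        by (intro sum.cong) (auto simp: A_def int_B[OF \<tau>] mult.commute intro!: sum.cong)
      finally show ?thesis
        using fin \<tau> by simp
    qed
    ultimately show ?thesis
      using fin by (simp add: I_def sum.Plus)
  qed
  have sol: "(\<Sum>i\<in>I. of_int (A j i) * v i) = 0" if j: "j \<in> J" for j
  proof -
    obtain \<tau> k where jk: "j = (\<tau>, k)" "\<tau> \<in> ridges X"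
      using j by (auto simp: J_def)
    show ?thesis
      unfolding jk(1) eval[OF jk(2)] using c[OF jk(2)] by (simp add: v_def sum_negf)
  qed
  have finIJ: "finite I" "finite J"
    using fin by (auto simp: I_def J_def)
  obtain p where p: "\<And>j. j \<in> J \<Longrightarrow> (\<Sum>i\<in>I. A j i * p i) = 0"
    and p_pos: "\<And>i. i \<in> I \<Longrightarrow> v i > 0 \<Longrightarrow> p i > 0" and p_0: "\<And>i. i \<in> I \<Longrightarrow> v i = 0 \<Longrightarrow> p i = 0"
    by (rule integer_solution[OF finIJ sol]) blast+
  have pos: "p (Inl \<sigma>) > 0" if "\<sigma> \<in> facets X" "\<omega> \<sigma> > 0" for \<sigma>
    using p_pos[of "Inl \<sigma>"] that by (auto simp: I_def v_def)
  moreover have zero: "p (Inl \<sigma>) = 0" if "\<sigma> \<in> facets X" "\<omega> \<sigma> = 0" for \<sigma>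
    using p_0[of "Inl \<sigma>"] that by (auto simp: I_def v_def)
  moreover have "balanced X (\<lambda>\<sigma>. of_int (p (Inl \<sigma>)))"
    unfolding balanced_iff[OF X Z]
  proof (intro conjI ballI)
    fix \<sigma> assume "\<sigma> \<in> facets X"
    then have "0 \<le> p (Inl \<sigma>)"
      using pos[of \<sigma>] zero[of \<sigma>] bal by fastforce
    then show "0 \<le> real_of_int (p (Inl \<sigma>))"
      by simp
  next
    fix \<tau> assume \<tau>: "\<tau> \<in> ridges X"
    let ?s = "\<Sum>b\<in>B \<tau>. real_of_int (p (Inr (\<tau>, b))) *\<^sub>R b"
    have "((\<Sum>\<sigma>\<in>star_facets X \<tau>. real_of_int (p (Inl \<sigma>)) *\<^sub>R Z \<tau> \<sigma>) + ?s) $ k = 0" for k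
    proof -
      have "real_of_int (\<Sum>i\<in>I. A (\<tau>, k) i * p i) = 0"
        using p[of "(\<tau>, k)"] \<tau> by (simp add: J_def)
      then show ?thesis
        using eval[OF \<tau>, of k "\<lambda>i. of_int (p i)"] by simp
    qed
    then have "(\<Sum>\<sigma>\<in>star_facets X \<tau>. real_of_int (p (Inl \<sigma>)) *\<^sub>R Z \<tau> \<sigma>) + ?s = 0"
      by (simp add: vec_eq_iff)
    then have "(\<Sum>\<sigma>\<in>star_facets X \<tau>. real_of_int (p (Inl \<sigma>)) *\<^sub>R Z \<tau> \<sigma>) = - ?s"
      by (simp add: eq_neg_iff_add_eq_0)
    moreover have "- ?s \<in> span (B \<tau>)"
      by (intro span_neg span_sum span_scale span_base)
    ultimately show "(\<Sum>\<sigma>\<in>star_facets X \<tau>. real_of_int (p (Inl \<sigma>)) *\<^sub>R Z \<tau> \<sigma>) \<in> parallel_space \<tau>"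
      using B(3)[OF \<tau>] by simp
  qed
  ultimately show ?thesis
    using that[of "\<lambda>\<sigma>. p (Inl \<sigma>)"] by blast
qed

text \<open>The cell structure consists of the faces of the facets with positive weight. At its
  ridges the omitted facets have weight 0, so balancing is inherited, and the integral map with the
  same support is the weighting.\<close>

lemma support_tropical_variety:
  assumes X: "tropical_complex X" "complex_dim X = int k"
    and bal: "balanced X \<omega>" and ne: "\<exists>\<sigma>\<in>facets X. \<omega> \<sigma> > 0"
  shows "tropical_variety k (\<Union>{\<sigma>\<in>facets X. \<omega> \<sigma> > 0})"
proof -
  note T = tropical_complexD[OF X(1)]
  obtain Z where Z: "lattice_normals X Z"
    using lattice_normals_exist[OF X(1)] .
  obtain p where p: "balanced X (\<lambda>\<sigma>. of_int (p \<sigma>))"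
    and p_pos: "\<And>\<sigma>. \<sigma> \<in> facets X \<Longrightarrow> \<omega> \<sigma> > 0 \<Longrightarrow> (p \<sigma> :: int) > 0"
    and p_0: "\<And>\<sigma>. \<sigma> \<in> facets X \<Longrightarrow> \<omega> \<sigma> = 0 \<Longrightarrow> p \<sigma> = 0"
    using integral_balanced_map[OF T(1,3) Z bal] by metis
  define Y where "Y = {\<rho>\<in>X. \<exists>\<sigma>\<in>facets X. \<omega> \<sigma> > 0 \<and> \<rho> face_of \<sigma>}"
  have sub: "Y \<subseteq> X" by (auto simp: Y_def)
  have refl: "\<sigma> face_of \<sigma>" if "\<sigma> \<in> facets X" for \<sigma>
    using that polyhedral_complex_cell(3)[OF T(1)] face_of_refl by (auto simp: facets_def)
  have Y_facet: "\<sigma> \<in> Y \<longleftrightarrow> \<omega> \<sigma> > 0" if "\<sigma> \<in> facets X" for \<sigma>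
  proof
    assume "\<sigma> \<in> Y"
    then obtain \<sigma>' where "\<sigma>' \<in> facets X" "\<omega> \<sigma>' > 0" "\<sigma> face_of \<sigma>'"
      by (auto simp: Y_def)
    then show "\<omega> \<sigma> > 0"
      using facet_eq[OF T(1) that, of \<sigma>'] by (auto simp: facets_def)
  next
    assume "\<omega> \<sigma> > 0"
    then show "\<sigma> \<in> Y"
      using that refl by (auto simp: Y_def facets_def)
  qed
  have "polyhedral_complex Y"
    unfolding polyhedral_complex_def
  proof (intro conjI ballI allI impI)
    show "finite Y"
      using sub polyhedral_complex_finite[OF T(1)] finite_subset by blast
    show "Y \<noteq> {}"
      using ne Y_facet by blast
    show "polyhedron \<rho>" "\<rho> \<noteq> {}" if "\<rho> \<in> Y" for \<rho>
      using that sub polyhedral_complex_cell[OF T(1)] by blast+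
    show "F \<in> Y" if "\<rho> \<in> Y" "F face_of \<rho> \<and> F \<noteq> {}" for \<rho> F
      using that polyhedral_complex_face[OF T(1)] face_of_trans[of F \<rho>] by (auto simp: Y_def)
    show "\<rho> \<inter> \<rho>' face_of \<rho>" "\<rho> \<inter> \<rho>' face_of \<rho>'" if "\<rho> \<in> Y" "\<rho>' \<in> Y" for \<rho> \<rho>'
      using that sub T(1) unfolding polyhedral_complex_def by blast+
  qed
  note Y = this
  \<comment> \<open>A facet of positive weight survives, so the dimension does not drop and ridges
    of \<open>Y\<close> are ridges of \<open>X\<close>.\<close>
  have dim: "complex_dim Y = complex_dim X"
  proof -
    obtain \<sigma> where "\<sigma> \<in> facets X" "\<sigma> \<in> Y"
      using ne Y_facet by blast
    then have "complex_dim X \<le> complex_dim Y"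
      using aff_dim_le_complex_dim[OF Y, of \<sigma>] by (simp add: facets_def)
    moreover have "complex_dim Y \<le> complex_dim X"
      using facets_nonempty[OF Y] sub aff_dim_le_complex_dim[OF T(1)] by (force simp: facets_def)
    ultimately show ?thesis by simp
  qed
  have fY: "facets Y = {\<sigma>\<in>facets X. \<omega> \<sigma> > 0}"
    using Y_facet sub by (auto simp: facets_def dim)
  have rY: "ridges Y \<subseteq> ridges X"
    using sub by (auto simp: ridges_def dim)
  have pure: "pure_complex Y"
    unfolding pure_complex_def fY by (auto simp: Y_def)
  have UY: "\<Union>Y = \<Union>{\<sigma>\<in>facets X. \<omega> \<sigma> > 0}"
    using Union_facets[OF Y pure] fY by simp
  have rat: "rational_complex Y"
    using T(3) rY fY by (auto simp: rational_complex_def)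
  have ZY: "lattice_normals Y Z"
    using Z rY by (auto simp: lattice_normals_def star_facets_def fY)
  have "(\<Sum>\<sigma>\<in>star_facets Y \<tau>. real_of_int (p \<sigma>) *\<^sub>R Z \<tau> \<sigma>) =
      (\<Sum>\<sigma>\<in>star_facets X \<tau>. real_of_int (p \<sigma>) *\<^sub>R Z \<tau> \<sigma>)" for \<tau>
  proof (intro sum.mono_neutral_left ballI)
    fix \<sigma> assume "\<sigma> \<in> star_facets X \<tau> - star_facets Y \<tau>"
    then have "\<sigma> \<in> facets X" "\<not> \<omega> \<sigma> > 0"
      by (auto simp: star_facets_def fY)
    then have "p \<sigma> = 0"
      using p_0 bal by (force simp: balanced_def)
    then show "real_of_int (p \<sigma>) *\<^sub>R Z \<tau> \<sigma> = 0" by simp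
  qed (use finite_star_facets[OF T(1)] in \<open>auto simp: star_facets_def fY\<close>)
  then have "balanced Y (\<lambda>\<sigma>. of_int (p \<sigma>))"
    using p rY unfolding balanced_iff[OF T(1,3) Z] balanced_iff[OF Y rat ZY] fY by auto
  moreover have "weighting Y (\<lambda>\<sigma>. of_int (p \<sigma>))"
    using p_pos by (auto simp: weighting_def fY)
  ultimately have "tropical_complex Y"
    using Y pure rat unfolding tropical_complex_def by blast
  then show ?thesis
    using dim X(2) UY unfolding tropical_variety_def by (intro exI[of _ Y]) simp
qed

section \<open>Facets around a ridge\<close>

text \<open>Improves \<open>enters_star_facet\<close>, which reaches only the closed facet:
  transversality makes the coefficient along the normal positive, and
  \<open>inward_normal_enters\<close> then gives the relative interior.\<close>

lemma ridge_enters: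
  assumes X: "tropical_complex X" and \<tau>: "\<tau> \<in> ridges X" and x: "x \<in> rel_interior \<tau>"
    and e: "enters x v (\<Union>X)" and v: "v \<notin> parallel_space \<tau>"
  obtains \<sigma> where "\<sigma> \<in> star_facets X \<tau>" "enters x v (rel_interior \<sigma>)"
proof -
  note T = tropical_complexD[OF X]
  obtain Z where Z: "lattice_normals X Z"
    using lattice_normals_exist[OF X] .
  have "\<tau> \<in> X"
    using \<tau> by (simp add: ridges_def)
  then obtain \<sigma> where \<sigma>: "\<sigma> \<in> star_facets X \<tau>" "enters x v \<sigma>"
    using enters_star_facet[OF T(1,2) _ x e] by blast
  then have cvx: "convex \<sigma>" and cl: "closed \<sigma>"
    using polyhedral_complex_cell[OF T(1)] by (auto simp: star_facets_def facets_def)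
  have n: "inward_normal \<tau> \<sigma> (Z \<tau> \<sigma>)"
    using lattice_normal_inward[OF T(1,3) \<tau> \<sigma>(1)] Z \<tau> \<sigma>(1) by (auto simp: lattice_normals_def)
  have xaff: "x \<in> affine hull \<tau>"
    using x by (rule rel_interior_in_hull)
  have "x \<in> affine hull \<sigma>"
    using enters_closed[OF \<sigma>(2) cl] by (simp add: hull_inc)
  then have "v \<in> parallel_space \<sigma>"
    using \<sigma>(2) by (intro enters_parallel_space)
  then obtain l c where lc: "v = l + c *\<^sub>R Z \<tau> \<sigma>" "l \<in> parallel_space \<tau>"
    using n by (elim inward_normal_decompose)
  then have "0 < c"
    using inward_normal_pos[OF n cvx xaff] \<sigma>(2) v by blast
  then have "enters x v (rel_interior \<sigma>)"
    using inward_normal_enters[OF n cvx x] lc by blast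
  with \<sigma>(1) show ?thesis using that by blast
qed

text \<open>\<open>\<sigma>\<close> is the only cell through \<open>x\<close>, so the ray has to
  continue in it.\<close>

lemma facet_enters:
  assumes X: "polyhedral_complex X" "pure_complex X" and \<sigma>: "\<sigma> \<in> facets X"
    and x: "x \<in> rel_interior \<sigma>" and e: "enters x v (\<Union>X)"
  shows "v \<in> parallel_space \<sigma>" "enters x v (rel_interior \<sigma>)"
proof -
  obtain \<sigma>' where \<sigma>': "\<sigma>' \<in> facets X" "enters x v \<sigma>'" "x \<in> \<sigma>'"
    using X e by (rule enters_facet)
  then have "\<sigma>' = \<sigma>"
    using facet_carrier_eq[OF X(1) \<sigma> _ x] by (auto simp: facets_def)
  then show "v \<in> parallel_space \<sigma>"
    using \<sigma>' by (intro enters_parallel_space) (auto simp: hull_inc)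
  then show "enters x v (rel_interior \<sigma>)"
    using x by (intro enters_rel_interior)
qed

text \<open>Seen from \<open>x\<close>, every point of \<open>S\<close> lies in a direction that
  stays in \<open>\<Union>X\<close> for small times, and at \<open>x\<close> only directions
  parallel to \<open>\<sigma>\<close> do. This locates cells of one complex relative to
  another.\<close>

lemma convex_in_facet:
  assumes X: "polyhedral_complex X" "pure_complex X" and \<sigma>: "\<sigma> \<in> facets X"
    and x: "x \<in> rel_interior \<sigma>" and S: "convex S" "x \<in> S" "S \<subseteq> \<Union>X"
  shows "parallel_space S \<subseteq> parallel_space \<sigma>"
proof (rule parallel_space_mono, rule subsetI)
  fix y assume "y \<in> S"
  have "x + t *\<^sub>R (y - x) \<in> S" if "0 < t" "t < 1" for t
  proof -
    have "(1 - t) *\<^sub>R x + t *\<^sub>R y \<in> S"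
      using that \<open>y \<in> S\<close> S by (intro convexD_alt) auto
    then show ?thesis by (simp add: algebra_simps)
  qed
  then have "enters x (y - x) S"
    unfolding enters_def eventually_at_right_field by (intro exI[of _ 1]) auto
  then have "enters x (y - x) (\<Union>X)"
    using S(3) by (rule enters_mono)
  then have "y - x \<in> parallel_space \<sigma>"
    using X \<sigma> x by (intro facet_enters(1))
  moreover have "x \<in> affine hull \<sigma>"
    using x by (rule rel_interior_in_hull)
  ultimately have "x + (y - x) \<in> affine hull \<sigma>"
    by (simp only: add_parallel_space_iff)
  then show "y \<in> affine hull \<sigma>" by simp
qed

lemma star_facet_enters:
  assumes X: "polyhedral_complex X" "rational_complex X" and Z: "lattice_normals X Z"
    and \<tau>: "\<tau> \<in> ridges X" and \<sigma>: "\<sigma> \<in> star_facets X \<tau>" and x: "x \<in> rel_interior \<tau>"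
    and l: "l \<in> parallel_space \<tau>" and c: "0 < c"
  shows "enters x (l + c *\<^sub>R Z \<tau> \<sigma>) (rel_interior \<sigma>)"
proof (rule inward_normal_enters[OF _ _ x l c])
  show "inward_normal \<tau> \<sigma> (Z \<tau> \<sigma>)"
    using lattice_normal_inward[OF X \<tau> \<sigma>] Z \<tau> \<sigma> by (auto simp: lattice_normals_def)
  show "convex \<sigma>"
    using \<sigma> polyhedral_complex_cell(3)[OF X(1)] by (auto simp: star_facets_def facets_def)
qed

text \<open>With congruent normals one ray enters both relative interiors, and these are disjoint
  for different cells.\<close>

lemma star_facet_eqI:
  assumes X: "polyhedral_complex X" "rational_complex X" and Z: "lattice_normals X Z"
    and \<tau>: "\<tau> \<in> ridges X" and \<sigma>: "\<sigma> \<in> star_facets X \<tau>" "\<sigma>' \<in> star_facets X \<tau>"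
    and d: "Z \<tau> \<sigma> - Z \<tau> \<sigma>' \<in> parallel_space \<tau>"
  shows "\<sigma> = \<sigma>'"
proof -
  have \<tau>X: "\<tau> \<in> X" "\<sigma> \<in> X" "\<sigma>' \<in> X"
    using \<tau> \<sigma> by (auto simp: ridges_def star_facets_def facets_def)
  obtain x where x: "x \<in> rel_interior \<tau>"
    using polyhedral_complex_cell(2,3)[OF X(1) \<tau>X(1)] rel_interior_eq_empty by blast
  have "subspace (parallel_space \<tau>)"
    using polyhedral_complex_cell(2)[OF X(1) \<tau>X(1)] by (rule subspace_parallel_space)
  from star_facet_enters[OF X Z \<tau> \<sigma>(1) x subspace_0[OF this] zero_less_one]
    star_facet_enters[OF X Z \<tau> \<sigma>(2) x d zero_less_one]
  show ?thesis
    using enters_cell_unique[OF X(1) \<tau>X(2,3), of x "Z \<tau> \<sigma>"] by simp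
qed

text \<open>If all facets around a ridge span the same space, each of them lies on one of the two sides
  of the ridge, and balancing forces equal weights on both sides.\<close>

lemma flat_ridge:
  assumes X: "tropical_complex X" and bal: "balanced X \<omega>"
    and \<tau>: "\<tau> \<in> ridges X" and x: "x \<in> rel_interior \<tau>"
    and M: "\<And>\<sigma>. \<sigma> \<in> star_facets X \<tau> \<Longrightarrow> parallel_space \<sigma> = M"
    and \<sigma>0: "\<sigma>0 \<in> star_facets X \<tau>" "\<omega> \<sigma>0 > 0" and v: "v \<in> M" "v \<notin> parallel_space \<tau>"
  obtains \<sigma> where "\<sigma> \<in> star_facets X \<tau>" "\<omega> \<sigma> = \<omega> \<sigma>0" "enters x v (rel_interior \<sigma>)"
proof -
  note T = tropical_complexD[OF X]
  obtain Z where Z: "lattice_normals X Z"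
    using lattice_normals_exist[OF X] .
  have \<tau>ne: "\<tau> \<noteq> {}"
    using x rel_interior_subset by blast
  then have sub: "subspace (parallel_space \<tau>)"
    by (rule subspace_parallel_space)
  have lat: "lattice_normal \<tau> \<sigma> (Z \<tau> \<sigma>)" if "\<sigma> \<in> star_facets X \<tau>" for \<sigma>
    using Z \<tau> that by (auto simp: lattice_normals_def)
  then have n: "inward_normal \<tau> \<sigma> (Z \<tau> \<sigma>)" if "\<sigma> \<in> star_facets X \<tau>" for \<sigma>
    using lattice_normal_inward[OF T(1,3) \<tau>] that by blast
  define z where "z = Z \<tau> \<sigma>0"
  have z: "z \<notin> parallel_space \<tau>"
    using n[OF \<sigma>0(1)] by (simp add: inward_normal_def z_def)
  have scaleD: "b = 0" if "b *\<^sub>R z \<in> parallel_space \<tau>" for b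
    using subspace_scale[OF sub that, of "1/b"] z by (cases "b = 0") auto
  obtain l c where lc: "v = l + c *\<^sub>R z" "l \<in> parallel_space \<tau>"
    using n[OF \<sigma>0(1)] v(1) M[OF \<sigma>0(1)] unfolding z_def by (elim inward_normal_decompose) auto
  have "c \<noteq> 0"
    using v(2) lc by auto
  then consider "c > 0" | "c < 0" by linarith
  then show ?thesis
  proof cases
    case 1
    then have "enters x v (rel_interior \<sigma>0)"
      using star_facet_enters[OF T(1,3) Z \<tau> \<sigma>0(1) x lc(2)] lc(1) by (simp add: z_def)
    then show ?thesis using that \<sigma>0(1) by blast
  next
    \<comment> \<open>Here \<open>v\<close> points away from \<open>\<sigma>0\<close>, and the facet
      on the other side has to be found.\<close>
    case 2
    \<comment> \<open>In a common parallel space the normal is fixed up to sign, and equal signs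
      mean equal facets.\<close>
    have opp: "z + Z \<tau> \<sigma> \<in> parallel_space \<tau>" if "\<sigma> \<in> star_facets X \<tau>" "\<sigma> \<noteq> \<sigma>0" for \<sigma>
    proof -
      have "\<not> z - Z \<tau> \<sigma> \<in> parallel_space \<tau>"
        using star_facet_eqI[OF T(1,3) Z \<tau> \<sigma>0(1) that(1)] that(2) by (auto simp: z_def)
      then show ?thesis
        using lattice_normal_unique_upto_sign[OF lat[OF \<sigma>0(1)] lat[OF that(1)] refl _ \<tau>ne]
          M[OF \<sigma>0(1)] M[OF that(1)] z by (auto simp: z_def)
    qed
    have sum: "(\<Sum>\<sigma>\<in>star_facets X \<tau>. \<omega> \<sigma> *\<^sub>R Z \<tau> \<sigma>) \<in> parallel_space \<tau>"
      using bal \<tau> by (simp add: balanced_iff[OF T(1,3) Z])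
    \<comment> \<open>A single positive term cannot balance.\<close>
    have "star_facets X \<tau> \<noteq> {\<sigma>0}"
    proof
      assume "star_facets X \<tau> = {\<sigma>0}"
      then have "\<omega> \<sigma>0 *\<^sub>R z \<in> parallel_space \<tau>"
        using sum by (simp add: z_def)
      then show False
        using scaleD \<sigma>0(2) by force
    qed
    then obtain \<sigma>1 where \<sigma>1: "\<sigma>1 \<in> star_facets X \<tau>" "\<sigma>1 \<noteq> \<sigma>0"
      using \<sigma>0(1) by blast
    have "\<sigma> = \<sigma>1" if "\<sigma> \<in> star_facets X \<tau>" "\<sigma> \<noteq> \<sigma>0" for \<sigma>
    proof (rule star_facet_eqI[OF T(1,3) Z \<tau> that(1) \<sigma>1(1)])
      have "(z + Z \<tau> \<sigma>) - (z + Z \<tau> \<sigma>1) \<in> parallel_space \<tau>"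
        using sub opp[OF that] opp[OF \<sigma>1] by (rule subspace_diff)
      then show "Z \<tau> \<sigma> - Z \<tau> \<sigma>1 \<in> parallel_space \<tau>" by simp
    qed
    then have "star_facets X \<tau> = {\<sigma>0, \<sigma>1}"
      using \<sigma>0(1) \<sigma>1(1) by blast
    then have "\<omega> \<sigma>0 *\<^sub>R z + \<omega> \<sigma>1 *\<^sub>R Z \<tau> \<sigma>1 \<in> parallel_space \<tau>"
      using sum \<sigma>1(2) by (simp add: z_def)
    \<comment> \<open>Eliminating the second normal leaves the difference of the two weights as the
      coefficient of \<open>z\<close>.\<close>
    then have "(\<omega> \<sigma>0 *\<^sub>R z + \<omega> \<sigma>1 *\<^sub>R Z \<tau> \<sigma>1) - \<omega> \<sigma>1 *\<^sub>R (z + Z \<tau> \<sigma>1) \<in> parallel_space \<tau>"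
      using sub opp[OF \<sigma>1] by (intro subspace_diff subspace_scale)
    then have "(\<omega> \<sigma>0 - \<omega> \<sigma>1) *\<^sub>R z \<in> parallel_space \<tau>"
      by (simp add: algebra_simps)
    then have eq: "\<omega> \<sigma>1 = \<omega> \<sigma>0"
      using scaleD by force
    \<comment> \<open>In terms of the normal of \<open>\<sigma>1\<close> the coefficient of
      \<open>v\<close> becomes \<open>- c\<close>, which is positive.\<close>
    have "enters x ((l + c *\<^sub>R (z + Z \<tau> \<sigma>1)) + (- c) *\<^sub>R Z \<tau> \<sigma>1) (rel_interior \<sigma>1)"
      using 2 by (intro star_facet_enters[OF T(1,3) Z \<tau> \<sigma>1(1) x]
          subspace_add[OF sub lc(2) subspace_scale[OF sub opp[OF \<sigma>1]]]) auto
    also have "(l + c *\<^sub>R (z + Z \<tau> \<sigma>1)) + (- c) *\<^sub>R Z \<tau> \<sigma>1 = v"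
      by (simp add: lc(1) algebra_simps)
    finally show ?thesis
      using that \<sigma>1(1) eq by blast
  qed
qed

text \<open>The common direction \<open>v\<close> spans both parallel spaces modulo that of the
  ridge. So they coincide, and the normals agree up to sign. Since \<open>v\<close> has a positive
  coefficient along both normals, the opposite sign is excluded.\<close>

lemma lattice_normals_agree:
  assumes n: "inward_normal \<tau> \<sigma> z" "inward_normal \<tau>' \<sigma>' z'"
    and lat: "lattice_normal \<tau> \<sigma> z" "lattice_normal \<tau>' \<sigma>' z'"
    and cvx: "convex \<sigma>" "convex \<sigma>'"
    and x: "x \<in> rel_interior \<tau>" "x \<in> rel_interior \<tau>'"
    and eq: "parallel_space \<tau>' = parallel_space \<tau>"
    and e: "enters x v \<sigma>" "enters x v \<sigma>'" and v: "v \<notin> parallel_space \<tau>"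
  shows "z - z' \<in> parallel_space \<tau>"
proof (rule ccontr)
  assume ndiff: "z - z' \<notin> parallel_space \<tau>"
  have "x \<in> \<tau>" "x \<in> \<tau>'"
    using x rel_interior_subset by blast+
  moreover have "\<tau> \<subseteq> \<sigma>" "\<tau>' \<subseteq> \<sigma>'"
    using n face_of_imp_subset by (auto simp: inward_normal_def)
  ultimately have aff: "x \<in> affine hull \<tau>" "x \<in> affine hull \<tau>'" "x \<in> affine hull \<sigma>" "x \<in> affine hull \<sigma>'"
    and ne: "\<tau> \<noteq> {}" "\<sigma> \<noteq> {}" "\<sigma>' \<noteq> {}"
    by (auto simp: hull_inc)
  note sub = ne[THEN subspace_parallel_space]
  have z: "z \<notin> parallel_space \<tau>" "z' \<notin> parallel_space \<tau>"
    using n eq by (auto simp: inward_normal_def)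
  have vp: "v \<in> parallel_space \<sigma>" "v \<in> parallel_space \<sigma>'"
    using e aff by (auto intro: enters_parallel_space)
  obtain l c where lc: "v = l + c *\<^sub>R z" "l \<in> parallel_space \<tau>"
    using n(1) vp(1) by (rule inward_normal_decompose)
  obtain l' c' where lc': "v = l' + c' *\<^sub>R z'" "l' \<in> parallel_space \<tau>"
    using n(2) vp(2) eq by (elim inward_normal_decompose) auto
  have c: "c > 0"
    using inward_normal_pos[OF n(1) cvx(1) aff(1) lc(2)] e(1) v lc(1) by simp
  have c': "c' > 0"
    using inward_normal_pos[OF n(2) cvx(2) aff(2), of l' c'] lc' e(2) v eq by simp
  have p: "parallel_space \<sigma> = {l + c *\<^sub>R z | l c. l \<in> parallel_space \<tau>}"
    "parallel_space \<sigma>' = {l + c *\<^sub>R z' | l c. l \<in> parallel_space \<tau>}"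
    using n eq by (auto simp: inward_normal_def)
  have "z = (1/c) *\<^sub>R (l' - l) + (c'/c) *\<^sub>R z'" "z' = (1/c') *\<^sub>R (l - l') + (c/c') *\<^sub>R z"
  proof -
    have "c *\<^sub>R z = (l' - l) + c' *\<^sub>R z'" "c' *\<^sub>R z' = (l - l') + c *\<^sub>R z"
      using lc(1) lc'(1) by (simp_all add: algebra_simps)
    then have *: "(1/c) *\<^sub>R c *\<^sub>R z = (1/c) *\<^sub>R ((l' - l) + c' *\<^sub>R z')"
      "(1/c') *\<^sub>R c' *\<^sub>R z' = (1/c') *\<^sub>R ((l - l') + c *\<^sub>R z)"
      by simp_all
    show "z = (1/c) *\<^sub>R (l' - l) + (c'/c) *\<^sub>R z'"
      using *(1) c by (simp add: scaleR_add_right)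
    show "z' = (1/c') *\<^sub>R (l - l') + (c/c') *\<^sub>R z"
      using *(2) c' by (simp add: scaleR_add_right)
  qed
  then have "z \<in> parallel_space \<sigma>'" "z' \<in> parallel_space \<sigma>"
    unfolding p using lc(2) lc'(2) subspace_scale[OF sub(1)] subspace_diff[OF sub(1)] by blast+
  moreover have "parallel_space \<tau> \<subseteq> parallel_space \<sigma>" "parallel_space \<tau> \<subseteq> parallel_space \<sigma>'"
  proof -
    have "parallel_space \<tau> \<subseteq> {l + c *\<^sub>R w | l c. l \<in> parallel_space \<tau>}" for w
      by (intro subsetI CollectI exI[of _ "0::real"] exI) auto
    then show "parallel_space \<tau> \<subseteq> parallel_space \<sigma>" "parallel_space \<tau> \<subseteq> parallel_space \<sigma>'"
      unfolding p by blast+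
  qed
  ultimately have "l + c *\<^sub>R z \<in> parallel_space \<sigma>'" "l + c *\<^sub>R z' \<in> parallel_space \<sigma>"
    if "l \<in> parallel_space \<tau>" for l c
    using sub that by (auto intro!: subspace_add subspace_scale)
  then have "parallel_space \<sigma> \<subseteq> parallel_space \<sigma>'" "parallel_space \<sigma>' \<subseteq> parallel_space \<sigma>"
    by (subst p, blast)+
  then have "z + z' \<in> parallel_space \<tau>"
    using lattice_normal_unique_upto_sign[OF lat eq[symmetric] _ ne(1) z(1)] ndiff by blast
  \<comment> \<open>The opposite sign puts \<open>(c + c') *\<^sub>R z'\<close> into the parallel
    space of the ridge, although \<open>c + c'\<close> is positive.\<close>
  then have "c *\<^sub>R (z + z') - (l' - l) \<in> parallel_space \<tau>"
    using lc(2) lc'(2) sub(1) by (intro subspace_diff subspace_scale)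
  also have "c *\<^sub>R (z + z') - (l' - l) = (c + c') *\<^sub>R z'"
    using lc(1) lc'(1) by (simp add: algebra_simps)
  finally have "(1 / (c + c')) *\<^sub>R (c + c') *\<^sub>R z' \<in> parallel_space \<tau>"
    by (rule subspace_scale[OF sub(1)])
  then show False
    using c c' z(2) by simp
qed

section \<open>Tropical varieties inside a tropical variety of the same dimension\<close>

text \<open>Only the underlying sets are nested: a cell of \<open>Y\<close> may cross many cells of
  \<open>X\<close>, and conversely.\<close>

locale tropical_subcomplex =
  fixes X Y :: "(real^'d) set set" and \<eta> :: "(real^'d) set \<Rightarrow> real"
  assumes X: "tropical_complex X" and Y: "tropical_complex Y"
    and dim: "complex_dim Y = complex_dim X" and sub: "\<Union>Y \<subseteq> \<Union>X"
    and bal: "balanced Y \<eta>" and pos: "\<And>\<sigma>. \<sigma> \<in> facets Y \<Longrightarrow> 0 < \<eta> \<sigma>"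
begin

lemmas XT = tropical_complexD[OF X]
lemmas YT = tropical_complexD[OF Y]

section \<open>Constancy of the weights of \<open>Y\<close> along a facet of
  \<open>X\<close>\<close>

lemma parallel_facets:
  assumes \<sigma>: "\<sigma> \<in> facets X" "x \<in> rel_interior \<sigma>" and \<sigma>': "\<sigma>' \<in> facets Y" "x \<in> \<sigma>'"
  shows "parallel_space \<sigma>' = parallel_space \<sigma>"
proof (rule parallel_space_eqI)
  have "\<sigma>' \<in> Y" "\<sigma> \<in> X" using \<sigma> \<sigma>' by (auto simp: facets_def)
  then show "parallel_space \<sigma>' \<subseteq> parallel_space \<sigma>" "\<sigma>' \<noteq> {}" "\<sigma> \<noteq> {}"
    using convex_in_facet[OF XT(1,2) \<sigma>, of \<sigma>'] \<sigma>' sub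
      polyhedral_complex_cell[OF YT(1)] polyhedral_complex_cell[OF XT(1)] by blast+
  show "aff_dim \<sigma>' = aff_dim \<sigma>"
    using \<sigma> \<sigma>' dim by (simp add: facets_def)
qed

text \<open>Move from \<open>p\<close> to a generic point outside the facets of the given weight.  Where the segment
  leaves these facets it crosses a ridge of \<open>Y\<close> transversally, and balancing at this ridge
  continues the weight to the other side.\<close>

lemma weight_constant:
  assumes \<sigma>: "\<sigma> \<in> facets X" and \<sigma>': "\<sigma>' \<in> facets Y"
    and p: "p \<in> rel_interior \<sigma>" "p \<in> rel_interior \<sigma>'"
  shows "rel_interior \<sigma> \<subseteq> \<Union>{\<sigma>''\<in>facets Y. \<eta> \<sigma>'' = \<eta> \<sigma>'}" (is "_ \<subseteq> ?A")
proof (rule ccontr)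
  assume "\<not> rel_interior \<sigma> \<subseteq> ?A"
  then have ne: "rel_interior \<sigma> \<inter> - ?A \<noteq> {}" by blast
  have \<sigma>X: "\<sigma> \<in> X" "aff_dim \<sigma> = complex_dim X"
    using \<sigma> by (auto simp: facets_def)
  have cvx: "convex \<sigma>" using polyhedral_complex_cell(3)[OF XT(1) \<sigma>X(1)] .
  have A: "closed ?A"
    using polyhedral_complex_finite[OF YT(1)] polyhedral_complex_cell(4)[OF YT(1)]
    by (intro closed_Union) (auto simp: facets_def)
  have op: "openin (top_of_set (affine hull \<sigma>)) (rel_interior \<sigma> \<inter> - ?A)"
    using A by (intro openin_Int_open openin_rel_interior) (auto simp: open_Compl)
  \<comment> \<open>Off the first family of hulls, the segment from \<open>p\<close> to
    \<open>q\<close> crosses ridges of \<open>Y\<close> transversally; off the second, it misses the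
    cells of codimension at least two. Adjoining \<open>p\<close> raises the dimension by at most
    one, so no hull contains \<open>\<sigma>\<close>.\<close>
  define F where "F = {\<rho>\<in>Y. aff_dim \<rho> < complex_dim X} \<union>
      insert p ` {\<rho>\<in>Y. aff_dim \<rho> < complex_dim X - 1}"
  have "finite F"
    using polyhedral_complex_finite[OF YT(1)] by (simp add: F_def)
  moreover have "\<not> \<sigma> \<subseteq> affine hull T" if "T \<in> F" for T
  proof
    assume "\<sigma> \<subseteq> affine hull T"
    then have "complex_dim X \<le> aff_dim T"
      using aff_dim_subset[of \<sigma> "affine hull T"] \<sigma>X(2) by (simp add: aff_dim_affine_hull)
    moreover have "aff_dim T < complex_dim X"
      using that by (auto simp: F_def aff_dim_insert)
    ultimately show False by simp
  qed
  ultimately obtain q where q: "q \<in> rel_interior \<sigma> \<inter> - ?A" and q_gen: "\<And>T. T \<in> F \<Longrightarrow> q \<notin> affine hull T"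
    using generic_point[OF _ op ne] by blast
  define v where "v = q - p"
  define T where "T = {t\<in>{0..1}. p + t *\<^sub>R v \<in> ?A}"
  have "T = {0..1} \<inter> (\<lambda>t. p + t *\<^sub>R v) -` ?A"
    by (auto simp: T_def)
  moreover have "compact ({0..1} \<inter> (\<lambda>t. p + t *\<^sub>R v) -` ?A)"
    by (intro compact_Int_closed compact_Icc continuous_closed_vimage A) (auto intro!: continuous_intros)
  ultimately have "compact T" by simp
  moreover have "0 \<in> T"
    using p(2) \<sigma>' rel_interior_subset by (auto simp: T_def)
  ultimately obtain s where s: "s \<in> T" and s_max: "\<And>t. t \<in> T \<Longrightarrow> t \<le> s"
    using compact_attains_sup[of T] by blast
  have "s \<noteq> 1"
    using s q by (auto simp: T_def v_def)
  then have s01: "0 \<le> s" "s < 1"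
    using s by (auto simp: T_def)
  define x where "x = p + s *\<^sub>R v"
  \<comment> \<open>By the maximality of \<open>s\<close>, all later points of the segment are
    outside \<open>?A\<close>.\<close>
  have leaves: "\<not> enters x v ?A"
  proof
    assume "enters x v ?A"
    then have "\<forall>\<^sub>F t in at_right 0. x + t *\<^sub>R v \<in> ?A"
      by (simp only: enters_def)
    moreover have "\<forall>\<^sub>F t in at_right 0. 0 < t \<and> t < 1 - s"
      unfolding eventually_at_right_field using s01 by (intro exI[of _ "1 - s"]) auto
    ultimately have "\<forall>\<^sub>F t in at_right (0::real). False"
    proof eventually_elim
      case (elim t)
      then have "s + t \<in> T"
        using s01 by (auto simp: T_def x_def algebra_simps)
      then show False
        using s_max[of "s + t"] elim by simp
    qed
    then show False by simp
  qed
  have "x \<in> rel_interior \<sigma>"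
  proof -
    have "(1 - s) *\<^sub>R p + s *\<^sub>R q \<in> rel_interior \<sigma>"
      using p(1) q s01 by (intro convexD_alt convex_rel_interior cvx) auto
    then show ?thesis by (simp add: x_def v_def algebra_simps)
  qed
  note x = this
  obtain \<sigma>1 where \<sigma>1: "\<sigma>1 \<in> facets Y" "\<eta> \<sigma>1 = \<eta> \<sigma>'" "x \<in> \<sigma>1"
    using s by (auto simp: T_def x_def)
  have v_par: "v \<in> parallel_space \<sigma>"
    unfolding v_def using p(1) q by (intro diff_in_parallel_space rel_interior_in_hull) auto
  have q_eq: "q = x + (1 - s) *\<^sub>R v"
    by (simp add: x_def v_def algebra_simps)
  have \<sigma>1Y: "\<sigma>1 \<in> Y" using \<sigma>1 by (simp add: facets_def)
  then obtain \<rho> where \<rho>: "\<rho> \<in> Y" "x \<in> rel_interior \<rho>"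
    using obtains_carrier[OF YT(1)] \<sigma>1(3) by blast
  then have \<rho>f: "\<rho> face_of \<sigma>1"
    using carrier_face_of[OF YT(1) _ \<sigma>1Y] \<sigma>1(3) by blast
  have xaff: "x \<in> affine hull \<rho>"
    using \<rho>(2) by (rule rel_interior_in_hull)
  have "aff_dim \<rho> \<le> complex_dim X"
    using aff_dim_le_complex_dim[OF YT(1) \<rho>(1)] dim by simp
  then consider "aff_dim \<rho> = complex_dim X" | "aff_dim \<rho> = complex_dim X - 1"
    | "aff_dim \<rho> < complex_dim X - 1"
    by linarith
  then show False
  proof cases
    \<comment> \<open>The point \<open>x\<close> is interior to a facet of \<open>Y\<close>, so the
      segment would continue inside it.\<close>
    case 1
    then have "\<rho> \<in> facets Y"
      using \<rho>(1) dim by (simp add: facets_def)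
    then have "\<sigma>1 = \<rho>"
      using facet_eq[OF YT(1) _ \<sigma>1Y \<rho>f] by simp
    moreover have "parallel_space \<sigma>1 = parallel_space \<sigma>"
      using parallel_facets[OF \<sigma> x \<sigma>1(1,3)] .
    ultimately have "enters x v (rel_interior \<sigma>1)"
      using enters_rel_interior \<rho>(2) v_par by blast
    then have "enters x v ?A"
      using \<sigma>1 rel_interior_subset by (elim enters_mono) blast
    then show False using leaves by blast
  next
    case 2
    then have \<rho>r: "\<rho> \<in> ridges Y"
      using \<rho>(1) dim by (simp add: ridges_def)
    have M: "parallel_space \<sigma>2 = parallel_space \<sigma>" if "\<sigma>2 \<in> star_facets Y \<rho>" for \<sigma>2
      using that \<rho>(2) rel_interior_face_mem
      by (intro parallel_facets[OF \<sigma> x]) (auto simp: star_facets_def)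
    have \<sigma>1s: "\<sigma>1 \<in> star_facets Y \<rho>"
      using \<sigma>1 \<rho>f by (simp add: star_facets_def)
    \<comment> \<open>Otherwise the rest of the segment, and with it \<open>q\<close>, would lie in
      the hull of the ridge.\<close>
    have "v \<notin> parallel_space \<rho>"
    proof
      assume "v \<in> parallel_space \<rho>"
      moreover have "subspace (parallel_space \<rho>)"
        using polyhedral_complex_cell(2)[OF YT(1) \<rho>(1)] by (rule subspace_parallel_space)
      ultimately have "(1 - s) *\<^sub>R v \<in> parallel_space \<rho>"
        by (intro subspace_scale)
      then have "q \<in> affine hull \<rho>"
        unfolding q_eq using xaff by (simp add: add_parallel_space_iff)
      then show False
        using q_gen[of \<rho>] \<rho>(1) 2 by (auto simp: F_def)
    qed
    then obtain \<sigma>2 where \<sigma>2: "\<sigma>2 \<in> star_facets Y \<rho>" "\<eta> \<sigma>2 = \<eta> \<sigma>1" "enters x v (rel_interior \<sigma>2)"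
      using flat_ridge[OF Y bal \<rho>r \<rho>(2) M \<sigma>1s pos[OF \<sigma>1(1)] v_par] by blast
    moreover have "rel_interior \<sigma>2 \<subseteq> ?A"
      using \<sigma>2 \<sigma>1(2) rel_interior_subset[of \<sigma>2] by (auto simp: star_facets_def)
    ultimately show False
      using leaves enters_mono by blast
  next
    case 3
    \<comment> \<open>At \<open>p\<close> the carrier in \<open>Y\<close> is the facet
      \<open>\<sigma>'\<close>, which is too large for this case.\<close>
    have "s \<noteq> 0"
    proof
      assume "s = 0"
      then have "x = p" by (simp add: x_def)
      then have "\<rho> = \<sigma>'"
        using carrier_unique[OF YT(1) \<rho>(1) _ \<rho>(2)] \<sigma>' p(2) by (auto simp: facets_def)
      then show False
        using 3 \<sigma>' dim by (simp add: facets_def)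
    qed
    have "p \<in> affine hull (insert p \<rho>)" "x \<in> affine hull (insert p \<rho>)"
      using xaff hull_mono[of \<rho> "insert p \<rho>" affine] by (auto simp: hull_inc)
    \<comment> \<open>\<open>q\<close> lies on the line through \<open>p\<close> and
      \<open>x\<close>, both of which are in the hull of \<open>insert p \<rho>\<close>.\<close>
    then have "(1 - 1/s) *\<^sub>R p + (1/s) *\<^sub>R x \<in> affine hull (insert p \<rho>)"
      by (intro mem_affine affine_affine_hull) auto
    also have "(1 - 1/s) *\<^sub>R p + (1/s) *\<^sub>R x = q"
      using \<open>s \<noteq> 0\<close> by (simp add: x_def v_def algebra_simps)
    finally show False
      using q_gen[of "insert p \<rho>"] \<rho>(1) 3 by (auto simp: F_def)
  qed
qed

section \<open>Transfer of the weights from the facets of \<open>Y\<close> to those of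
  \<open>X\<close>\<close>

lemma facet_in_subcomplex:
  assumes \<sigma>: "\<sigma> \<in> facets X" and \<sigma>': "\<sigma>' \<in> facets Y"
    and p: "p \<in> rel_interior \<sigma>" "p \<in> rel_interior \<sigma>'"
  shows "\<sigma> \<subseteq> \<Union>Y"
proof -
  have "convex \<sigma>"
    using polyhedral_complex_cell(3)[OF XT(1)] \<sigma> by (auto simp: facets_def)
  have "rel_interior \<sigma> \<subseteq> \<Union>Y"
    using weight_constant[OF assms] by (auto simp: facets_def)
  moreover have "closed (\<Union>Y)"
    using polyhedral_complex_finite[OF YT(1)] polyhedral_complex_cell(4)[OF YT(1)] by (intro closed_Union) auto
  ultimately have "closure (rel_interior \<sigma>) \<subseteq> \<Union>Y"
    by (intro closure_minimal)
  then show ?thesis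
    using convex_closure_rel_interior[OF \<open>convex \<sigma>\<close>] closure_subset by blast
qed

text \<open>By \<open>weight_constant\<close>, a common point of the relative interiors of
  \<open>\<sigma>\<close> and \<open>\<sigma>''\<close> lies in a facet with the weight of
  \<open>\<sigma>'\<close>; but \<open>\<sigma>''\<close> is the only facet of \<open>Y\<close>
  through it.\<close>

lemma weight_unique:
  assumes \<sigma>: "\<sigma> \<in> facets X" and \<sigma>': "\<sigma>' \<in> facets Y" "\<sigma>'' \<in> facets Y"
    and meet: "rel_interior \<sigma> \<inter> rel_interior \<sigma>' \<noteq> {}" "rel_interior \<sigma> \<inter> rel_interior \<sigma>'' \<noteq> {}"
  shows "\<eta> \<sigma>'' = \<eta> \<sigma>'"
proof -
  obtain p q where pq: "p \<in> rel_interior \<sigma>" "p \<in> rel_interior \<sigma>'" "q \<in> rel_interior \<sigma>" "q \<in> rel_interior \<sigma>''"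
    using meet by blast
  then obtain \<sigma>1 where "\<sigma>1 \<in> facets Y" "\<eta> \<sigma>1 = \<eta> \<sigma>'" "q \<in> \<sigma>1"
    using weight_constant[OF \<sigma> \<sigma>'(1) pq(1,2)] by blast
  moreover from this have "\<sigma>1 = \<sigma>''"
    using facet_carrier_eq[OF YT(1) \<sigma>'(2) _ pq(4)] by (auto simp: facets_def)
  ultimately show ?thesis by simp
qed

text \<open>The choice is immaterial by \<open>weight_unique\<close>. The default 0 keeps facets of
  \<open>X\<close> whose relative interior meets that of no facet of \<open>Y\<close> out of the
  support.\<close>

definition induced_weight :: "(real^'d) set \<Rightarrow> real" where
  "induced_weight \<sigma> =
     (if \<exists>\<sigma>'\<in>facets Y. rel_interior \<sigma> \<inter> rel_interior \<sigma>' \<noteq> {}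
      then \<eta> (SOME \<sigma>'. \<sigma>' \<in> facets Y \<and> rel_interior \<sigma> \<inter> rel_interior \<sigma>' \<noteq> {}) else 0)"

lemma induced_weight_eq:
  assumes \<sigma>: "\<sigma> \<in> facets X" and \<sigma>': "\<sigma>' \<in> facets Y"
    and meet: "rel_interior \<sigma> \<inter> rel_interior \<sigma>' \<noteq> {}"
  shows "induced_weight \<sigma> = \<eta> \<sigma>'"
proof -
  let ?P = "\<lambda>\<sigma>'. \<sigma>' \<in> facets Y \<and> rel_interior \<sigma> \<inter> rel_interior \<sigma>' \<noteq> {}"
  have "?P (SOME \<sigma>'. ?P \<sigma>')"
    using \<sigma>' meet by (intro someI[of ?P \<sigma>']) auto
  then have "\<eta> (SOME \<sigma>'. ?P \<sigma>') = \<eta> \<sigma>'"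
    using weight_unique[OF \<sigma> \<sigma>' _ meet] by blast
  then show ?thesis
    unfolding induced_weight_def using \<sigma>' meet by auto
qed

lemma induced_weight_eq_enters:
  assumes "\<sigma> \<in> facets X" "\<sigma>' \<in> facets Y"
    and "enters x v (rel_interior \<sigma>)" "enters x v (rel_interior \<sigma>')"
  shows "induced_weight \<sigma> = \<eta> \<sigma>'"
proof -
  have "enters x v (rel_interior \<sigma> \<inter> rel_interior \<sigma>')"
    using assms by (simp add: enters_Int)
  then show ?thesis
    by (rule enters_obtains) (use induced_weight_eq[OF assms(1,2)] in auto)
qed

lemma induced_weight_nonzero:
  assumes "\<sigma> \<in> facets X" "induced_weight \<sigma> \<noteq> 0"
  shows "\<sigma> \<subseteq> \<Union>Y" "induced_weight \<sigma> > 0"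
proof -
  obtain \<sigma>' where \<sigma>': "\<sigma>' \<in> facets Y" "rel_interior \<sigma> \<inter> rel_interior \<sigma>' \<noteq> {}"
    using assms(2) by (auto simp: induced_weight_def split: if_splits)
  then show "\<sigma> \<subseteq> \<Union>Y"
    using facet_in_subcomplex[OF assms(1)] by blast
  show "induced_weight \<sigma> > 0"
    using induced_weight_eq[OF assms(1) \<sigma>'] pos[OF \<sigma>'(1)] by simp
qed

lemma induced_weight_nonneg: "\<sigma> \<in> facets X \<Longrightarrow> 0 \<le> induced_weight \<sigma>"
  using induced_weight_nonzero(2)[of \<sigma>] by (cases "induced_weight \<sigma> = 0") auto

text \<open>For the harder inclusion, a generic point of a facet of \<open>Y\<close> lies in the
  relative interior of a facet of \<open>X\<close>, whose weight is then positive; closedness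
  extends this to the whole facet.\<close>

lemma induced_weight_support: "\<Union>{\<sigma>\<in>facets X. 0 < induced_weight \<sigma>} = \<Union>Y" (is "?G = _")
proof
  show "?G \<subseteq> \<Union>Y"
    using induced_weight_nonzero(1) by (intro Union_least) auto
  have G: "closed ?G"
    using polyhedral_complex_finite[OF XT(1)] polyhedral_complex_cell(4)[OF XT(1)]
    by (intro closed_Union) (auto simp: facets_def)
  have "\<sigma>' \<subseteq> ?G" if \<sigma>': "\<sigma>' \<in> facets Y" for \<sigma>'
  proof -
    have \<sigma>'Y: "\<sigma>' \<in> Y" "aff_dim \<sigma>' = complex_dim X"
      using \<sigma>' dim by (auto simp: facets_def)
    have "rel_interior \<sigma>' \<subseteq> ?G"
    proof (rule ccontr)
      assume "\<not> rel_interior \<sigma>' \<subseteq> ?G"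
      then have ne: "rel_interior \<sigma>' \<inter> - ?G \<noteq> {}" by blast
      have op: "openin (top_of_set (affine hull \<sigma>')) (rel_interior \<sigma>' \<inter> - ?G)"
        using G by (intro openin_Int_open openin_rel_interior) (auto simp: open_Compl)
      \<comment> \<open>Avoiding the hulls of the lower-dimensional cells forces the carrier of
        \<open>x\<close> in \<open>X\<close> to be a facet.\<close>
      have "finite (X - facets X)"
        using polyhedral_complex_finite[OF XT(1)] by simp
      moreover have "\<not> \<sigma>' \<subseteq> affine hull T" if "T \<in> X - facets X" for T
      proof
        assume "\<sigma>' \<subseteq> affine hull T"
        then have "complex_dim X \<le> aff_dim T"
          using aff_dim_subset[of \<sigma>' "affine hull T"] \<sigma>'Y(2) by (simp add: aff_dim_affine_hull)
        then show False
          using that aff_dim_le_complex_dim[OF XT(1), of T] by (auto simp: facets_def)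
      qed
      ultimately obtain x where x: "x \<in> rel_interior \<sigma>' \<inter> - ?G"
        and x_gen: "\<And>T. T \<in> X - facets X \<Longrightarrow> x \<notin> affine hull T"
        using generic_point[OF _ op ne] by blast
      have "x \<in> \<Union>X"
        using x rel_interior_subset[of \<sigma>'] \<sigma>'Y(1) sub by blast
      then obtain \<sigma> where \<sigma>: "\<sigma> \<in> X" "x \<in> rel_interior \<sigma>"
        using obtains_carrier[OF XT(1)] by blast
      then have "\<sigma> \<in> facets X"
        using x_gen[of \<sigma>] rel_interior_in_hull by blast
      moreover from this have "induced_weight \<sigma> = \<eta> \<sigma>'"
        using \<sigma> x \<sigma>' by (intro induced_weight_eq) auto
      moreover have "x \<in> \<sigma>"
        using \<sigma> rel_interior_subset by blast
      ultimately have "x \<in> ?G"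
        using pos[OF \<sigma>'] by auto
      then show False using x by blast
    qed
    then have "closure (rel_interior \<sigma>') \<subseteq> ?G"
      using G by (intro closure_minimal)
    then show ?thesis
      using convex_closure_rel_interior polyhedral_complex_cell(3)[OF YT(1) \<sigma>'Y(1)] closure_subset by blast
  qed
  then show "\<Union>Y \<subseteq> ?G"
    unfolding Union_facets[OF YT(1,2), symmetric] by blast
qed

text \<open>The case in which \<open>\<tau>\<close> locally coincides with a ridge of
  \<open>Y\<close>. The facets of \<open>Y\<close> at \<open>\<rho>\<close> correspond bijectively
  to the facets of \<open>X\<close> at \<open>\<tau>\<close> with nonzero weight; weights agree and
  normals are congruent, so balancing of \<open>Y\<close> carries over.\<close>

lemma induced_weight_balanced_at_ridge:
  assumes Z: "lattice_normals X Z" and Z': "lattice_normals Y Z'"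
    and \<tau>: "\<tau> \<in> ridges X" and x: "x \<in> rel_interior \<tau>"
    and \<rho>: "\<rho> \<in> ridges Y" "x \<in> rel_interior \<rho>" and eq: "parallel_space \<rho> = parallel_space \<tau>"
  shows "(\<Sum>\<sigma>\<in>star_facets X \<tau>. induced_weight \<sigma> *\<^sub>R Z \<tau> \<sigma>) \<in> parallel_space \<tau>"
proof -
  define S where "S = {\<sigma>\<in>star_facets X \<tau>. induced_weight \<sigma> \<noteq> 0}"
  have sub\<tau>: "subspace (parallel_space \<tau>)"
    using x rel_interior_subset by (intro subspace_parallel_space) auto
  have lat: "lattice_normal \<tau> \<sigma> (Z \<tau> \<sigma>)" if "\<sigma> \<in> star_facets X \<tau>" for \<sigma>
    using Z \<tau> that by (auto simp: lattice_normals_def)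
  then have n: "inward_normal \<tau> \<sigma> (Z \<tau> \<sigma>)" if "\<sigma> \<in> star_facets X \<tau>" for \<sigma>
    using lattice_normal_inward[OF XT(1,3) \<tau>] that by blast
  have lat': "lattice_normal \<rho> \<sigma> (Z' \<rho> \<sigma>)" if "\<sigma> \<in> star_facets Y \<rho>" for \<sigma>
    using Z' \<rho>(1) that by (auto simp: lattice_normals_def)
  then have n': "inward_normal \<rho> \<sigma> (Z' \<rho> \<sigma>)" if "\<sigma> \<in> star_facets Y \<rho>" for \<sigma>
    using lattice_normal_inward[OF YT(1,3) \<rho>(1)] that by blast
  have facet: "\<sigma> \<in> facets X" "convex \<sigma>" if "\<sigma> \<in> star_facets X \<tau>" for \<sigma>
    using that polyhedral_complex_cell(3)[OF XT(1)] by (auto simp: star_facets_def facets_def)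
  have facet': "\<sigma> \<in> facets Y" "convex \<sigma>" "\<sigma> \<subseteq> \<Union>X" if "\<sigma> \<in> star_facets Y \<rho>" for \<sigma>
    using that polyhedral_complex_cell(3)[OF YT(1)] sub by (auto simp: star_facets_def facets_def)
  have ent: "enters x (Z \<tau> \<sigma>) (rel_interior \<sigma>)" if "\<sigma> \<in> star_facets X \<tau>" for \<sigma>
    using star_facet_enters[OF XT(1,3) Z \<tau> that x subspace_0[OF sub\<tau>] zero_less_one] by simp
  have ent': "enters x (Z' \<rho> \<sigma>) (rel_interior \<sigma>)" if "\<sigma> \<in> star_facets Y \<rho>" for \<sigma>
    using star_facet_enters[OF YT(1,3) Z' \<rho>(1) that \<rho>(2) subspace_0[OF sub\<tau>, folded eq] zero_less_one]
    by simp
  \<comment> \<open>A shared transversal ray transports the weight and, by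
    \<open>lattice_normals_agree\<close>, the normal.\<close>
  have agree: "induced_weight \<sigma> = \<eta> \<sigma>' \<and> Z \<tau> \<sigma> - Z' \<rho> \<sigma>' \<in> parallel_space \<tau>"
    if \<sigma>: "\<sigma> \<in> star_facets X \<tau>" "\<sigma>' \<in> star_facets Y \<rho>"
      and e: "enters x v (rel_interior \<sigma>)" "enters x v (rel_interior \<sigma>')" and v: "v \<notin> parallel_space \<tau>"
    for \<sigma> \<sigma>' v
  proof
    show "induced_weight \<sigma> = \<eta> \<sigma>'"
      using induced_weight_eq_enters facet(1)[OF \<sigma>(1)] facet'(1)[OF \<sigma>(2)] e by blast
    show "Z \<tau> \<sigma> - Z' \<rho> \<sigma>' \<in> parallel_space \<tau>"
      using lattice_normals_agree[OF n[OF \<sigma>(1)] n'[OF \<sigma>(2)] lat[OF \<sigma>(1)] lat'[OF \<sigma>(2)]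
          facet(2)[OF \<sigma>(1)] facet'(2)[OF \<sigma>(2)] x \<rho>(2) eq _ _ v]
        enters_mono[OF e(1) rel_interior_subset] enters_mono[OF e(2) rel_interior_subset] by blast
  qed
  \<comment> \<open>The normal of a facet of \<open>Y\<close> points into \<open>\<Union>X\<close>,
    hence into a facet of \<open>X\<close> at \<open>\<tau>\<close>, whose weight is
    positive.\<close>
  have "\<forall>\<sigma>'\<in>star_facets Y \<rho>. \<exists>\<sigma>. \<sigma> \<in> S \<and> induced_weight \<sigma> = \<eta> \<sigma>' \<and> Z \<tau> \<sigma> - Z' \<rho> \<sigma>' \<in> parallel_space \<tau>"
  proof
    fix \<sigma>' assume \<sigma>': "\<sigma>' \<in> star_facets Y \<rho>"
    have v: "Z' \<rho> \<sigma>' \<notin> parallel_space \<tau>"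
      using n'[OF \<sigma>'] eq by (simp add: inward_normal_def)
    have "enters x (Z' \<rho> \<sigma>') (\<Union>X)"
      using ent'[OF \<sigma>'] facet'(3)[OF \<sigma>'] rel_interior_subset by (elim enters_mono) blast
    then obtain \<sigma> where "\<sigma> \<in> star_facets X \<tau>" "enters x (Z' \<rho> \<sigma>') (rel_interior \<sigma>)"
      using ridge_enters[OF X \<tau> x _ v] by blast
    then show "\<exists>\<sigma>. \<sigma> \<in> S \<and> induced_weight \<sigma> = \<eta> \<sigma>' \<and> Z \<tau> \<sigma> - Z' \<rho> \<sigma>' \<in> parallel_space \<tau>"
      using agree[OF _ \<sigma>' _ ent'[OF \<sigma>'] v] pos[OF facet'(1)[OF \<sigma>']]
      by (intro exI[of _ \<sigma>]) (auto simp: S_def)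
  qed
  from bchoice[OF this] obtain f where f: "\<And>\<sigma>'. \<sigma>' \<in> star_facets Y \<rho> \<Longrightarrow> f \<sigma>' \<in> S"
    "\<And>\<sigma>'. \<sigma>' \<in> star_facets Y \<rho> \<Longrightarrow> induced_weight (f \<sigma>') = \<eta> \<sigma>'"
    "\<And>\<sigma>'. \<sigma>' \<in> star_facets Y \<rho> \<Longrightarrow> Z \<tau> (f \<sigma>') - Z' \<rho> \<sigma>' \<in> parallel_space \<tau>"
    by blast
  have "bij_betw f (star_facets Y \<rho>) S"
  proof (rule bij_betw_imageI)
    show "inj_on f (star_facets Y \<rho>)"
    proof (rule inj_onI)
      fix \<sigma>1 \<sigma>2 assume s: "\<sigma>1 \<in> star_facets Y \<rho>" "\<sigma>2 \<in> star_facets Y \<rho>" and "f \<sigma>1 = f \<sigma>2"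
      then have "Z' \<rho> \<sigma>1 - Z' \<rho> \<sigma>2 \<in> parallel_space \<rho>"
        using subspace_diff[OF sub\<tau> f(3)[OF s(2)] f(3)[OF s(1)]] eq by simp
      then show "\<sigma>1 = \<sigma>2"
        by (rule star_facet_eqI[OF YT(1,3) Z' \<rho>(1) s])
    qed
    show "f ` star_facets Y \<rho> = S"
    proof
      show "f ` star_facets Y \<rho> \<subseteq> S" using f(1) by blast
      show "S \<subseteq> f ` star_facets Y \<rho>"
      proof
        fix \<sigma> assume \<sigma>S: "\<sigma> \<in> S"
        then have \<sigma>: "\<sigma> \<in> star_facets X \<tau>" "induced_weight \<sigma> \<noteq> 0"
          by (auto simp: S_def)
        have v: "Z \<tau> \<sigma> \<notin> parallel_space \<tau>" "Z \<tau> \<sigma> \<notin> parallel_space \<rho>"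
          using n[OF \<sigma>(1)] eq by (auto simp: inward_normal_def)
        \<comment> \<open>Conversely, a facet of \<open>X\<close> with nonzero weight lies in
          \<open>\<Union>Y\<close>, so its normal points into a facet of \<open>Y\<close> at
          \<open>\<rho>\<close>.\<close>
        have "enters x (Z \<tau> \<sigma>) (\<Union>Y)"
          using enters_mono[OF ent[OF \<sigma>(1)], of "\<Union>Y"] rel_interior_subset[of \<sigma>]
            induced_weight_nonzero(1)[OF facet(1)[OF \<sigma>(1)] \<sigma>(2)] by blast
        then obtain \<sigma>' where \<sigma>': "\<sigma>' \<in> star_facets Y \<rho>" "enters x (Z \<tau> \<sigma>) (rel_interior \<sigma>')"
          using ridge_enters[OF Y \<rho> _ v(2)] by blast
        then have "Z \<tau> \<sigma> - Z' \<rho> \<sigma>' \<in> parallel_space \<tau>"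
          using agree[OF \<sigma>(1) \<sigma>'(1) ent[OF \<sigma>(1)] _ v(1)] by blast
        then have "Z \<tau> \<sigma> - Z \<tau> (f \<sigma>') \<in> parallel_space \<tau>"
          using subspace_diff[OF sub\<tau> _ f(3)[OF \<sigma>'(1)]] by fastforce
        then have "\<sigma> = f \<sigma>'"
          using star_facet_eqI[OF XT(1,3) Z \<tau> \<sigma>(1)] f(1)[OF \<sigma>'(1)] by (auto simp: S_def)
        then show "\<sigma> \<in> f ` star_facets Y \<rho>"
          using \<sigma>'(1) by blast
      qed
    qed
  qed
  then have "(\<Sum>\<sigma>\<in>S. induced_weight \<sigma> *\<^sub>R Z \<tau> \<sigma>) =
      (\<Sum>\<sigma>'\<in>star_facets Y \<rho>. induced_weight (f \<sigma>') *\<^sub>R Z \<tau> (f \<sigma>'))"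
    by (rule sum.reindex_bij_betw[symmetric])
  also have "\<dots> = (\<Sum>\<sigma>'\<in>star_facets Y \<rho>. \<eta> \<sigma>' *\<^sub>R Z \<tau> (f \<sigma>'))"
    using f(2) by (intro sum.cong) auto
  also have "\<dots> \<in> parallel_space \<tau>"
  proof -
    have "(\<Sum>\<sigma>'\<in>star_facets Y \<rho>. \<eta> \<sigma>' *\<^sub>R Z' \<rho> \<sigma>') \<in> parallel_space \<tau>"
      using bal \<rho>(1) eq unfolding balanced_iff[OF YT(1,3) Z'] by auto
    then show ?thesis
      using weighted_sum_mem_cong[OF sub\<tau> f(3), of "star_facets Y \<rho>" "\<lambda>\<sigma>. \<sigma>" \<eta>] by simp
  qed
  finally have "(\<Sum>\<sigma>\<in>S. induced_weight \<sigma> *\<^sub>R Z \<tau> \<sigma>) \<in> parallel_space \<tau>" .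
  moreover have "(\<Sum>\<sigma>\<in>star_facets X \<tau>. induced_weight \<sigma> *\<^sub>R Z \<tau> \<sigma>) = (\<Sum>\<sigma>\<in>S. induced_weight \<sigma> *\<^sub>R Z \<tau> \<sigma>)"
    using finite_star_facets[OF XT(1)] by (intro sum.mono_neutral_right) (auto simp: S_def)
  ultimately show ?thesis by simp
qed

text \<open>The case in which \<open>\<tau>\<close> cuts through the relative interior of a facet
  \<open>\<rho>\<close> of \<open>Y\<close>. Exactly two facets of \<open>X\<close> at
  \<open>\<tau>\<close> have nonzero weight, one on each side; both have weight
  \<open>\<eta> \<rho>\<close>, and their normals cancel modulo
  \<open>parallel_space \<tau>\<close>.\<close>

lemma induced_weight_balanced_in_facet:
  assumes Z: "lattice_normals X Z"
    and \<tau>: "\<tau> \<in> ridges X" and x: "x \<in> rel_interior \<tau>"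
    and \<rho>: "\<rho> \<in> facets Y" "x \<in> rel_interior \<rho>" and le: "parallel_space \<tau> \<subseteq> parallel_space \<rho>"
  shows "(\<Sum>\<sigma>\<in>star_facets X \<tau>. induced_weight \<sigma> *\<^sub>R Z \<tau> \<sigma>) \<in> parallel_space \<tau>"
proof -
  define S where "S = {\<sigma>\<in>star_facets X \<tau>. induced_weight \<sigma> \<noteq> 0}"
  have ne: "\<tau> \<noteq> {}" "\<rho> \<noteq> {}"
    using x \<rho>(2) rel_interior_subset by blast+
  note sub\<tau> = ne(1)[THEN subspace_parallel_space] and sub\<rho> = ne(2)[THEN subspace_parallel_space]
  have lat: "lattice_normal \<tau> \<sigma> (Z \<tau> \<sigma>)" if "\<sigma> \<in> star_facets X \<tau>" for \<sigma>
    using Z \<tau> that by (auto simp: lattice_normals_def)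
  then have n: "inward_normal \<tau> \<sigma> (Z \<tau> \<sigma>)" if "\<sigma> \<in> star_facets X \<tau>" for \<sigma>
    using lattice_normal_inward[OF XT(1,3) \<tau>] that by blast
  have facet: "\<sigma> \<in> facets X" "convex \<sigma>" "\<sigma> \<noteq> {}" "x \<in> affine hull \<sigma>" if "\<sigma> \<in> star_facets X \<tau>" for \<sigma>
  proof -
    have "x \<in> \<sigma>"
      using x that rel_interior_face_mem by (auto simp: star_facets_def)
    then show "\<sigma> \<in> facets X" "convex \<sigma>" "\<sigma> \<noteq> {}" "x \<in> affine hull \<sigma>"
      using that polyhedral_complex_cell(3)[OF XT(1)] by (auto simp: star_facets_def facets_def hull_inc)
  qed
  have ent: "enters x (Z \<tau> \<sigma>) (rel_interior \<sigma>)" if "\<sigma> \<in> star_facets X \<tau>" for \<sigma>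
    using star_facet_enters[OF XT(1,3) Z \<tau> that x subspace_0[OF sub\<tau>] zero_less_one] by simp
  \<comment> \<open>Near \<open>x\<close> the rays in \<open>\<Union>Y\<close> are those in
    \<open>\<rho>\<close>, so a facet of \<open>X\<close> contained in \<open>\<Union>Y\<close>
    takes over the weight and the parallel space of \<open>\<rho>\<close>.\<close>
  have S: "induced_weight \<sigma> = \<eta> \<rho>" "parallel_space \<sigma> = parallel_space \<rho>" if "\<sigma> \<in> S" for \<sigma>
  proof -
    have \<sigma>: "\<sigma> \<in> star_facets X \<tau>" "induced_weight \<sigma> \<noteq> 0"
      using that by (auto simp: S_def)
    have "enters x (Z \<tau> \<sigma>) (\<Union>Y)"
      using enters_mono[OF ent[OF \<sigma>(1)], of "\<Union>Y"] rel_interior_subset[of \<sigma>]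
        induced_weight_nonzero(1)[OF facet(1)[OF \<sigma>(1)] \<sigma>(2)] by blast
    note e = facet_enters[OF YT(1,2) \<rho> this]
    show "induced_weight \<sigma> = \<eta> \<rho>"
      using induced_weight_eq_enters facet(1)[OF \<sigma>(1)] \<rho>(1) ent[OF \<sigma>(1)] e(2) by blast
    have "parallel_space \<sigma> \<subseteq> parallel_space \<rho>"
    proof -
      have "l + c *\<^sub>R Z \<tau> \<sigma> \<in> parallel_space \<rho>" if "l \<in> parallel_space \<tau>" for l c
        using sub\<rho> le e(1) that by (intro subspace_add subspace_scale) auto
      then show ?thesis
        using n[OF \<sigma>(1)] by (auto simp: inward_normal_def)
    qed
    then show "parallel_space \<sigma> = parallel_space \<rho>"
      using facet(1,3)[OF \<sigma>(1)] \<rho>(1) ne(2) dim by (intro parallel_space_eqI) (auto simp: facets_def)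
  qed
  have "\<not> parallel_space \<rho> \<subseteq> parallel_space \<tau>"
  proof
    assume "parallel_space \<rho> \<subseteq> parallel_space \<tau>"
    then have "parallel_space \<rho> = parallel_space \<tau>"
      using le by blast
    then have "aff_dim \<rho> = aff_dim \<tau>"
      using ne dim_parallel_space by metis
    then show False
      using \<rho>(1) \<tau> dim by (simp add: facets_def ridges_def)
  qed
  then obtain v where v: "v \<in> parallel_space \<rho>" "v \<notin> parallel_space \<tau>"
    by blast
  \<comment> \<open>Every direction of \<open>\<rho>\<close> transversal to \<open>\<tau>\<close>
    leads into a facet of \<open>X\<close> with nonzero weight; \<open>v\<close> and
    \<open>- v\<close> provide the two sides.\<close>
  have reach: "\<exists>\<sigma>\<in>S. enters x w (rel_interior \<sigma>)" if w: "w \<in> parallel_space \<rho>" "w \<notin> parallel_space \<tau>" for w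
  proof -
    have e: "enters x w (rel_interior \<rho>)"
      using \<rho>(2) w(1) by (rule enters_rel_interior)
    then have "enters x w (\<Union>X)"
      using \<rho>(1) sub rel_interior_subset[of \<rho>] by (elim enters_mono) (auto simp: facets_def)
    then obtain \<sigma> where \<sigma>: "\<sigma> \<in> star_facets X \<tau>" "enters x w (rel_interior \<sigma>)"
      using ridge_enters[OF X \<tau> x _ w(2)] by blast
    then have "induced_weight \<sigma> = \<eta> \<rho>"
      using induced_weight_eq_enters[OF facet(1)[OF \<sigma>(1)] \<rho>(1) \<sigma>(2) e] by simp
    then show ?thesis
      using \<sigma> pos[OF \<rho>(1)] by (auto simp: S_def)
  qed
  obtain \<sigma>p where \<sigma>p: "\<sigma>p \<in> S" "enters x v (rel_interior \<sigma>p)"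
    using reach[OF v] by blast
  have mv: "- v \<in> parallel_space \<rho>" "- v \<notin> parallel_space \<tau>"
    using v subspace_neg[OF sub\<rho>] subspace_neg[OF sub\<tau>, of "- v"] by auto
  obtain \<sigma>m where \<sigma>m: "\<sigma>m \<in> S" "enters x (- v) (rel_interior \<sigma>m)"
    using reach[OF mv] by blast
  have star: "\<sigma> \<in> star_facets X \<tau>" if "\<sigma> \<in> S" for \<sigma>
    using that by (simp add: S_def)
  \<comment> \<open>In a single facet, \<open>v\<close> and \<open>- v\<close> would both have a
    positive coefficient along its normal.\<close>
  have "\<sigma>p \<noteq> \<sigma>m"
  proof
    assume same: "\<sigma>p = \<sigma>m"
    note s = star[OF \<sigma>p(1)]
    have xaff: "x \<in> affine hull \<tau>"
      using x by (rule rel_interior_in_hull)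
    obtain l c where lc: "v = l + c *\<^sub>R Z \<tau> \<sigma>p" "l \<in> parallel_space \<tau>"
      using n[OF s] v(1) S(2)[OF \<sigma>p(1)] by (elim inward_normal_decompose) auto
    have "0 < c"
      using inward_normal_pos[OF n[OF s] facet(2)[OF s] xaff lc(2)] v(2) lc(1)
        enters_mono[OF \<sigma>p(2) rel_interior_subset] by simp
    moreover have "0 < - c"
      using inward_normal_pos[OF n[OF s] facet(2)[OF s] xaff subspace_neg[OF sub\<tau> lc(2)], of "- c"]
        mv(2) lc(1) enters_mono[OF \<sigma>m(2) rel_interior_subset] same by simp
    ultimately show False by simp
  qed
  have opp: "Z \<tau> \<sigma>p + Z \<tau> \<sigma> \<in> parallel_space \<tau>" if "\<sigma> \<in> S" "\<sigma> \<noteq> \<sigma>p" for \<sigma>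
  proof -
    have "\<not> Z \<tau> \<sigma>p - Z \<tau> \<sigma> \<in> parallel_space \<tau>"
      using star_facet_eqI[OF XT(1,3) Z \<tau> star[OF \<sigma>p(1)] star[OF that(1)]] that(2) by auto
    then show ?thesis
      using lattice_normal_unique_upto_sign[OF lat[OF star[OF \<sigma>p(1)]] lat[OF star[OF that(1)]] refl _ ne(1)]
        S(2)[OF \<sigma>p(1)] S(2)[OF that(1)] n[OF star[OF \<sigma>p(1)]] by (auto simp: inward_normal_def)
  qed
  have "\<sigma> = \<sigma>m" if "\<sigma> \<in> S" "\<sigma> \<noteq> \<sigma>p" for \<sigma>
  proof (rule star_facet_eqI[OF XT(1,3) Z \<tau> star[OF that(1)] star[OF \<sigma>m(1)]])
    have "(Z \<tau> \<sigma>p + Z \<tau> \<sigma>) - (Z \<tau> \<sigma>p + Z \<tau> \<sigma>m) \<in> parallel_space \<tau>"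
      using opp[OF that] opp[OF \<sigma>m(1)] \<open>\<sigma>p \<noteq> \<sigma>m\<close> by (intro subspace_diff[OF sub\<tau>]) auto
    then show "Z \<tau> \<sigma> - Z \<tau> \<sigma>m \<in> parallel_space \<tau>" by simp
  qed
  then have "S = {\<sigma>p, \<sigma>m}"
    using \<sigma>p(1) \<sigma>m(1) by blast
  then have "(\<Sum>\<sigma>\<in>S. induced_weight \<sigma> *\<^sub>R Z \<tau> \<sigma>) = \<eta> \<rho> *\<^sub>R (Z \<tau> \<sigma>p + Z \<tau> \<sigma>m)"
    using \<open>\<sigma>p \<noteq> \<sigma>m\<close> S(1)[OF \<sigma>p(1)] S(1)[OF \<sigma>m(1)] by (simp add: scaleR_add_right)
  also have "\<dots> \<in> parallel_space \<tau>"
    using opp[OF \<sigma>m(1)] \<open>\<sigma>p \<noteq> \<sigma>m\<close> by (intro subspace_scale[OF sub\<tau>]) auto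
  finally have "(\<Sum>\<sigma>\<in>S. induced_weight \<sigma> *\<^sub>R Z \<tau> \<sigma>) \<in> parallel_space \<tau>" .
  moreover have "(\<Sum>\<sigma>\<in>star_facets X \<tau>. induced_weight \<sigma> *\<^sub>R Z \<tau> \<sigma>) = (\<Sum>\<sigma>\<in>S. induced_weight \<sigma> *\<^sub>R Z \<tau> \<sigma>)"
    using finite_star_facets[OF XT(1)] by (intro sum.mono_neutral_right) (auto simp: S_def)
  ultimately show ?thesis by simp
qed

text \<open>The condition at \<open>\<tau>\<close> does not mention a point of
  \<open>\<tau>\<close>, so it may be tested at one well-chosen point.\<close>

lemma induced_weight_balanced: "balanced X induced_weight"
proof -
  obtain Z Z' where Z: "lattice_normals X Z" and Z': "lattice_normals Y Z'"
    using lattice_normals_exist[OF X] lattice_normals_exist[OF Y] by metis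
  have "(\<Sum>\<sigma>\<in>star_facets X \<tau>. induced_weight \<sigma> *\<^sub>R Z \<tau> \<sigma>) \<in> parallel_space \<tau>" if \<tau>: "\<tau> \<in> ridges X" for \<tau>
  proof -
    have \<tau>X: "\<tau> \<in> X" "aff_dim \<tau> = complex_dim X - 1"
      using \<tau> by (auto simp: ridges_def)
    note cell = polyhedral_complex_cell[OF XT(1) \<tau>X(1)]
    have "rel_interior \<tau> \<noteq> {}"
      using cell rel_interior_eq_empty by blast
    \<comment> \<open>Avoiding these hulls forces \<open>\<tau>\<close> into the hull of the carrier
      of \<open>x\<close> in \<open>Y\<close>, which is therefore a ridge or a facet.\<close>
    moreover have "finite {\<rho>\<in>Y. \<not> \<tau> \<subseteq> affine hull \<rho>}"
      using polyhedral_complex_finite[OF YT(1)] by simp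
    ultimately obtain x where x: "x \<in> rel_interior \<tau>"
      and x_gen: "\<And>\<rho>. \<rho> \<in> {\<rho>\<in>Y. \<not> \<tau> \<subseteq> affine hull \<rho>} \<Longrightarrow> x \<notin> affine hull \<rho>"
      using generic_point[OF _ openin_rel_interior] by (metis (mono_tags, lifting) mem_Collect_eq)
    show ?thesis
    proof (cases "x \<in> \<Union>Y")
      \<comment> \<open>Every facet at \<open>\<tau>\<close> contains \<open>x\<close>, so none lies
        in \<open>\<Union>Y\<close> and all weights vanish.\<close>
      case False
      have "induced_weight \<sigma> = 0" if "\<sigma> \<in> star_facets X \<tau>" for \<sigma>
      proof (rule ccontr)
        assume "induced_weight \<sigma> \<noteq> 0"
        then have "\<sigma> \<subseteq> \<Union>Y"
          using that induced_weight_nonzero(1) by (auto simp: star_facets_def)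
        moreover have "x \<in> \<sigma>"
          using x that rel_interior_face_mem by (auto simp: star_facets_def)
        ultimately show False
          using False by blast
      qed
      then show ?thesis
        using subspace_0[OF subspace_parallel_space[OF cell(2)]] by simp
    next
      case True
      then obtain \<rho> where \<rho>: "\<rho> \<in> Y" "x \<in> rel_interior \<rho>"
        using obtains_carrier[OF YT(1)] by blast
      then have sub_aff: "\<tau> \<subseteq> affine hull \<rho>"
        using x_gen rel_interior_in_hull by blast
      then have le: "parallel_space \<tau> \<subseteq> parallel_space \<rho>"
        by (rule parallel_space_mono)
      have "complex_dim X - 1 \<le> aff_dim \<rho>"
        using aff_dim_subset[OF sub_aff] \<tau>X(2) by (simp add: aff_dim_affine_hull)
      moreover have "aff_dim \<rho> \<le> complex_dim X"
        using aff_dim_le_complex_dim[OF YT(1) \<rho>(1)] dim by simp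
      ultimately consider "aff_dim \<rho> = complex_dim X" | "aff_dim \<rho> = complex_dim X - 1"
        by linarith
      then show ?thesis
      proof cases
        case 1
        then show ?thesis
          using induced_weight_balanced_in_facet[OF Z \<tau> x _ \<rho>(2) le] \<rho>(1) dim by (simp add: facets_def)
      next
        case 2
        then have "parallel_space \<rho> = parallel_space \<tau>"
          using le \<tau>X(2) cell(2) polyhedral_complex_cell(2)[OF YT(1) \<rho>(1)]
          by (intro parallel_space_eqI[symmetric]) auto
        then show ?thesis
          using induced_weight_balanced_at_ridge[OF Z Z' \<tau> x _ \<rho>(2)] 2 \<rho>(1) dim by (simp add: ridges_def)
      qed
    qed
  qed
  then show ?thesis
    unfolding balanced_iff[OF XT(1,3) Z] using induced_weight_nonneg by blast
qed

end

lemma tropical_subvariety_support: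
  assumes X: "tropical_complex X" "complex_dim X = int k"
    and D: "tropical_variety k D" "D \<subseteq> \<Union>X"
  obtains \<omega> where "balanced X \<omega>" "D = \<Union>{\<sigma>\<in>facets X. 0 < \<omega> \<sigma>}"
proof -
  obtain Y where Y: "tropical_complex Y" "complex_dim Y = int k" and DY: "D = \<Union>Y"
    using D(1) by (auto simp: tropical_variety_def)
  then obtain \<eta> where "balanced Y \<eta>" "weighting Y \<eta>"
    by (auto simp: tropical_complex_def)
  then interpret tropical_subcomplex X Y \<eta>
    using X Y DY D(2) by unfold_locales (auto simp: weighting_def)
  show ?thesis
    using that induced_weight_balanced induced_weight_support DY by metis
qed

section \<open>Vertices of a section of the standard simplex\<close>

definition simplex_section :: "(real^'e) set \<Rightarrow> (real^'e) set" where
  "simplex_section L = {x\<in>L. (\<forall>e. 0 \<le> x $ e) \<and> (\<Sum>e\<in>UNIV. x $ e) = 1}"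

text \<open>The coordinates of \<open>u\<close> sum to 0, so some of them decrease; the move stops
  when the first of these reaches 0. By \<open>supp\<close> that coordinate was positive, so the
  step has positive length.\<close>

lemma simplex_section_move:
  fixes L :: "(real^'e::finite) set"
  assumes L: "subspace L" and x: "x \<in> simplex_section L"
    and u: "u \<in> L" "(\<Sum>e\<in>UNIV. u $ e) = 0" "u \<noteq> 0" and supp: "\<And>e. u $ e \<noteq> 0 \<Longrightarrow> 0 < x $ e"
  obtains s e where "s > 0" "x + s *\<^sub>R u \<in> simplex_section L" "0 < x $ e" "(x + s *\<^sub>R u) $ e = 0"
proof -
  define N where "N = {e. u $ e < 0}"
  have "N \<noteq> {}"
  proof
    assume "N = {}"
    then have "\<forall>e. 0 \<le> u $ e"
      by (auto simp: N_def not_less)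
    then have "\<forall>e. u $ e = 0"
      using u(2) by (simp add: sum_nonneg_eq_0_iff)
    then show False using u(3) by (simp add: vec_eq_iff)
  qed
  \<comment> \<open>The ratio test: the earliest time at which a decreasing coordinate
    vanishes.\<close>
  define s where "s = Min ((\<lambda>e. x $ e / - u $ e) ` N)"
  have "s \<in> (\<lambda>e. x $ e / - u $ e) ` N"
    unfolding s_def using \<open>N \<noteq> {}\<close> by (intro Min_in) auto
  then obtain e where e: "e \<in> N" "s = x $ e / - u $ e"
    by blast
  have le: "s \<le> x $ e' / - u $ e'" if "e' \<in> N" for e'
    unfolding s_def using that by (intro Min_le) auto
  have xe: "0 < x $ e"
    using supp[of e] e(1) by (auto simp: N_def)
  then have s: "s > 0"
    unfolding e(2) using e(1) by (intro divide_pos_pos) (auto simp: N_def)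
  have "0 \<le> (x + s *\<^sub>R u) $ e'" for e'
  proof (cases "e' \<in> N")
    case True
    then have "s * (- u $ e') \<le> x $ e'"
      using le[OF True] True by (subst (asm) pos_le_divide_eq) (auto simp: N_def)
    then show ?thesis by simp
  next
    case False
    then show ?thesis
      using s x by (simp add: N_def simplex_section_def)
  qed
  moreover have "x + s *\<^sub>R u \<in> L"
    using L x u(1) by (auto simp: simplex_section_def intro: subspace_add subspace_scale)
  moreover have "(\<Sum>e\<in>UNIV. (x + s *\<^sub>R u) $ e) = 1"
    using x u(2) by (simp add: simplex_section_def sum.distrib flip: sum_distrib_left)
  ultimately have "x + s *\<^sub>R u \<in> simplex_section L"
    by (simp add: simplex_section_def)
  moreover have "(x + s *\<^sub>R u) $ e = 0"
    using e by (simp add: N_def field_simps)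
  ultimately show ?thesis
    using that s xe by blast
qed

lemma simplex_section_diff:
  assumes "subspace L" "x \<in> simplex_section L" "y \<in> simplex_section L"
  shows "x - y \<in> L" "(\<Sum>e\<in>UNIV. (x - y) $ e) = 0"
  using assms by (auto simp: simplex_section_def sum_subtractf intro: subspace_diff)

lemma in_open_segment_opposite:
  fixes x u :: "'a::real_vector"
  assumes "s > 0" "t > 0" "u \<noteq> 0"
  shows "x \<in> open_segment (x + s *\<^sub>R u) (x - t *\<^sub>R u)"
proof -
  have "x + s *\<^sub>R u \<noteq> x - t *\<^sub>R u"
  proof
    assume "x + s *\<^sub>R u = x - t *\<^sub>R u"
    then have "(s + t) *\<^sub>R u = 0"
      by (simp add: scaleR_add_left add_eq_0_iff)
    then show False using assms by simp
  qed
  moreover have "x = (1 - s / (s + t)) *\<^sub>R (x + s *\<^sub>R u) + (s / (s + t)) *\<^sub>R (x - t *\<^sub>R u)"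
  proof -
    have "(1 - s / (s + t)) * s - (s / (s + t)) * t = 0"
      using assms by (simp add: field_simps)
    moreover have "(1 - a) *\<^sub>R (x + s *\<^sub>R u) + a *\<^sub>R (x - t *\<^sub>R u) = x + ((1 - a) * s - a * t) *\<^sub>R u" for a
      by (simp add: algebra_simps)
    ultimately show ?thesis by simp
  qed
  moreover have "0 < s / (s + t)" "s / (s + t) < 1"
    using assms by auto
  ultimately show ?thesis
    unfolding in_segment by blast
qed

text \<open>Otherwise \<open>v\<close> could be moved a little further away from \<open>x\<close>
  within the section, which puts \<open>v\<close> inside a segment.\<close>

lemma extreme_point_minimal_support:
  fixes L :: "(real^'e::finite) set"
  assumes L: "subspace L" and v: "v extreme_point_of simplex_section L"
    and x: "x \<in> simplex_section L" and supp: "\<And>e. 0 < x $ e \<Longrightarrow> 0 < v $ e"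
  shows "x = v"
proof (rule ccontr)
  assume "x \<noteq> v"
  have vP: "v \<in> simplex_section L"
    using v by (simp add: extreme_point_of_def)
  \<comment> \<open>Where \<open>v\<close> vanishes, \<open>x\<close> vanishes too, so the direction
    \<open>v - x\<close> is supported on the support of \<open>v\<close>.\<close>
  have "0 < v $ e" if "(v - x) $ e \<noteq> 0" for e
  proof (cases "v $ e = 0")
    case True
    then show ?thesis
      using that supp[of e] x by (force simp: simplex_section_def less_le)
  next
    case False
    then show ?thesis
      using vP by (simp add: simplex_section_def less_le)
  qed
  then obtain s e where s: "s > 0" "v + s *\<^sub>R (v - x) \<in> simplex_section L"
    using simplex_section_move[OF L vP simplex_section_diff[OF L vP x]] \<open>x \<noteq> v\<close> by auto
  have "v \<in> open_segment (v + s *\<^sub>R (v - x)) (v - 1 *\<^sub>R (v - x))"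
    using s(1) \<open>x \<noteq> v\<close> by (intro in_open_segment_opposite) auto
  then show False
    using v s(2) x by (simp add: extreme_point_of_def)
qed

text \<open>A point inside a segment is moved along it in both directions until a coordinate
  vanishes. Each endpoint loses a coordinate of the support, and none is lost in both.\<close>

lemma non_extreme_point_splits:
  fixes L :: "(real^'e::finite) set"
  assumes L: "subspace L" and x: "x \<in> simplex_section L"
    and nx: "\<not> x extreme_point_of simplex_section L"
  obtains y z where "y \<in> simplex_section L" "z \<in> simplex_section L"
    "{e. 0 < y $ e} \<subset> {e. 0 < x $ e}" "{e. 0 < z $ e} \<subset> {e. 0 < x $ e}"
    "{e. 0 < x $ e} = {e. 0 < y $ e} \<union> {e. 0 < z $ e}"
proof -
  obtain a b where ab: "a \<in> simplex_section L" "b \<in> simplex_section L" "x \<in> open_segment a b"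
    using nx x by (auto simp: extreme_point_of_def)
  define u where "u = a - b"
  have uL: "u \<in> L" "(\<Sum>e\<in>UNIV. u $ e) = 0"
    unfolding u_def using simplex_section_diff[OF L ab(1,2)] by blast+
  have u0: "u \<noteq> 0"
    using ab(3) by (auto simp: u_def)
  have nonneg: "0 \<le> x $ e" "0 \<le> a $ e" "0 \<le> b $ e" for e
    using x ab by (auto simp: simplex_section_def)
  obtain r where r: "0 < r" "r < 1" "x = (1 - r) *\<^sub>R a + r *\<^sub>R b"
    using ab(3) by (auto simp: in_segment)
  \<comment> \<open>\<open>x\<close> mixes \<open>a\<close> and \<open>b\<close> with positive
    coefficients, so its support contains both of theirs.\<close>
  have supp: "0 < x $ e" if "u $ e \<noteq> 0" for e
  proof -
    have "a $ e > 0 \<or> b $ e > 0"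
      using that nonneg[of e] by (auto simp: u_def less_le)
    then have "0 < (1 - r) * a $ e + r * b $ e"
      using nonneg[of e] r by (auto intro: add_pos_nonneg add_nonneg_pos)
    then show ?thesis by (simp add: r(3))
  qed
  obtain s e where s: "s > 0" "x + s *\<^sub>R u \<in> simplex_section L" "0 < x $ e" "(x + s *\<^sub>R u) $ e = 0"
    using simplex_section_move[OF L x uL u0 supp] by blast
  have "- u \<in> L" "(\<Sum>e\<in>UNIV. (- u) $ e) = 0" "- u \<noteq> 0"
    using uL u0 L by (auto simp: sum_negf subspace_neg)
  then obtain t f where t: "t > 0" "x + t *\<^sub>R (- u) \<in> simplex_section L" "0 < x $ f" "(x + t *\<^sub>R (- u)) $ f = 0"
    using simplex_section_move[OF L x, of "- u"] supp by auto
  let ?y = "x + s *\<^sub>R u" and ?z = "x + t *\<^sub>R (- u)"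
  have sub: "0 < x $ e" if "0 < (x + c *\<^sub>R u) $ e" for c e
    using that supp[of e] nonneg(1)[of e] by (cases "u $ e = 0") auto
  have "{e. 0 < ?y $ e} \<subset> {e. 0 < x $ e}"
  proof
    show "{e. 0 < ?y $ e} \<subseteq> {e. 0 < x $ e}"
      using sub by blast
    show "{e. 0 < ?y $ e} \<noteq> {e. 0 < x $ e}"
      using s(3,4) by (metis (mono_tags, lifting) less_irrefl mem_Collect_eq)
  qed
  moreover have "{e. 0 < ?z $ e} \<subset> {e. 0 < x $ e}"
  proof
    show "{e. 0 < ?z $ e} \<subseteq> {e. 0 < x $ e}"
      using sub[where c = "- t"] by auto
    show "{e. 0 < ?z $ e} \<noteq> {e. 0 < x $ e}"
      using t(3,4) by (metis (mono_tags, lifting) less_irrefl mem_Collect_eq)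
  qed
  moreover have "{e. 0 < x $ e} \<subseteq> {e. 0 < ?y $ e} \<union> {e. 0 < ?z $ e}"
  proof
    fix e assume "e \<in> {e. 0 < x $ e}"
    then have "0 < x $ e" by simp
    \<comment> \<open>The moves go in opposite directions, so each coordinate is not decreased by at
      least one of them.\<close>
    moreover have "0 \<le> s * u $ e \<or> t * u $ e \<le> 0"
      using s(1) t(1) by (auto simp: zero_le_mult_iff mult_le_0_iff)
    ultimately have "0 < x $ e + s * u $ e \<or> 0 < x $ e - t * u $ e"
      by linarith
    then show "e \<in> {e. 0 < ?y $ e} \<union> {e. 0 < ?z $ e}" by auto
  qed
  ultimately show ?thesis
    using that[OF s(2) t(2)] by blast
qed

text \<open>From the positive point \<open>p\<close> the segment to a relative interior point
  extends beyond it, so that point is positive as well. Conversely, positivity is an open condition,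
  and the other conditions defining the section hold on the whole affine hull.\<close>

lemma rel_interior_simplex_section:
  fixes L :: "(real^'e::finite) set"
  assumes L: "subspace L" and p: "p \<in> simplex_section L" "\<And>e. 0 < p $ e"
  shows "rel_interior (simplex_section L) = {x\<in>simplex_section L. \<forall>e. 0 < x $ e}"
proof
  have cvx: "convex (simplex_section L)"
  proof (rule convexI)
    fix x y :: "real^'e" and u v :: real
    assume "x \<in> simplex_section L" "y \<in> simplex_section L" "0 \<le> u" "0 \<le> v" "u + v = 1"
    then show "u *\<^sub>R x + v *\<^sub>R y \<in> simplex_section L"
      using L by (auto simp: simplex_section_def sum.distrib subspace_add subspace_scale simp flip: sum_distrib_left)
  qed
  show "rel_interior (simplex_section L) \<subseteq> {x\<in>simplex_section L. \<forall>e. 0 < x $ e}"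
  proof
    fix x assume x: "x \<in> rel_interior (simplex_section L)"
    then have "p \<in> affine hull (simplex_section L)"
      using p(1) by (simp add: hull_inc)
    then obtain c where c: "c > 1" "(1 - c) *\<^sub>R p + c *\<^sub>R x \<in> simplex_section L"
      using convex_rel_interior_if2[OF cvx x] by blast
    have "0 < x $ e" for e
    proof -
      have "0 \<le> (1 - c) * p $ e + c * x $ e"
        using c(2) by (simp add: simplex_section_def)
      moreover have "(1 - c) * p $ e < 0"
        using c(1) p(2)[of e] by (simp add: mult_neg_pos)
      ultimately have "0 < c * x $ e" by linarith
      then show ?thesis
        using c(1) by (simp add: zero_less_mult_iff)
    qed
    then show "x \<in> {x\<in>simplex_section L. \<forall>e. 0 < x $ e}"
      using x rel_interior_subset by blast
  qed
  show "{x\<in>simplex_section L. \<forall>e. 0 < x $ e} \<subseteq> rel_interior (simplex_section L)"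
  proof
    fix x assume x: "x \<in> {x\<in>simplex_section L. \<forall>e. 0 < x $ e}"
    let ?T = "{y :: real^'e. \<forall>e. 0 < y $ e}"
    have "?T = (\<Inter>e. {y. 0 < y $ e})"
      by auto
    then have "open ?T"
      by (auto intro!: open_INT open_Collect_less continuous_intros)
    moreover have "x \<in> ?T \<inter> simplex_section L" using x by simp
    moreover have "?T \<inter> affine hull (simplex_section L) \<subseteq> simplex_section L"
    proof -
      have "simplex_section L \<subseteq> L \<inter> {y. (\<Sum>e\<in>UNIV. y $ e) = 1}"
        by (auto simp: simplex_section_def)
      moreover have "affine (L \<inter> {y. (\<Sum>e\<in>UNIV. y $ e) = 1})"
      proof (rule affine_Int[OF subspace_imp_affine[OF L]])
        show "affine {y :: real^'e. (\<Sum>e\<in>UNIV. y $ e) = 1}"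
          by (auto simp: affine_def sum.distrib simp flip: sum_distrib_left)
      qed
      ultimately have "affine hull (simplex_section L) \<subseteq> L \<inter> {y. (\<Sum>e\<in>UNIV. y $ e) = 1}"
        by (rule hull_minimal)
      then show ?thesis
        by (auto simp: simplex_section_def less_imp_le)
    qed
    ultimately show "x \<in> rel_interior (simplex_section L)"
      unfolding mem_rel_interior by blast
  qed
qed

section \<open>Vertices and extremal varieties\<close>

lemma balanced_polytope_eq_simplex_section:
  fixes cell :: "'e::finite \<Rightarrow> (real^'d) set"
  assumes X: "tropical_complex X" and cell: "bij_betw cell UNIV (facets X)"
  obtains L where "subspace L" "balanced_polytope cell X = simplex_section L"
proof -
  note T = tropical_complexD[OF X]
  obtain Z where Z: "lattice_normals X Z"
    using lattice_normals_exist[OF X] .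
  have inv: "inv cell (cell e) = e" for e
    using cell by (simp add: bij_betw_def)
  have cell_inv: "cell (inv cell \<sigma>) = \<sigma>" if "\<sigma> \<in> facets X" for \<sigma>
    using cell that by (metis bij_betw_def f_inv_into_f)
  have facet: "cell e \<in> facets X" for e
    using cell bij_betwE by blast
  \<comment> \<open>Points of the polytope are indexed by \<open>'e\<close>, so the weight of a
    facet is read off through \<open>inv cell\<close>.\<close>
  define B where "B = (\<lambda>\<tau> x. \<Sum>\<sigma>\<in>star_facets X \<tau>. x $ inv cell \<sigma> *\<^sub>R Z \<tau> \<sigma>)"
  define L where "L = {x :: real^'e. \<forall>\<tau>\<in>ridges X. B \<tau> x \<in> parallel_space \<tau>}"
  have lin: "linear (B \<tau>)" for \<tau>
    unfolding B_def by (intro linearI) (simp_all add: scaleR_add_left sum.distrib scaleR_sum_right)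
  have "subspace (parallel_space \<tau>)" if "\<tau> \<in> ridges X" for \<tau>
    using that polyhedral_complex_cell(2)[OF T(1)]
    by (intro subspace_parallel_space) (auto simp: ridges_def)
  then have "subspace L"
    unfolding L_def subspace_def
    by (auto simp: linear_0[OF lin] linear_add[OF lin] linear_cmul[OF lin])
  have "x \<in> balanced_cone cell X \<longleftrightarrow> x \<in> L \<and> (\<forall>e. 0 \<le> x $ e)" for x
  proof -
    have "x \<in> balanced_cone cell X \<longleftrightarrow> balanced X (\<lambda>\<sigma>. x $ inv cell \<sigma>)"
    proof
      assume "x \<in> balanced_cone cell X"
      then obtain \<omega> where \<omega>: "x = (\<chi> e. \<omega> (cell e))" "balanced X \<omega>"
        by (auto simp: balanced_cone_def)
      have eq: "x $ inv cell \<sigma> = \<omega> \<sigma>" if "\<sigma> \<in> facets X" for \<sigma>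
        using that by (simp add: \<omega>(1) cell_inv)
      then have "(\<Sum>\<sigma>\<in>star_facets X \<tau>. x $ inv cell \<sigma> *\<^sub>R Z \<tau> \<sigma>) =
          (\<Sum>\<sigma>\<in>star_facets X \<tau>. \<omega> \<sigma> *\<^sub>R Z \<tau> \<sigma>)" for \<tau>
        by (intro sum.cong) (auto simp: star_facets_def)
      then show "balanced X (\<lambda>\<sigma>. x $ inv cell \<sigma>)"
        using \<omega>(2) eq by (auto simp: balanced_iff[OF T(1,3) Z])
    next
      assume "balanced X (\<lambda>\<sigma>. x $ inv cell \<sigma>)"
      then show "x \<in> balanced_cone cell X"
        unfolding balanced_cone_def
        by (intro CollectI exI[of _ "\<lambda>\<sigma>. x $ inv cell \<sigma>"]) (simp add: inv vec_eq_iff)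
    qed
    moreover have "(\<forall>\<sigma>\<in>facets X. 0 \<le> x $ inv cell \<sigma>) \<longleftrightarrow> (\<forall>e. 0 \<le> x $ e)"
      using facet inv by metis
    ultimately show ?thesis
      by (auto simp: balanced_iff[OF T(1,3) Z] L_def B_def)
  qed
  then have "balanced_polytope cell X = simplex_section L"
    by (auto simp: balanced_polytope_def simplex_section_def)
  with \<open>subspace L\<close> show ?thesis using that by blast
qed

section \<open>From balanced maps to points of the polytope and their supports\<close>

lemma balanced_polytope_I:
  fixes cell :: "'e::finite \<Rightarrow> (real^'d) set"
  assumes X: "tropical_complex X" and cell: "bij_betw cell UNIV (facets X)"
    and \<omega>: "balanced X \<omega>" "\<exists>\<sigma>\<in>facets X. 0 < \<omega> \<sigma>"
  obtains x c where "x \<in> balanced_polytope cell X" "0 < c" "\<And>e. x $ e = c * \<omega> (cell e)"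
proof -
  note T = tropical_complexD[OF X]
  obtain Z where Z: "lattice_normals X Z"
    using lattice_normals_exist[OF X] .
  have ran: "range cell = facets X" using cell by (simp add: bij_betw_def)
  define m where "m = (\<Sum>e\<in>UNIV. \<omega> (cell e))"
  have nonneg: "0 \<le> \<omega> (cell e)" for e
    using \<omega>(1) ran unfolding balanced_def by blast
  obtain e0 where "0 < \<omega> (cell e0)"
    using \<omega>(2) ran by (metis imageE)
  then have m: "0 < m"
    unfolding m_def using nonneg by (intro sum_pos2[of _ e0]) auto
  have "balanced X (\<lambda>\<sigma>. (1 / m) * \<omega> \<sigma>)"
    unfolding balanced_iff[OF T(1,3) Z]
  proof (intro conjI ballI)
    fix \<tau> assume \<tau>: "\<tau> \<in> ridges X"
    then have "subspace (parallel_space \<tau>)"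
      using polyhedral_complex_cell(2)[OF T(1)] by (intro subspace_parallel_space) (auto simp: ridges_def)
    then have "(1 / m) *\<^sub>R (\<Sum>\<sigma>\<in>star_facets X \<tau>. \<omega> \<sigma> *\<^sub>R Z \<tau> \<sigma>) \<in> parallel_space \<tau>"
      using \<omega>(1) \<tau> by (intro subspace_scale) (simp_all add: balanced_iff[OF T(1,3) Z])
    then show "(\<Sum>\<sigma>\<in>star_facets X \<tau>. ((1 / m) * \<omega> \<sigma>) *\<^sub>R Z \<tau> \<sigma>) \<in> parallel_space \<tau>"
      by (simp add: scaleR_sum_right)
  qed (use m \<omega>(1) in \<open>simp add: balanced_def\<close>)
  then have "(\<chi> e. (1 / m) * \<omega> (cell e)) \<in> balanced_cone cell X"
    unfolding balanced_cone_def by (intro CollectI exI[of _ "\<lambda>\<sigma>. (1 / m) * \<omega> \<sigma>"]) simp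
  moreover have "(\<Sum>e\<in>UNIV. (\<chi> e. (1 / m) * \<omega> (cell e)) $ e) = 1"
    using m by (simp add: m_def flip: sum_divide_distrib)
  ultimately show ?thesis
    using that[of "\<chi> e. (1 / m) * \<omega> (cell e)" "1 / m"] m by (simp add: balanced_polytope_def)
qed

text \<open>A relative interior point of a facet lies in no other facet, so the set of facets used
  can be read off from their union.\<close>

lemma support_variety_mono_iff:
  fixes cell :: "'e::finite \<Rightarrow> (real^'d) set"
  assumes X: "polyhedral_complex X" and cell: "bij_betw cell UNIV (facets X)"
  shows "support_variety cell x \<subseteq> support_variety cell y \<longleftrightarrow> {e. 0 < x $ e} \<subseteq> {e. 0 < y $ e}"
proof
  assume sub: "support_variety cell x \<subseteq> support_variety cell y"
  show "{e. 0 < x $ e} \<subseteq> {e. 0 < y $ e}"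
  proof
    fix e assume "e \<in> {e. 0 < x $ e}"
    then have "cell e \<subseteq> support_variety cell x"
      by (auto simp: support_variety_def)
    then have cell_le: "cell e \<subseteq> support_variety cell y"
      using sub by (rule order_trans)
    have facet: "cell e \<in> facets X" for e
      using cell bij_betwE by blast
    then have "convex (cell e)" "cell e \<noteq> {}"
      using polyhedral_complex_cell[OF X] by (auto simp: facets_def)
    then obtain p where p: "p \<in> rel_interior (cell e)"
      using rel_interior_eq_empty by blast
    then have "p \<in> support_variety cell y"
      using cell_le rel_interior_subset by blast
    then obtain f where f: "0 < y $ f" "p \<in> cell f"
      by (auto simp: support_variety_def)
    then have "cell f = cell e"
      using facet_carrier_eq[OF X facet _ p] facet[of f] by (simp add: facets_def)
    then have "f = e"
      using cell by (auto simp: bij_betw_def dest: injD)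
    then show "e \<in> {e. 0 < y $ e}" using f by simp
  qed
next
  assume "{e. 0 < x $ e} \<subseteq> {e. 0 < y $ e}"
  then show "support_variety cell x \<subseteq> support_variety cell y"
    by (auto simp: support_variety_def)
qed

lemma support_variety_eq_Union:
  assumes cell: "bij_betw cell UNIV (facets X)" and iff: "\<And>e. 0 < x $ e \<longleftrightarrow> 0 < \<omega> (cell e)"
  shows "support_variety cell x = \<Union>{\<sigma>\<in>facets X. 0 < \<omega> \<sigma>}"
proof -
  have "range cell = facets X" using cell by (simp add: bij_betw_def)
  then have "{cell e | e. 0 < x $ e} = {\<sigma>\<in>facets X. 0 < \<omega> \<sigma>}"
    using iff by (auto simp flip: \<open>range cell = facets X\<close>)
  then show ?thesis by (simp add: support_variety_def)
qed

lemma support_variety_tropical: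
  fixes cell :: "'e::finite \<Rightarrow> (real^'d) set"
  assumes X: "tropical_complex X" "complex_dim X = int k" and cell: "bij_betw cell UNIV (facets X)"
    and x: "x \<in> balanced_polytope cell X"
  shows "tropical_variety k (support_variety cell x)" "support_variety cell x \<subseteq> \<Union>X"
proof -
  obtain \<omega> where \<omega>: "balanced X \<omega>" "x = (\<chi> e. \<omega> (cell e))"
    using x by (auto simp: balanced_polytope_def balanced_cone_def)
  have eq: "support_variety cell x = \<Union>{\<sigma>\<in>facets X. 0 < \<omega> \<sigma>}"
    using cell by (rule support_variety_eq_Union) (simp add: \<omega>(2))
  have ran: "range cell = facets X" using cell by (simp add: bij_betw_def)
  have "\<exists>e. 0 < \<omega> (cell e)"
  proof (rule ccontr)
    assume "\<nexists>e. 0 < \<omega> (cell e)"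
    then have "(\<Sum>e\<in>UNIV. x $ e) \<le> 0"
      by (intro sum_nonpos) (auto simp: \<omega>(2) not_less)
    then show False using x by (simp add: balanced_polytope_def)
  qed
  then have "\<exists>\<sigma>\<in>facets X. 0 < \<omega> \<sigma>" using ran by blast
  then show "tropical_variety k (support_variety cell x)"
    unfolding eq using support_tropical_variety[OF X \<omega>(1)] by blast
  show "support_variety cell x \<subseteq> \<Union>X"
    unfolding eq by (auto simp: facets_def)
qed

lemma tropical_variety_nonempty: "tropical_variety k D \<Longrightarrow> D \<noteq> {}"
  unfolding tropical_variety_def tropical_complex_def
  using facets_nonempty polyhedral_complex_cell(2) by (fastforce simp: facets_def)

text \<open>The balanced map that cuts out \<open>D\<close> can be normalised to total weight 1,
  since it is nonzero on some facet: \<open>D\<close> is nonempty.\<close>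

lemma tropical_subvariety_support_variety:
  fixes cell :: "'e::finite \<Rightarrow> (real^'d) set"
  assumes X: "tropical_complex X" "complex_dim X = int k" and cell: "bij_betw cell UNIV (facets X)"
    and D: "tropical_variety k D" "D \<subseteq> \<Union>X"
  obtains x where "x \<in> balanced_polytope cell X" "D = support_variety cell x"
proof -
  obtain \<omega> where \<omega>: "balanced X \<omega>" "D = \<Union>{\<sigma>\<in>facets X. 0 < \<omega> \<sigma>}"
    using tropical_subvariety_support[OF X D] .
  then have "\<exists>\<sigma>\<in>facets X. 0 < \<omega> \<sigma>"
    using tropical_variety_nonempty[OF D(1)] by blast
  then obtain x c where x: "x \<in> balanced_polytope cell X" "0 < c" "\<And>e. x $ e = c * \<omega> (cell e)"
    using balanced_polytope_I[OF X(1) cell \<omega>(1)] by blast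
  then have "support_variety cell x = D"
    unfolding \<omega>(2) using cell by (intro support_variety_eq_Union) (simp_all add: zero_less_mult_iff)
  with x(1) show ?thesis using that by blast
qed

text \<open>A convex set of larger dimension would have a relative interior point outside the hulls
  of all members of \<open>F\<close>.\<close>

lemma aff_dim_le_of_covered:
  fixes S :: "'a::euclidean_space set"
  assumes S: "convex S" and F: "finite F" "S \<subseteq> \<Union>F" and le: "\<And>T. T \<in> F \<Longrightarrow> aff_dim T \<le> d"
    and ne: "S \<noteq> {}"
  shows "aff_dim S \<le> d"
proof (rule ccontr)
  assume "\<not> aff_dim S \<le> d"
  then have "\<not> S \<subseteq> affine hull T" if "T \<in> F" for T
    using le[OF that] aff_dim_subset[of S "affine hull T"] by (auto simp: aff_dim_affine_hull)
  then obtain x where "x \<in> rel_interior S" "\<And>T. T \<in> F \<Longrightarrow> x \<notin> affine hull T"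
    using generic_point[OF F(1) openin_rel_interior] S ne rel_interior_eq_empty by metis
  then show False
    using F(2) rel_interior_subset[of S] by (meson UnionE hull_inc subsetD)
qed

text \<open>The pieces of a splitting may have any dimension a priori. Containment in
  \<open>\<Union>X\<close> bounds both dimensions by \<open>k\<close>, and covering a
  \<open>k\<close>-dimensional cell of \<open>D\<close> bounds the larger one from below.\<close>

lemma tropical_union_dim:
  assumes X: "tropical_complex X" "complex_dim X = int k" and D: "tropical_variety k D"
    and C: "tropical_variety k1 C1" "tropical_variety k2 C2" "D = C1 \<union> C2" "D \<subseteq> \<Union>X"
  shows "k1 = k \<or> k2 = k"
proof -
  obtain Y where Y: "tropical_complex Y" "complex_dim Y = int k" "D = \<Union>Y"
    using D by (auto simp: tropical_variety_def)
  obtain Y1 where Y1: "tropical_complex Y1" "complex_dim Y1 = int k1" "C1 = \<Union>Y1"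
    using C(1) by (auto simp: tropical_variety_def)
  obtain Y2 where Y2: "tropical_complex Y2" "complex_dim Y2 = int k2" "C2 = \<Union>Y2"
    using C(2) by (auto simp: tropical_variety_def)
  have le: "complex_dim V \<le> complex_dim W"
    if V: "polyhedral_complex V" "\<Union>V \<subseteq> \<Union>W" and W: "polyhedral_complex W" for V W :: "(real^'a) set set"
  proof -
    obtain \<sigma> where \<sigma>: "\<sigma> \<in> V" "aff_dim \<sigma> = complex_dim V"
      using facets_nonempty[OF V(1)] by (auto simp: facets_def)
    have "aff_dim \<sigma> \<le> complex_dim W"
      using polyhedral_complex_cell(2,3)[OF V(1) \<sigma>(1)] polyhedral_complex_finite[OF W] V(2) \<sigma>(1)
      by (intro aff_dim_le_of_covered[of \<sigma> W] aff_dim_le_complex_dim W) auto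
    then show ?thesis using \<sigma>(2) by simp
  qed
  note P = tropical_complexD(1)
  have "complex_dim Y1 \<le> complex_dim X" "complex_dim Y2 \<le> complex_dim X"
    using le[OF P[OF Y1(1)] _ P[OF X(1)]] le[OF P[OF Y2(1)] _ P[OF X(1)]] C(3,4) Y1(3) Y2(3) by auto
  then have "k1 \<le> k" "k2 \<le> k"
    using X(2) Y1(2) Y2(2) by auto
  moreover have "k \<le> max k1 k2"
  proof -
    obtain \<sigma> where \<sigma>: "\<sigma> \<in> Y" "aff_dim \<sigma> = int k"
      using facets_nonempty[OF P[OF Y(1)]] Y(2) by (auto simp: facets_def)
    have "aff_dim \<sigma> \<le> int (max k1 k2)"
    proof (rule aff_dim_le_of_covered[of \<sigma> "Y1 \<union> Y2"])
      show "\<sigma> \<subseteq> \<Union>(Y1 \<union> Y2)"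
        using \<sigma>(1) Y(3) C(3) Y1(3) Y2(3) by auto
      show "aff_dim T \<le> int (max k1 k2)" if "T \<in> Y1 \<union> Y2" for T
        using that aff_dim_le_complex_dim[OF P[OF Y1(1)], of T] aff_dim_le_complex_dim[OF P[OF Y2(1)], of T]
          Y1(2) Y2(2) by auto
    qed (use polyhedral_complex_cell[OF P[OF Y(1)] \<sigma>(1)] polyhedral_complex_finite P Y1 Y2 in auto)
    then show ?thesis using \<sigma>(2) by simp
  qed
  ultimately show ?thesis by linarith
qed

text \<open>Proper inclusion of varieties is proper inclusion of supports. A point that is not a
  vertex splits into two smaller supports, while no point of the polytope has a support properly
  inside that of a vertex.\<close>

lemma extremal_iff_extreme_point:
  fixes cell :: "'e::finite \<Rightarrow> (real^'d) set"
  assumes X: "tropical_complex X" "complex_dim X = int k" and cell: "bij_betw cell UNIV (facets X)"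
    and x: "x \<in> balanced_polytope cell X"
  shows "extremal_tropical_variety k (support_variety cell x) \<longleftrightarrow>
    x extreme_point_of balanced_polytope cell X"
proof -
  let ?supp = "\<lambda>x. {e. 0 < x $ e}"
  obtain L where L: "subspace L" "balanced_polytope cell X = simplex_section L"
    using balanced_polytope_eq_simplex_section[OF X(1) cell] .
  note mono = support_variety_mono_iff[OF tropical_complexD(1)[OF X(1)] cell]
  have smono: "support_variety cell y \<subset> support_variety cell z \<longleftrightarrow> ?supp y \<subset> ?supp z" for y z
    by (simp only: less_le_not_le mono)
  show ?thesis
  proof
    assume ext: "extremal_tropical_variety k (support_variety cell x)"
    show "x extreme_point_of balanced_polytope cell X"
    proof (rule ccontr)
      assume "\<not> x extreme_point_of balanced_polytope cell X"
      then obtain y z where yz: "y \<in> balanced_polytope cell X" "z \<in> balanced_polytope cell X"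
        "?supp y \<subset> ?supp x" "?supp z \<subset> ?supp x" "?supp x = ?supp y \<union> ?supp z"
        using non_extreme_point_splits[OF L(1)] x L(2) by metis
      have "support_variety cell x = support_variety cell y \<union> support_variety cell z"
        using yz(5) by (auto simp: support_variety_def set_eq_iff)
      then show False
        using ext yz(3,4) support_variety_tropical(1)[OF X cell yz(1)]
          support_variety_tropical(1)[OF X cell yz(2)]
        unfolding extremal_tropical_variety_def smono[symmetric] by blast
    qed
  next
    assume ext: "x extreme_point_of balanced_polytope cell X"
    \<comment> \<open>A single proper subvariety of dimension \<open>k\<close> is already
      impossible, so it is enough that one of the two pieces has this dimension.\<close>
    have no_proper: False if D: "tropical_variety k D" "D \<subset> support_variety cell x" for D
    proof -
      have "D \<subseteq> \<Union>X"
        using D(2) support_variety_tropical(2)[OF X cell x] by blast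
      then obtain y where y: "y \<in> balanced_polytope cell X" "D = support_variety cell y"
        using tropical_subvariety_support_variety[OF X cell D(1)] by blast
      then have "?supp y \<subset> ?supp x"
        using D(2) smono by blast
      then have "y = x"
        using extreme_point_minimal_support[OF L(1)] ext y(1) L(2) by (metis mem_Collect_eq psubsetD)
      then show False using D(2) y(2) by simp
    qed
    show "extremal_tropical_variety k (support_variety cell x)"
      unfolding extremal_tropical_variety_def
    proof (intro conjI notI support_variety_tropical(1)[OF X cell x])
      assume "\<exists>C1 C2 k1 k2. tropical_variety k1 C1 \<and> tropical_variety k2 C2 \<and>
        C1 \<subset> support_variety cell x \<and> C2 \<subset> support_variety cell x \<and> support_variety cell x = C1 \<union> C2"
      then obtain C1 C2 k1 k2 where C: "tropical_variety k1 C1" "tropical_variety k2 C2"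
        "C1 \<subset> support_variety cell x" "C2 \<subset> support_variety cell x" "support_variety cell x = C1 \<union> C2"
        by blast
      then have "k1 = k \<or> k2 = k"
        using tropical_union_dim[OF X] support_variety_tropical[OF X cell x] by blast
      then show False
        using C(1-4) no_proper by blast
    qed
  qed
qed

theorem theorem5p10:
  fixes X :: "(real^'d) set set" and C :: "(real^'d) set" and k n :: nat
    and cell :: "'e::finite \<Rightarrow> (real^'d) set"
    and \<omega> :: "nat \<Rightarrow> real^'e"
  assumes "tropical_complex X" and "complex_dim X = int k" and "C = \<Union>X"
    and "bij_betw cell UNIV (facets X)"
    and "bij_betw \<omega> {1..n} {v. v extreme_point_of balanced_polytope cell X}"
  shows "bij_betw (\<lambda>i. support_variety cell (\<omega> i)) {1..n}
           {D. extremal_tropical_variety k D \<and> D \<subseteq> C} \<and>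
         (\<forall>S\<subseteq>{1..n}.
           extremal_decomposition k ((\<lambda>i. support_variety cell (\<omega> i)) ` S) C \<longleftrightarrow>
           (\<exists>t :: nat \<Rightarrow> real. (\<forall>i\<in>S. 0 < t i \<and> t i \<le> 1) \<and> (\<Sum>i\<in>S. t i) = 1 \<and>
              (\<Sum>i\<in>S. t i *\<^sub>R \<omega> i) \<in> rel_interior (balanced_polytope cell X)))"
proof -
  note X = assms(1,2) and cell = assms(4)
  let ?P = "balanced_polytope cell X" and ?C = "\<lambda>i. support_variety cell (\<omega> i)"
  let ?E = "{v. v extreme_point_of ?P}"
  obtain L where L: "subspace L" "?P = simplex_section L"
    using balanced_polytope_eq_simplex_section[OF X(1) cell] .
  have ext: "\<omega> i extreme_point_of ?P" if "i \<in> {1..n}" for i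
    using bij_betwE[OF assms(5)] that by blast
  then have mem: "\<omega> i \<in> ?P" if "i \<in> {1..n}" for i
    using that by (simp add: extreme_point_of_def)
  \<comment> \<open>The point set determines the support, and the support determines the
    vertex.\<close>
  have inj: "inj_on (support_variety cell) ?E"
  proof (rule inj_onI)
    fix v w assume "v \<in> ?E" "w \<in> ?E" and eq: "support_variety cell v = support_variety cell w"
    moreover from eq have "{e. 0 < v $ e} = {e. 0 < w $ e}"
      using support_variety_mono_iff[OF tropical_complexD(1)[OF X(1)] cell]
      by (intro equalityI) (metis order_refl)+
    ultimately show "v = w"
      using extreme_point_minimal_support[OF L(1), of w v] L(2) by (auto simp: extreme_point_of_def)
  qed
  have "support_variety cell ` ?E = {D. extremal_tropical_variety k D \<and> D \<subseteq> C}"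
  proof
    show "support_variety cell ` ?E \<subseteq> {D. extremal_tropical_variety k D \<and> D \<subseteq> C}"
    proof
      fix D assume "D \<in> support_variety cell ` ?E"
      then obtain v where v: "v extreme_point_of ?P" "D = support_variety cell v" by blast
      then have "v \<in> ?P" by (simp add: extreme_point_of_def)
      then show "D \<in> {D. extremal_tropical_variety k D \<and> D \<subseteq> C}"
        using extremal_iff_extreme_point[OF X cell] support_variety_tropical(2)[OF X cell] assms(3) v
        by simp
    qed
    show "{D. extremal_tropical_variety k D \<and> D \<subseteq> C} \<subseteq> support_variety cell ` ?E"
    proof
      fix D assume "D \<in> {D. extremal_tropical_variety k D \<and> D \<subseteq> C}"
      then have D: "extremal_tropical_variety k D" "D \<subseteq> \<Union>X"
        using assms(3) by auto
      then obtain x where x: "x \<in> ?P" "D = support_variety cell x"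
        using tropical_subvariety_support_variety[OF X cell, of D] by (auto simp: extremal_tropical_variety_def)
      then show "D \<in> support_variety cell ` ?E"
        using extremal_iff_extreme_point[OF X cell x(1)] D(1) by blast
    qed
  qed
  then have "bij_betw (support_variety cell) ?E {D. extremal_tropical_variety k D \<and> D \<subseteq> C}"
    using inj by (simp add: bij_betw_def)
  from bij_betw_trans[OF assms(5) this]
  have bij: "bij_betw ?C {1..n} {D. extremal_tropical_variety k D \<and> D \<subseteq> C}"
    by (simp add: comp_def)
  \<comment> \<open>The weighting of \<open>X\<close>, once normalised, is a point \<open>p\<close>
    of full support whose variety is \<open>C\<close>.\<close>
  obtain w where w: "balanced X w" "weighting X w"
    using X(1) by (auto simp: tropical_complex_def)
  have ran: "range cell = facets X" using cell by (simp add: bij_betw_def)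
  have "\<exists>\<sigma>\<in>facets X. 0 < w \<sigma>"
    using w(2) facets_nonempty[OF tropical_complexD(1)[OF X(1)]] by (auto simp: weighting_def)
  then obtain p c where p: "p \<in> ?P" "0 < c" "\<And>e. p $ e = c * w (cell e)"
    using balanced_polytope_I[OF X(1) cell w(1)] by blast
  have p_pos: "0 < p $ e" for e
    using p(2,3) w(2) ran by (auto simp: weighting_def intro!: mult_pos_pos)
  have relint: "rel_interior ?P = {x\<in>?P. \<forall>e. 0 < x $ e}"
    using rel_interior_simplex_section[OF L(1)] p(1) p_pos L(2) by simp
  have C_eq: "C = support_variety cell p"
    unfolding assms(3) Union_facets[OF tropical_complexD(1,2)[OF X(1)], symmetric] ran[symmetric]
    using p_pos by (auto simp: support_variety_def)
  have nonneg: "0 \<le> x $ e" if "x \<in> ?P" for x e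
    using that L(2) by (simp add: simplex_section_def)
  have "extremal_decomposition k (?C ` S) C \<longleftrightarrow>
      (\<exists>t :: nat \<Rightarrow> real. (\<forall>i\<in>S. 0 < t i \<and> t i \<le> 1) \<and> (\<Sum>i\<in>S. t i) = 1 \<and>
        (\<Sum>i\<in>S. t i *\<^sub>R \<omega> i) \<in> rel_interior ?P)" (is "_ \<longleftrightarrow> ?R") if S: "S \<subseteq> {1..n}" for S
  proof -
    have fin: "finite S" using S finite_subset by blast
    have SP: "\<omega> i \<in> ?P" if "i \<in> S" for i
      using mem S that by blast
    have "extremal_decomposition k (?C ` S) C \<longleftrightarrow> C = (\<Union>i\<in>S. ?C i)"
      using bij_betwE[OF bij] S fin by (auto simp: extremal_decomposition_def)
    also have "\<dots> \<longleftrightarrow> (\<forall>e. \<exists>i\<in>S. 0 < \<omega> i $ e)"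
    proof -
      \<comment> \<open>The indicator vector of the union of the supports makes the union of the
        varieties itself a \<open>support_variety\<close>, so that it can be compared with
        \<open>C\<close>.\<close>
      define y :: "real^'e" where "y = (\<chi> e. if \<exists>i\<in>S. 0 < \<omega> i $ e then 1 else 0)"
      have "(\<Union>i\<in>S. ?C i) = support_variety cell y"
        by (auto simp: support_variety_def y_def split: if_splits)
      moreover have "support_variety cell y \<subseteq> support_variety cell p"
        using p_pos by (auto simp: support_variety_def)
      ultimately have "C = (\<Union>i\<in>S. ?C i) \<longleftrightarrow> support_variety cell p \<subseteq> support_variety cell y"
        unfolding C_eq by auto
      also have "\<dots> \<longleftrightarrow> (\<forall>e. 0 < y $ e)"
        using support_variety_mono_iff[OF tropical_complexD(1)[OF X(1)] cell, of p y] p_pos by auto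
      finally show ?thesis by (simp add: y_def)
    qed
    also have "\<dots> \<longleftrightarrow> ?R"
    proof
      assume cover: "\<forall>e. \<exists>i\<in>S. 0 < \<omega> i $ e"
      then have "S \<noteq> {}" by auto
      then have card: "0 < card S" using fin by (simp add: card_gt_0_iff)
      \<comment> \<open>Equal coefficients suffice: the combination is positive wherever one of the
        vertices is.\<close>
      define t :: "nat \<Rightarrow> real" where "t = (\<lambda>_. 1 / card S)"
      let ?x = "\<Sum>i\<in>S. t i *\<^sub>R \<omega> i"
      have t: "\<forall>i\<in>S. 0 < t i \<and> t i \<le> 1" "(\<Sum>i\<in>S. t i) = 1"
        using card by (auto simp: t_def)
      have "?x \<in> L"
        using SP L by (intro subspace_sum subspace_scale) (auto simp: simplex_section_def)
      moreover have pos: "0 < ?x $ e" for e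
      proof -
        obtain i where i: "i \<in> S" "0 < \<omega> i $ e" using cover by blast
        have "0 < (\<Sum>i\<in>S. t i * \<omega> i $ e)"
        proof (rule sum_pos2[OF fin i(1)])
          show "0 < t i * \<omega> i $ e"
            using t(1) i by simp
          show "0 \<le> t j * \<omega> j $ e" if "j \<in> S" for j
            using t(1) nonneg[OF SP[OF that]] that by (simp add: zero_le_mult_iff less_le)
        qed
        then show ?thesis by simp
      qed
      moreover have "(\<Sum>e\<in>UNIV. ?x $ e) = 1"
      proof -
        have "(\<Sum>e\<in>UNIV. ?x $ e) = (\<Sum>i\<in>S. t i * (\<Sum>e\<in>UNIV. \<omega> i $ e))"
          unfolding sum_distrib_left by (subst sum.swap) simp
        also have "\<dots> = (\<Sum>i\<in>S. t i)"
          using SP by (intro sum.cong) (auto simp: balanced_polytope_def)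
        finally show ?thesis using t(2) by simp
      qed
      ultimately have "?x \<in> ?P"
        unfolding L(2) simplex_section_def by (simp add: less_imp_le)
      then have "?x \<in> rel_interior ?P"
        unfolding relint using pos by simp
      with t show ?R by blast
    next
      assume ?R
      then obtain t :: "nat \<Rightarrow> real" where t: "(\<Sum>i\<in>S. t i *\<^sub>R \<omega> i) \<in> rel_interior ?P"
        by blast
      show "\<forall>e. \<exists>i\<in>S. 0 < \<omega> i $ e"
      proof (rule ccontr)
        assume "\<not> (\<forall>e. \<exists>i\<in>S. 0 < \<omega> i $ e)"
        then obtain e where e: "\<And>i. i \<in> S \<Longrightarrow> \<not> 0 < \<omega> i $ e" by blast
        \<comment> \<open>A coordinate that vanishes at all chosen vertices vanishes on each of
          their linear combinations.\<close>
        then have "\<omega> i $ e = 0" if "i \<in> S" for i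
          using nonneg[OF SP[OF that], of e] e[OF that] by linarith
        then have "(\<Sum>i\<in>S. t i *\<^sub>R \<omega> i) $ e = 0" by simp
        then show False using t unfolding relint by (metis (mono_tags, lifting) less_irrefl mem_Collect_eq)
      qed
    qed
    finally show ?thesis .
  qed
  with bij show ?thesis by blast
qed

end
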